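(* Let $\mathcal V$ be a variation of biextension type over a curve $S$ with self-dual extension data, and let $\delta(s)$ be the (real-valued) Deligne $\delta$-splitting of $\mathcal V_s$. Then $\delta(s)$ is a subharmonic function which vanishes exactly at the points $s\in S$ for which the infinitesimal invariants of the associated normal functions vanish.
   Context: Biextension type: mixed Hodge structures with $\operatorname{gr}^W_0=\mathbb Z(0)$, $\operatorname{gr}^W_{-1}=H$ a pure Hodge structure of weight $-1$ polarized by the alternating form $Q$, $\operatorname{gr}^W_{-2}=\mathbb Z(1)$. A variation of biextension type is a graded-polarized variation of mixed Hodge structure with such fibres $(F_s,W)$. It gives two normal functions: $\nu$, the class of $0\to\operatorname{gr}^W_{-1}\to W_0/W_{-2}\to\mathbb Z(0)\to0$, and the one given by the dual (twisted into $\mathbb Z(1)$) of $0\to\mathbb Z(1)\to W_{-1}\to\operatorname{gr}^W_{-1}\to0$. Self-dual means that these correspond to each other under the isomorphism $H\cong\operatorname{Hom}(H,\mathbb Z(1))$ given by $Q$; infinitesimally (Tate twists suppressed) this says that, with $\gamma^{-1,0}$ and $t$ as defined below, $\gamma^{-1,0}$ on $H$ is the functional $\beta\mapsto-Q(\beta,t)$ with values in $\operatorname{gr}^W_{-2}$. Let $V_{\mathbb C}=\bigoplus I^{p,q}$ be the Deligne bigrading of $(F,W)$: the unique functorial bigrading with $F^p=\bigoplus_{a\ge p}I^{a,b}$, $W_k=\bigoplus_{a+b\le k}I^{a,b}$, $\overline{I^{p,q}}\equiv I^{q,p}$ mod $\bigoplus_{a<q,b<p}I^{a,b}$. $\mathfrak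 g_{\mathbb C}$ (real form $\mathfrak g_{\mathbb R}$) is the Lie algebra of the group of complex automorphisms of $V_{\mathbb C}$ preserving $W$ and the graded polarizations; $\mathfrak g^{a,b}$ consists of the elements mapping each $I^{p,q}$ to $I^{p+a,q+b}$; $\mathfrak q_F=\bigoplus_{a<0}\mathfrak g^{a,b}$. Near a point $s_0$ (coordinate $s$ centred there) the variation is $F(s)=e^{\Gamma(s)}\cdot F$, $F=F(0)$, with $\Gamma$ holomorphic, $\mathfrak q_F$-valued, $\Gamma(0)=0$, and, by horizontality, $\Gamma'(0)\in\bigoplus_b\mathfrak g^{-1,b}$. $\delta_{F,W}\in\mathfrak g^{-1,-1}\cap\mathfrak g_{\mathbb R}$, where $\mathfrak g^{-1,-1}=\operatorname{Hom}(\operatorname{gr}^W_0,\operatorname{gr}^W_{-2})_{\mathbb C}$, is the unique element such that $(e^{-\mathrm i\delta_{F,W}}F,W)$ is split over $\mathbb R$ (i.e. its Deligne bigrading satisfies $\overline{I^{p,q}}=I^{q,p}$); using fixed real bases of $\operatorname{gr}^W_0$, $\operatorname{gr}^W_{-2}$ (and a normalization constant depending only on $W$) it is viewed as a real number $\delta(s)$ for $F=F_s$. Infinitesimal invariant at $s_0$: let $e(0)\in I^{0,0}_F$ lift $1\in\mathbb Z(0)$, and let $\gamma^{-1,0}$ be the component of type $(-1,0)$ of $\Gamma'(0)$; the infinitesimal invariant of $\nu$ at $s_0$ is identified with $t=\gamma^{-1,0}(e(0))\in I^{-1,0}_F$; by self-duality that of the dual normal function vanishes exactly when $t$ does.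
   Formalization: "Vanishes exactly" is proved for the Laplacian of δ(s), not for δ(s) itself: with H = 0 and a constant non-split extension of Z(0) by Z(1), the infinitesimal invariants vanish but δ is a nonzero constant. The normalization constant of δ is taken positive. *)

theory Defs
  imports
    "HOL-Complex_Analysis.Complex_Analysis"
    "HOL-Library.Groups_Big_Fun"
    "HOL-Library.Set_Algebras"
begin

text \<open>
  Encoding.  The complex vector space underlying every fibre is the type \<open>complex ^ 'n\<close>, its
  integral structure is the standard lattice and complex conjugation is componentwise.
  A lattice of biextension type is given by three parameters:
  \<^item> \<open>eps\<close>, the projection onto \<open>gr 0 = Z(0)\<close>, so that \<open>W (-1)\<close> is its kernel;
  \<^item> \<open>tw\<close>, the generator of the lattice of \<open>W (-2) = Z(1)\<close>;
  \<^item> \<open>Q\<close>, the polarization of \<open>H = gr (-1)\<close>, regarded as a form on \<open>W (-1)\<close> whose radical contains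
    \<open>W (-2)\<close>.  Tate twists are suppressed: \<open>Q\<close> takes values in \<open>Z\<close> instead of \<open>Z(1)\<close>, via the
    generator \<open>tw\<close>.

  Weight and Hodge filtrations are families of subsets of \<open>complex ^ 'n\<close> indexed by \<open>int\<close>, and
  endomorphisms are matrices.
\<close>

subsection \<open>Linear algebra\<close>

definition cnjv :: "complex ^ 'n \<Rightarrow> complex ^ 'n::finite" where
  "cnjv v = (\<chi> i. cnj (v $ i))"

definition int_lattice :: "(complex ^ 'n::finite) set" where
  "int_lattice = {v. \<forall>i. v $ i \<in> \<int>}"

definition real_matrix :: "complex ^ 'n ^ 'n::finite \<Rightarrow> bool" where
  "real_matrix A \<longleftrightarrow> (\<forall>i j. A $ i $ j \<in> \<real>)"

definition cscale_matrix :: "complex \<Rightarrow> complex ^ 'n ^ 'n \<Rightarrow> complex ^ 'n ^ 'n::finite" where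
  "cscale_matrix c A = (\<chi> i j. c * A $ i $ j)"

definition mexp :: "complex ^ 'n ^ 'n \<Rightarrow> complex ^ 'n ^ 'n::finite" where
  "mexp A = suminf (\<lambda>k. (((**) A ^^ k) (mat 1)) /\<^sub>R fact k)"

definition bilinear_on ::
    "(complex ^ 'n) set \<Rightarrow> (complex ^ 'n) set \<Rightarrow> (complex ^ 'n \<Rightarrow> complex ^ 'n \<Rightarrow> complex) \<Rightarrow> bool" where
  "bilinear_on V W B \<longleftrightarrow>
     (\<forall>v\<in>V. \<forall>v'\<in>V. \<forall>w\<in>W. B (v + v') w = B v w + B v' w) \<and>
     (\<forall>v\<in>V. \<forall>w\<in>W. \<forall>w'\<in>W. B v (w + w') = B v w + B v w') \<and>
     (\<forall>v\<in>V. \<forall>w\<in>W. \<forall>a. B (a *s v) w = a * B v w \<and> B v (a *s w) = a * B v w)"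

text \<open>Finite decompositions \<open>v = \<Sum>k. c k\<close> with \<open>c k \<in> A k\<close>.  The value of \<open>component\<close> is only
  meaningful when \<open>v\<close> has exactly one such decomposition.\<close>

definition decomposes :: "('k \<Rightarrow> 'v::comm_monoid_add set) \<Rightarrow> ('k \<Rightarrow> 'v) \<Rightarrow> 'v \<Rightarrow> bool" where
  "decomposes A c v \<longleftrightarrow> (\<forall>k. c k \<in> A k) \<and> finite {k. c k \<noteq> 0} \<and> v = Sum_any c"

definition sum_over :: "('k \<Rightarrow> 'v::comm_monoid_add set) \<Rightarrow> 'k set \<Rightarrow> 'v set" where
  "sum_over A K = {v. \<exists>c. decomposes A c v \<and> (\<forall>k. k \<notin> K \<longrightarrow> c k = 0)}"

definition component :: "('k \<Rightarrow> 'v::comm_monoid_add set) \<Rightarrow> 'k \<Rightarrow> 'v \<Rightarrow> 'v" where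
  "component A k v = (THE c. decomposes A c v) k"

subsection \<open>Mixed Hodge structures of biextension type\<close>

definition wfil :: "(complex ^ 'n \<Rightarrow> complex) \<Rightarrow> complex ^ 'n \<Rightarrow> int \<Rightarrow> (complex ^ 'n::finite) set" where
  "wfil eps tw k =
     (if k \<ge> 0 then UNIV
      else if k = -1 then {v. eps v = 0}
      else if k = -2 then range (\<lambda>a. a *s tw)
      else {0})"

definition biext_lattice ::
    "(complex ^ 'n \<Rightarrow> complex) \<Rightarrow> complex ^ 'n \<Rightarrow> (complex ^ 'n \<Rightarrow> complex ^ 'n \<Rightarrow> complex) \<Rightarrow> bool" where
  "biext_lattice eps tw Q \<longleftrightarrow>
     Vector_Spaces.linear (*s) (*) eps \<and> eps ` int_lattice = \<int> \<and>
     tw \<noteq> 0 \<and> eps tw = 0 \<and> wfil eps tw (-2) \<inter> int_lattice = (\<lambda>a. a *s tw) ` \<int> \<and>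
     bilinear_on (wfil eps tw (-1)) (wfil eps tw (-1)) Q \<and>
     (\<forall>v \<in> wfil eps tw (-1). Q v v = 0) \<and>
     (\<forall>v \<in> wfil eps tw (-1). Q v tw = 0) \<and>
     (\<forall>v \<in> wfil eps tw (-1) \<inter> int_lattice. \<forall>w \<in> wfil eps tw (-1) \<inter> int_lattice. Q v w \<in> \<int>)"

text \<open>The filtration induced by \<open>F\<close> on \<open>W k / W (k - 1)\<close>, as subspaces of \<open>W k\<close> containing
  \<open>W (k - 1)\<close>.\<close>

definition grF ::
    "(complex ^ 'n \<Rightarrow> complex) \<Rightarrow> complex ^ 'n \<Rightarrow> (int \<Rightarrow> (complex ^ 'n) set)
      \<Rightarrow> int \<Rightarrow> int \<Rightarrow> (complex ^ 'n::finite) set" where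
  "grF eps tw F k p = (F p \<inter> wfil eps tw k) + wfil eps tw (k - 1)"

definition hodge_filtration :: "(int \<Rightarrow> (complex ^ 'n::finite) set) \<Rightarrow> bool" where
  "hodge_filtration F \<longleftrightarrow>
     (\<forall>p. vec.subspace (F p)) \<and> antimono F \<and> (\<exists>p. F p = UNIV) \<and> (\<exists>p. F p = {0})"

text \<open>Purity of weight \<open>k\<close> of \<open>W k / W (k - 1)\<close> is the direct sum decomposition into the step \<open>p\<close>
  of the filtration and the conjugate of its step \<open>k + 1 - p\<close>.\<close>

definition mixed_hodge ::
    "(complex ^ 'n \<Rightarrow> complex) \<Rightarrow> complex ^ 'n \<Rightarrow> (int \<Rightarrow> (complex ^ 'n::finite) set) \<Rightarrow> bool" where
  "mixed_hodge eps tw F \<longleftrightarrow> hodge_filtration F \<and>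
     (\<forall>k p. grF eps tw F k p + cnjv ` grF eps tw F k (k + 1 - p) = wfil eps tw k \<and>
            grF eps tw F k p \<inter> cnjv ` grF eps tw F k (k + 1 - p) = wfil eps tw (k - 1))"

text \<open>The Riemann bilinear relations on \<open>gr (-1)\<close>; the Weil operator is \<open>\<i> powi (p - q)\<close> on
  type \<open>(p, q)\<close>.  On \<open>gr 0\<close> and \<open>gr (-2)\<close> the polarizations are the standard ones.\<close>

definition polarized ::
    "(complex ^ 'n \<Rightarrow> complex) \<Rightarrow> complex ^ 'n \<Rightarrow> (complex ^ 'n \<Rightarrow> complex ^ 'n \<Rightarrow> complex)
      \<Rightarrow> (int \<Rightarrow> (complex ^ 'n::finite) set) \<Rightarrow> bool" where
  "polarized eps tw Q F \<longleftrightarrow>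
     (\<forall>p. \<forall>u \<in> grF eps tw F (-1) p. \<forall>v \<in> grF eps tw F (-1) (-p). Q u v = 0) \<and>
     (\<forall>p q. p + q = -1 \<longrightarrow>
        (\<forall>u \<in> grF eps tw F (-1) p \<inter> cnjv ` grF eps tw F (-1) q - wfil eps tw (-2).
           \<exists>r>0. \<i> powi (p - q) * Q u (cnjv u) = of_real r))"

subsection \<open>Deligne bigrading and the splitting \<open>\<delta>\<close>\<close>

definition deligne_bigrading ::
    "(complex ^ 'n \<Rightarrow> complex) \<Rightarrow> complex ^ 'n \<Rightarrow> (int \<Rightarrow> (complex ^ 'n) set)
      \<Rightarrow> (int \<times> int \<Rightarrow> (complex ^ 'n::finite) set) \<Rightarrow> bool" where
  "deligne_bigrading eps tw F I \<longleftrightarrow>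
     (\<forall>k. vec.subspace (I k)) \<and> (\<forall>v. \<exists>!c. decomposes I c v) \<and>
     (\<forall>p. F p = sum_over I {(a, b). a \<ge> p}) \<and>
     (\<forall>k. wfil eps tw k = sum_over I {(a, b). a + b \<le> k}) \<and>
     (\<forall>p q. cnjv ` I (p, q) + sum_over I {(a, b). a < q \<and> b < p}
           = I (q, p) + sum_over I {(a, b). a < q \<and> b < p})"

definition Ipq ::
    "(complex ^ 'n \<Rightarrow> complex) \<Rightarrow> complex ^ 'n \<Rightarrow> (int \<Rightarrow> (complex ^ 'n) set)
      \<Rightarrow> int \<times> int \<Rightarrow> (complex ^ 'n::finite) set" where
  "Ipq eps tw F = (THE I. deligne_bigrading eps tw F I)"

definition split_over_reals ::
    "(complex ^ 'n \<Rightarrow> complex) \<Rightarrow> complex ^ 'n \<Rightarrow> (int \<Rightarrow> (complex ^ 'n::finite) set) \<Rightarrow> bool" where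
  "split_over_reals eps tw F \<longleftrightarrow>
     (\<exists>I. deligne_bigrading eps tw F I \<and> (\<forall>p q. cnjv ` I (p, q) = I (q, p)))"

text \<open>The complex Lie algebra: \<open>X\<close> acts by zero on \<open>gr 0\<close> and \<open>gr (-2)\<close> (the infinitesimal isometries of
  a one-dimensional space with a symmetric form) and by an infinitesimal isometry of \<open>Q\<close> on
  \<open>gr (-1)\<close>.  The first two conditions already imply that \<open>X\<close> preserves \<open>W\<close>.\<close>

definition lie_alg ::
    "(complex ^ 'n \<Rightarrow> complex) \<Rightarrow> complex ^ 'n \<Rightarrow> (complex ^ 'n \<Rightarrow> complex ^ 'n \<Rightarrow> complex)
      \<Rightarrow> (complex ^ 'n ^ 'n::finite) set" where
  "lie_alg eps tw Q = {X. (\<forall>v. eps (X *v v) = 0) \<and> X *v tw = 0 \<and>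
     (\<forall>u \<in> wfil eps tw (-1). \<forall>v \<in> wfil eps tw (-1). Q (X *v u) v + Q u (X *v v) = 0)}"

definition lie_comp ::
    "(complex ^ 'n \<Rightarrow> complex) \<Rightarrow> complex ^ 'n \<Rightarrow> (complex ^ 'n \<Rightarrow> complex ^ 'n \<Rightarrow> complex)
      \<Rightarrow> (int \<Rightarrow> (complex ^ 'n) set) \<Rightarrow> int \<times> int \<Rightarrow> (complex ^ 'n ^ 'n::finite) set" where
  "lie_comp eps tw Q F = (\<lambda>(a, b). {X \<in> lie_alg eps tw Q.
     \<forall>p q. (*v) X ` Ipq eps tw F (p, q) \<subseteq> Ipq eps tw F (p + a, q + b)})"

definition deligne_delta_op ::
    "(complex ^ 'n \<Rightarrow> complex) \<Rightarrow> complex ^ 'n \<Rightarrow> (complex ^ 'n \<Rightarrow> complex ^ 'n \<Rightarrow> complex)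
      \<Rightarrow> (int \<Rightarrow> (complex ^ 'n) set) \<Rightarrow> complex ^ 'n ^ 'n::finite" where
  "deligne_delta_op eps tw Q F =
     (THE X. X \<in> lie_comp eps tw Q F (-1, -1) \<and> real_matrix X \<and>
        split_over_reals eps tw (\<lambda>p. (*v) (mexp (cscale_matrix (- \<i>) X)) ` F p))"

text \<open>The coordinate with respect to the generators of \<open>gr 0\<close> and \<open>gr (-2)\<close>.\<close>

definition deligne_delta ::
    "(complex ^ 'n \<Rightarrow> complex) \<Rightarrow> complex ^ 'n \<Rightarrow> (complex ^ 'n \<Rightarrow> complex ^ 'n \<Rightarrow> complex)
      \<Rightarrow> (int \<Rightarrow> (complex ^ 'n::finite) set) \<Rightarrow> real" where
  "deligne_delta eps tw Q F =
     (THE d. \<forall>v. deligne_delta_op eps tw Q F *v v = (of_real d * eps v) *s tw)"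

subsection \<open>Curves\<close>

definition chart_inv :: "('i \<Rightarrow> 's set) \<Rightarrow> ('i \<Rightarrow> 's \<Rightarrow> complex) \<Rightarrow> 'i \<Rightarrow> complex \<Rightarrow> 's" where
  "chart_inv U chart i = inv_into (U i) (chart i)"

definition curve :: "'s topology \<Rightarrow> ('i \<Rightarrow> 's set) \<Rightarrow> ('i \<Rightarrow> 's \<Rightarrow> complex) \<Rightarrow> bool" where
  "curve S U chart \<longleftrightarrow>
     Hausdorff_space S \<and> connected_space S \<and> topspace S = (\<Union>i. U i) \<and>
     (\<forall>i. openin S (U i) \<and> open (chart i ` U i) \<and>
          homeomorphic_map (subtopology S (U i)) (top_of_set (chart i ` U i)) (chart i)) \<and>
     (\<forall>i j. (chart j \<circ> chart_inv U chart i) holomorphic_on chart i ` (U i \<inter> U j))"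

text \<open>Subharmonicity of a real-valued function: upper semicontinuity and the local submean
  inequality.\<close>

definition subharmonic_on :: "complex set \<Rightarrow> (complex \<Rightarrow> real) \<Rightarrow> bool" where
  "subharmonic_on D u \<longleftrightarrow> open D \<and>
     (\<forall>z\<in>D. \<forall>y > u z. eventually (\<lambda>w. u w < y) (nhds z)) \<and>
     (\<forall>z\<in>D. \<exists>R>0. cball z R \<subseteq> D \<and> (\<forall>r. 0 < r \<and> r < R \<longrightarrow>
        (\<lambda>t. u (z + of_real r * cis t)) absolutely_integrable_on {0..2 * pi} \<and>
        u z \<le> integral {0..2 * pi} (\<lambda>t. u (z + of_real r * cis t)) / (2 * pi)))"

definition subharmonic_on_curve ::
    "('i \<Rightarrow> 's set) \<Rightarrow> ('i \<Rightarrow> 's \<Rightarrow> complex) \<Rightarrow> ('s \<Rightarrow> real) \<Rightarrow> bool" where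
  "subharmonic_on_curve U chart u \<longleftrightarrow>
     (\<forall>i. subharmonic_on (chart i ` U i) (u \<circ> chart_inv U chart i))"

text \<open>\<open>u\<close> is differentiable near \<open>z\<close>, its partial derivatives are differentiable at \<open>z\<close>, and the Laplacian
  at \<open>z\<close> has the value \<open>L\<close>.\<close>

definition has_laplacian :: "(complex \<Rightarrow> real) \<Rightarrow> real \<Rightarrow> complex \<Rightarrow> bool" where
  "has_laplacian u L z \<longleftrightarrow>
     (\<exists>ux uy uxx uxy uyx uyy.
        eventually (\<lambda>w. (u has_derivative (\<lambda>h. ux w * Re h + uy w * Im h)) (at w)) (nhds z) \<and>
        (ux has_derivative (\<lambda>h. uxx * Re h + uxy * Im h)) (at z) \<and>
        (uy has_derivative (\<lambda>h. uyx * Re h + uyy * Im h)) (at z) \<and>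
        L = uxx + uyy)"

subsection \<open>Variations of biextension type\<close>

text \<open>Integral automorphisms preserving \<open>W\<close> and \<open>Q\<close> and inducing the identity on \<open>gr 0 = Z(0)\<close> and
  \<open>gr (-2) = Z(1)\<close>.\<close>

definition biext_aut ::
    "(complex ^ 'n \<Rightarrow> complex) \<Rightarrow> complex ^ 'n \<Rightarrow> (complex ^ 'n \<Rightarrow> complex ^ 'n \<Rightarrow> complex)
      \<Rightarrow> complex ^ 'n ^ 'n::finite \<Rightarrow> bool" where
  "biext_aut eps tw Q g \<longleftrightarrow>
     bij ((*v) g) \<and> (*v) g ` int_lattice = int_lattice \<and>
     (\<forall>v. eps (g *v v) = eps v) \<and> g *v tw = tw \<and>
     (\<forall>u \<in> wfil eps tw (-1). \<forall>v \<in> wfil eps tw (-1). Q (g *v u) (g *v v) = Q u v)"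

text \<open>The fibre at \<open>s\<close> is the model lattice with Hodge filtration \<open>Fil s\<close>.  The local system is given by
  its flat frames: \<open>frame i s\<close> is the identification of the fibre at \<open>s\<close> with the model which is
  flat over \<open>U i\<close>.  In this frame the Hodge filtration becomes \<open>flat_fil frame Fil i s\<close>.\<close>

definition flat_fil ::
    "('i \<Rightarrow> 's \<Rightarrow> complex ^ 'n ^ 'n) \<Rightarrow> ('s \<Rightarrow> int \<Rightarrow> (complex ^ 'n) set)
      \<Rightarrow> 'i \<Rightarrow> 's \<Rightarrow> int \<Rightarrow> (complex ^ 'n::finite) set" where
  "flat_fil frame Fil i s p = (*v) (frame i s) ` Fil s p"

definition local_system ::
    "'s topology \<Rightarrow> ('i \<Rightarrow> 's set) \<Rightarrow> (complex ^ 'n \<Rightarrow> complex) \<Rightarrow> complex ^ 'n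
      \<Rightarrow> (complex ^ 'n \<Rightarrow> complex ^ 'n \<Rightarrow> complex)
      \<Rightarrow> ('i \<Rightarrow> 's \<Rightarrow> complex ^ 'n ^ 'n::finite) \<Rightarrow> bool" where
  "local_system S U eps tw Q frame \<longleftrightarrow>
     (\<forall>i. \<forall>s \<in> U i. biext_aut eps tw Q (frame i s)) \<and>
     (\<forall>i j. \<forall>s \<in> U i \<inter> U j. \<exists>N g. openin S N \<and> s \<in> N \<and> N \<subseteq> U i \<inter> U j \<and>
        (\<forall>s' \<in> N. frame j s' = g ** frame i s'))"

text \<open>\<open>\<Gamma>\<close> is a holomorphic function near \<open>chart i s\<close>, zero at that point, with values in the sum \<open>q\<close> of
  the \<open>g\<^sup>a\<^sup>,\<^sup>b\<close> with \<open>a < 0\<close>, such that the Hodge filtration in the flat frame is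
  \<open>exp (\<Gamma> z) F\<close>, where \<open>F\<close> is its value at \<open>s\<close>.\<close>

definition local_lift ::
    "('i \<Rightarrow> 's set) \<Rightarrow> ('i \<Rightarrow> 's \<Rightarrow> complex) \<Rightarrow> (complex ^ 'n \<Rightarrow> complex) \<Rightarrow> complex ^ 'n
      \<Rightarrow> (complex ^ 'n \<Rightarrow> complex ^ 'n \<Rightarrow> complex) \<Rightarrow> ('i \<Rightarrow> 's \<Rightarrow> complex ^ 'n ^ 'n)
      \<Rightarrow> ('s \<Rightarrow> int \<Rightarrow> (complex ^ 'n) set) \<Rightarrow> 'i \<Rightarrow> 's
      \<Rightarrow> (complex \<Rightarrow> complex ^ 'n ^ 'n::finite) \<Rightarrow> bool" where
  "local_lift U chart eps tw Q frame Fil i s \<Gamma> \<longleftrightarrow>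
     (\<exists>r>0. ball (chart i s) r \<subseteq> chart i ` U i \<and>
        (\<forall>k l. (\<lambda>z. \<Gamma> z $ k $ l) holomorphic_on ball (chart i s) r) \<and>
        \<Gamma> (chart i s) = 0 \<and>
        (\<forall>z \<in> ball (chart i s) r.
           \<Gamma> z \<in> sum_over (lie_comp eps tw Q (flat_fil frame Fil i s)) {(a, b). a < 0} \<and>
           (\<forall>p. flat_fil frame Fil i (chart_inv U chart i z) p
                = (*v) (mexp (\<Gamma> z)) ` flat_fil frame Fil i s p)))"

definition matrix_deriv :: "(complex \<Rightarrow> complex ^ 'n ^ 'n) \<Rightarrow> complex \<Rightarrow> complex ^ 'n ^ 'n::finite" where
  "matrix_deriv \<Gamma> z = (\<chi> k l. deriv (\<lambda>w. \<Gamma> w $ k $ l) z)"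

text \<open>Holomorphy of the Hodge filtration is expressed by the local lifts: \<open>\<Gamma> \<mapsto> exp \<Gamma> F\<close>
  is a local holomorphic coordinate on the compact dual of the classifying space at \<open>F\<close>.  Modulo the
  stabilizer of \<open>F\<close>, Griffiths transversality at \<open>s\<close> says that the derivative of \<open>\<Gamma>\<close> lies in the sum of
  the \<open>g\<^sup>-\<^sup>1\<^sup>,\<^sup>b\<close>.\<close>

definition biext_variation ::
    "'s topology \<Rightarrow> ('i \<Rightarrow> 's set) \<Rightarrow> ('i \<Rightarrow> 's \<Rightarrow> complex)
      \<Rightarrow> (complex ^ 'n \<Rightarrow> complex) \<Rightarrow> complex ^ 'n \<Rightarrow> (complex ^ 'n \<Rightarrow> complex ^ 'n \<Rightarrow> complex)
      \<Rightarrow> ('i \<Rightarrow> 's \<Rightarrow> complex ^ 'n ^ 'n) \<Rightarrow> ('s \<Rightarrow> int \<Rightarrow> (complex ^ 'n::finite) set) \<Rightarrow> bool" where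
  "biext_variation S U chart eps tw Q frame Fil \<longleftrightarrow>
     biext_lattice eps tw Q \<and> local_system S U eps tw Q frame \<and>
     (\<forall>s \<in> topspace S. mixed_hodge eps tw (Fil s) \<and> polarized eps tw Q (Fil s)) \<and>
     (\<forall>i. \<forall>s \<in> U i. \<exists>\<Gamma>. local_lift U chart eps tw Q frame Fil i s \<Gamma> \<and>
        matrix_deriv \<Gamma> (chart i s)
          \<in> sum_over (lie_comp eps tw Q (flat_fil frame Fil i s)) {(a, b). a = -1})"

text \<open>Self-duality: near every point there is a flat morphism, given by a pairing \<open>B\<close>, from the
  extension \<open>W 0 / W (-2)\<close> of \<open>Z(0)\<close> by \<open>H\<close> to the extension \<open>Hom (W (-1), Z(1))\<close> of \<open>Z(0)\<close> by
  \<open>Hom (H, Z(1))\<close>, which induces the map \<open>x \<mapsto> Q(-, x)\<close> on \<open>H\<close> and the identity on \<open>Z(0)\<close>.  The step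
  \<open>p\<close> of \<open>Hom (W (-1), Z(1))\<close> is the annihilator of the step \<open>-p\<close> of \<open>W (-1)\<close>, because \<open>Z(1)\<close> has
  type \<open>(-1, -1)\<close>.  There is at most one such morphism of mixed Hodge structures at each point (a
  difference of two is a morphism from \<open>Z(0)\<close> to a structure of weight \<open>-1\<close>), so that the local morphisms
  glue to a morphism over the whole curve.  The order of the arguments of \<open>Q\<close> is the sign
  convention for which the component of type \<open>(-1, 0)\<close> of the derivative of \<open>\<Gamma>\<close> is
  \<open>\<beta> \<mapsto> - Q(\<beta>, t)\<close> on \<open>H\<close>.\<close>

definition self_dual ::
    "'s topology \<Rightarrow> ('i \<Rightarrow> 's set) \<Rightarrow> (complex ^ 'n \<Rightarrow> complex) \<Rightarrow> complex ^ 'n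
      \<Rightarrow> (complex ^ 'n \<Rightarrow> complex ^ 'n \<Rightarrow> complex)
      \<Rightarrow> ('i \<Rightarrow> 's \<Rightarrow> complex ^ 'n ^ 'n) \<Rightarrow> ('s \<Rightarrow> int \<Rightarrow> (complex ^ 'n::finite) set) \<Rightarrow> bool" where
  "self_dual S U eps tw Q frame Fil \<longleftrightarrow>
     (\<forall>i. \<forall>s \<in> U i. \<exists>N B. openin S N \<and> s \<in> N \<and> N \<subseteq> U i \<and>
        bilinear_on UNIV (wfil eps tw (-1)) B \<and>
        (\<forall>v \<in> int_lattice. \<forall>w \<in> wfil eps tw (-1) \<inter> int_lattice. B v w \<in> \<int>) \<and>
        (\<forall>x \<in> wfil eps tw (-1). \<forall>w \<in> wfil eps tw (-1). B x w = Q w x) \<and>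
        (\<forall>v. B v tw = eps v) \<and>
        (\<forall>s' \<in> N. \<forall>p. \<forall>v \<in> flat_fil frame Fil i s' p.
           \<forall>w \<in> flat_fil frame Fil i s' (-p) \<inter> wfil eps tw (-1). B v w = 0))"

subsection \<open>Infinitesimal invariants\<close>

text \<open>The component of type \<open>(-1, 0)\<close> of the derivative of \<open>\<Gamma>\<close> at \<open>s\<close>; the germ of \<open>\<Gamma>\<close> at \<open>s\<close> is
  unique.\<close>

definition gamma_m1_0 ::
    "('i \<Rightarrow> 's set) \<Rightarrow> ('i \<Rightarrow> 's \<Rightarrow> complex) \<Rightarrow> (complex ^ 'n \<Rightarrow> complex) \<Rightarrow> complex ^ 'n
      \<Rightarrow> (complex ^ 'n \<Rightarrow> complex ^ 'n \<Rightarrow> complex) \<Rightarrow> ('i \<Rightarrow> 's \<Rightarrow> complex ^ 'n ^ 'n)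
      \<Rightarrow> ('s \<Rightarrow> int \<Rightarrow> (complex ^ 'n) set) \<Rightarrow> 'i \<Rightarrow> 's \<Rightarrow> complex ^ 'n ^ 'n::finite" where
  "gamma_m1_0 U chart eps tw Q frame Fil i s =
     component (lie_comp eps tw Q (flat_fil frame Fil i s)) (-1, 0)
       (THE D. \<exists>\<Gamma>. local_lift U chart eps tw Q frame Fil i s \<Gamma> \<and> D = matrix_deriv \<Gamma> (chart i s))"

definition inf_invariant ::
    "('i \<Rightarrow> 's set) \<Rightarrow> ('i \<Rightarrow> 's \<Rightarrow> complex) \<Rightarrow> (complex ^ 'n \<Rightarrow> complex) \<Rightarrow> complex ^ 'n
      \<Rightarrow> (complex ^ 'n \<Rightarrow> complex ^ 'n \<Rightarrow> complex) \<Rightarrow> ('i \<Rightarrow> 's \<Rightarrow> complex ^ 'n ^ 'n)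
      \<Rightarrow> ('s \<Rightarrow> int \<Rightarrow> (complex ^ 'n) set) \<Rightarrow> 'i \<Rightarrow> 's \<Rightarrow> complex ^ 'n::finite" where
  "inf_invariant U chart eps tw Q frame Fil i s =
     gamma_m1_0 U chart eps tw Q frame Fil i s
       *v (THE e. e \<in> Ipq eps tw (flat_fil frame Fil i s) (0, 0) \<and> eps e = 1)"

text \<open>The infinitesimal invariant of the dual normal function is the functional on \<open>gr (-1)\<close> with
  values in \<open>gr (-2)\<close> induced by the same component.\<close>

definition dual_inf_invariant_vanishes ::
    "('i \<Rightarrow> 's set) \<Rightarrow> ('i \<Rightarrow> 's \<Rightarrow> complex) \<Rightarrow> (complex ^ 'n \<Rightarrow> complex) \<Rightarrow> complex ^ 'n
      \<Rightarrow> (complex ^ 'n \<Rightarrow> complex ^ 'n \<Rightarrow> complex) \<Rightarrow> ('i \<Rightarrow> 's \<Rightarrow> complex ^ 'n ^ 'n)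
      \<Rightarrow> ('s \<Rightarrow> int \<Rightarrow> (complex ^ 'n::finite) set) \<Rightarrow> 'i \<Rightarrow> 's \<Rightarrow> bool" where
  "dual_inf_invariant_vanishes U chart eps tw Q frame Fil i s \<longleftrightarrow>
     (\<forall>\<beta> \<in> wfil eps tw (-1). gamma_m1_0 U chart eps tw Q frame Fil i s *v \<beta> = 0)"

end

(*
  Let e generate I^{0,0} with eps e = 1.  Then the imaginary part of e is delta * tw.  At a point with
  F = F(0) and F(z) = g(z) F, g = exp Gamma, write W_{-1} = A + conj A + C tw with A the
  intersection of F^0 and W_{-1}, and solve g a + conj(g) b + c tw = g e - conj(g e) - (e - conj e) with a in A and b in conj A.  Then
  g e - g a generates I^{0,0} of F(z), so that delta(z) = delta(0) + c(z) / 2i.  This is a linear system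
  which is trivial at 0, and differentiating it twice gives the Laplacian of c.  With D = Gamma'(0) and
  t the component of D e of type (-1,0), horizontality yields
    Laplacian c = 4 x - 4 conj x,  where x is the tw-component of D (conj t),
  and differentiating the self-duality pairing yields x = - Q(conj t, t).  By the Riemann bilinear relations
  this is i r with r >= 0 and r = 0 only for t = 0; hence the Laplacian of delta is 4 r.

  A function with nonnegative Laplacian has the submean property by the maximum principle, after
  approximation of its boundary values on a circle by harmonic polynomials.
*)

theory Submission
  imports Defs
begin

subsection \<open>Second order jets of complex-valued functions\<close>

no_notation fps_nth (infixl \<open>$\<close> 75)

text \<open>The splitting is reached through a chain of unique descriptions, among them the
  bigrading, the operator, its coordinate and the derivative of \<open>\<Gamma>\<close>. Each has to
  be shown legitimate before anything can be computed; this is the purpose of the algebraic half.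
  The analytic obstacle is that I^{0,0} of a nearby fibre depends on the filtration and on its
  conjugate, so that its generator is not holomorphic in \<open>z\<close>. The linear system refers
  the unknowns back to the fixed decomposition at the centre. Its matrix and its right-hand side are
  sums of a holomorphic and an antiholomorphic function, hence have Laplacian zero, and the
  Laplacian of the solution at the centre arises only from products of first derivatives. Therefore
  the derivative of \<open>\<Gamma>\<close> at the centre, where horizontality is assumed,
  determines it, and a gradient together with a Laplacian is all that must be recorded of a
  function. Every point of the curve is the centre of its own germ, so the Laplacian is never
  computed at another point of the disc.\<close>

abbreviation lin2 :: "complex \<Rightarrow> complex \<Rightarrow> complex \<Rightarrow> complex" where
  "lin2 a b \<equiv> (\<lambda>h. a * of_real (Re h) + b * of_real (Im h))"

text \<open>The gradient of \<open>f\<close> at \<open>z\<close> is \<open>(a, b)\<close> and its Laplacian is \<open>L\<close>.\<close>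

definition has_jet2 :: "(complex \<Rightarrow> complex) \<Rightarrow> complex \<Rightarrow> complex \<Rightarrow> complex \<Rightarrow> complex \<Rightarrow> bool" where
  "has_jet2 f a b L z \<longleftrightarrow>
     (\<exists>fx fy Dx Dy.
        eventually (\<lambda>w. (f has_derivative lin2 (fx w) (fy w)) (at w)) (nhds z) \<and>
        (fx has_derivative Dx) (at z) \<and> (fy has_derivative Dy) (at z) \<and>
        fx z = a \<and> fy z = b \<and> Dx 1 + Dy \<i> = L)"

lemma has_jet2I:
  assumes "eventually (\<lambda>w. (f has_derivative lin2 (fx w) (fy w)) (at w)) (nhds z)"
    "(fx has_derivative Dx) (at z)" "(fy has_derivative Dy) (at z)"
    "fx z = a" "fy z = b" "Dx 1 + Dy \<i> = L"
  shows "has_jet2 f a b L z"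
  unfolding has_jet2_def by (intro exI conjI) (rule assms)+

lemma has_jet2E:
  assumes "has_jet2 f a b L z"
  obtains fx fy Dx Dy where
    "eventually (\<lambda>w. (f has_derivative lin2 (fx w) (fy w)) (at w)) (nhds z)"
    "(fx has_derivative Dx) (at z)" "(fy has_derivative Dy) (at z)"
    "fx z = a" "fy z = b" "Dx 1 + Dy \<i> = L" "(f has_derivative lin2 a b) (at z)"
proof -
  obtain fx fy Dx Dy where *:
    "eventually (\<lambda>w. (f has_derivative lin2 (fx w) (fy w)) (at w)) (nhds z)"
    "(fx has_derivative Dx) (at z)" "(fy has_derivative Dy) (at z)"
    "fx z = a" "fy z = b" "Dx 1 + Dy \<i> = L"
    using assms unfolding has_jet2_def by blast
  have "(f has_derivative lin2 a b) (at z)"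
    using eventually_nhds_x_imp_x[OF *(1)] by (simp only: *(4,5))
  with * show ?thesis by (rule that)
qed

lemma has_jet2_isCont: "has_jet2 f a b L z \<Longrightarrow> isCont f z"
  by (erule has_jet2E) (rule has_derivative_continuous)

lemma isCont_eventually_nonzero:
  fixes f :: "complex \<Rightarrow> complex"
  assumes "isCont f z" "f z \<noteq> 0"
  shows "eventually (\<lambda>w. f w \<noteq> 0) (nhds z)"
proof -
  have "(f \<longlongrightarrow> f z) (nhds z)"
    using assms(1) by (simp add: isCont_def tendsto_at_iff_tendsto_nhds)
  then show ?thesis using assms(2) by (rule tendsto_imp_eventually_ne)
qed

lemma has_jet2_cong:
  assumes "has_jet2 f a b L z" "eventually (\<lambda>w. f w = g w) (nhds z)"
  shows "has_jet2 g a b L z"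
proof -
  from assms(1) obtain fx fy fDx fDy where f:
    "eventually (\<lambda>w. (f has_derivative lin2 (fx w) (fy w)) (at w)) (nhds z)"
    "(fx has_derivative fDx) (at z)" "(fy has_derivative fDy) (at z)"
    "fx z = a" "fy z = b" "fDx 1 + fDy \<i> = L" "(f has_derivative lin2 a b) (at z)"
    by (rule has_jet2E)
  have "eventually (\<lambda>w. eventually (\<lambda>w. f w = g w) (nhds w)) (nhds z)"
    using assms(2) by (simp add: eventually_eventually)
  with f(1) have "eventually (\<lambda>w. (g has_derivative lin2 (fx w) (fy w)) (at w)) (nhds z)"
  proof eventually_elim
    case (elim w)
    have "eventually (\<lambda>w. f w = g w) (at w)" using elim(2) by (simp add: eventually_nhds_conv_at)
    with elim(1) show ?case
      by (rule has_derivative_transform_eventually) (use eventually_nhds_x_imp_x[OF elim(2)] in auto)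
  qed
  from has_jet2I[OF this f(2-6)] show ?thesis .
qed

text \<open>The gradient functions of two jets agree near \<open>z\<close> because derivatives are
  unique; hence so do their derivatives at \<open>z\<close>, and with them the Laplacians.\<close>

lemma has_jet2_unique:
  assumes "has_jet2 f a b L z" "has_jet2 f a' b' L' z"
  shows "a = a'" "b = b'" "L = L'"
proof -
  have D: "p = p' \<and> q = q'"
    if "(f has_derivative lin2 p q) (at w)" "(f has_derivative lin2 p' q') (at w)" for f p q p' q' w
    using fun_cong[OF has_derivative_unique[OF that], of 1] fun_cong[OF has_derivative_unique[OF that], of \<i>]
    by auto
  from assms(1) obtain fx fy fDx fDy where f:
    "eventually (\<lambda>w. (f has_derivative lin2 (fx w) (fy w)) (at w)) (nhds z)"
    "(fx has_derivative fDx) (at z)" "(fy has_derivative fDy) (at z)"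
    "fx z = a" "fy z = b" "fDx 1 + fDy \<i> = L" "(f has_derivative lin2 a b) (at z)"
    by (rule has_jet2E)
  from assms(2) obtain gx gy gDx gDy where g:
    "eventually (\<lambda>w. (f has_derivative lin2 (gx w) (gy w)) (at w)) (nhds z)"
    "(gx has_derivative gDx) (at z)" "(gy has_derivative gDy) (at z)"
    "gx z = a'" "gy z = b'" "gDx 1 + gDy \<i> = L'" "(f has_derivative lin2 a' b') (at z)"
    by (rule has_jet2E)
  have e: "eventually (\<lambda>w. fx w = gx w \<and> fy w = gy w) (nhds z)"
    using f(1) g(1) by eventually_elim (rule D)
  from eventually_nhds_x_imp_x[OF e] show ab: "a = a'" "b = b'" by (simp_all add: f(4,5) g(4,5))
  have ea: "eventually (\<lambda>w. fx w = gx w) (at z)" "eventually (\<lambda>w. fy w = gy w) (at z)"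
    using e by (auto simp: eventually_nhds_conv_at elim: eventually_mono)
  have "(gx has_derivative fDx) (at z)"
    by (rule has_derivative_transform_eventually[OF f(2) ea(1)]) (simp_all add: ab f(4) g(4))
  then have "fDx = gDx" using g(2) by (rule has_derivative_unique)
  moreover have "(gy has_derivative fDy) (at z)"
    by (rule has_derivative_transform_eventually[OF f(3) ea(2)]) (simp_all add: ab f(5) g(5))
  then have "fDy = gDy" using g(3) by (rule has_derivative_unique)
  ultimately show "L = L'" by (simp only: f(6)[symmetric] g(6)[symmetric])
qed

lemma has_jet2_const: "has_jet2 (\<lambda>w. c) 0 0 0 z"
  by (rule has_jet2I[OF _ has_derivative_const has_derivative_const]) auto

lemma has_jet2_add:
  assumes "has_jet2 f a b L z" "has_jet2 g a' b' L' z"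
  shows "has_jet2 (\<lambda>w. f w + g w) (a + a') (b + b') (L + L') z"
proof -
  from assms(1) obtain fx fy fDx fDy where f:
    "eventually (\<lambda>w. (f has_derivative lin2 (fx w) (fy w)) (at w)) (nhds z)"
    "(fx has_derivative fDx) (at z)" "(fy has_derivative fDy) (at z)"
    "fx z = a" "fy z = b" "fDx 1 + fDy \<i> = L" "(f has_derivative lin2 a b) (at z)"
    by (rule has_jet2E)
  from assms(2) obtain gx gy gDx gDy where g:
    "eventually (\<lambda>w. (g has_derivative lin2 (gx w) (gy w)) (at w)) (nhds z)"
    "(gx has_derivative gDx) (at z)" "(gy has_derivative gDy) (at z)"
    "gx z = a'" "gy z = b'" "gDx 1 + gDy \<i> = L'" "(g has_derivative lin2 a' b') (at z)"
    by (rule has_jet2E)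
  show ?thesis
  proof (rule has_jet2I[OF _ has_derivative_add[OF f(2) g(2)] has_derivative_add[OF f(3) g(3)]])
    show "eventually (\<lambda>w. ((\<lambda>w. f w + g w) has_derivative lin2 (fx w + gx w) (fy w + gy w)) (at w)) (nhds z)"
      using f(1) g(1)
    proof eventually_elim
      case (elim w)
      show ?case using has_derivative_add[OF elim] by (simp add: algebra_simps)
    qed
  qed (simp_all add: f(4,5) g(4,5) f(6)[symmetric] g(6)[symmetric])
qed

text \<open>The Leibniz rule; its cross term is twice the complex bilinear product of the gradients.
  The result depends only on values, gradients and Laplacians of the factors, so mixed second
  derivatives never have to be recorded.\<close>

lemma has_jet2_mult:
  assumes "has_jet2 f a b L z" "has_jet2 g a' b' L' z"
  shows "has_jet2 (\<lambda>w. f w * g w) (a * g z + f z * a') (b * g z + f z * b')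
    (L * g z + f z * L' + 2 * (a * a' + b * b')) z"
proof -
  from assms(1) obtain fx fy fDx fDy where f:
    "eventually (\<lambda>w. (f has_derivative lin2 (fx w) (fy w)) (at w)) (nhds z)"
    "(fx has_derivative fDx) (at z)" "(fy has_derivative fDy) (at z)"
    "fx z = a" "fy z = b" "fDx 1 + fDy \<i> = L" "(f has_derivative lin2 a b) (at z)"
    by (rule has_jet2E)
  from assms(2) obtain gx gy gDx gDy where g:
    "eventually (\<lambda>w. (g has_derivative lin2 (gx w) (gy w)) (at w)) (nhds z)"
    "(gx has_derivative gDx) (at z)" "(gy has_derivative gDy) (at z)"
    "gx z = a'" "gy z = b'" "gDx 1 + gDy \<i> = L'" "(g has_derivative lin2 a' b') (at z)"
    by (rule has_jet2E)
  note d = has_derivative_add[OF has_derivative_mult has_derivative_mult]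
  show ?thesis
  proof (rule has_jet2I[OF _ d[OF f(2) g(7) f(7) g(2)] d[OF f(3) g(7) f(7) g(3)]])
    show "eventually (\<lambda>w. ((\<lambda>w. f w * g w) has_derivative
        lin2 (fx w * g w + f w * gx w) (fy w * g w + f w * gy w)) (at w)) (nhds z)"
      using f(1) g(1)
    proof eventually_elim
      case (elim w)
      show ?case using has_derivative_mult[OF elim] by (simp add: algebra_simps)
    qed
  qed (simp_all add: f(4,5) g(4,5) f(6)[symmetric] g(6)[symmetric] algebra_simps)
qed

lemma has_jet2_mult_const:
  assumes "has_jet2 f a b L z"
  shows "has_jet2 (\<lambda>w. f w * c) (a * c) (b * c) (L * c) z"
  using has_jet2_mult[OF assms has_jet2_const[of c]] by simp

lemma has_jet2_diff:
  assumes "has_jet2 f a b L z" "has_jet2 g a' b' L' z"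
  shows "has_jet2 (\<lambda>w. f w - g w) (a - a') (b - b') (L - L') z"
  using has_jet2_add[OF assms(1) has_jet2_mult_const[OF assms(2), of "-1"]] by simp

lemma has_jet2_cnj:
  assumes "has_jet2 f a b L z"
  shows "has_jet2 (\<lambda>w. cnj (f w)) (cnj a) (cnj b) (cnj L) z"
proof -
  from assms(1) obtain fx fy fDx fDy where f:
    "eventually (\<lambda>w. (f has_derivative lin2 (fx w) (fy w)) (at w)) (nhds z)"
    "(fx has_derivative fDx) (at z)" "(fy has_derivative fDy) (at z)"
    "fx z = a" "fy z = b" "fDx 1 + fDy \<i> = L" "(f has_derivative lin2 a b) (at z)"
    by (rule has_jet2E)
  show ?thesis
  proof (rule has_jet2I[OF _ has_derivative_cnj[OF f(2)] has_derivative_cnj[OF f(3)]])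
    show "eventually (\<lambda>w. ((\<lambda>w. cnj (f w)) has_derivative lin2 (cnj (fx w)) (cnj (fy w))) (at w)) (nhds z)"
      using f(1)
    proof eventually_elim
      case (elim w)
      show ?case using has_derivative_cnj[OF elim] by simp
    qed
  qed (simp_all add: f(4,5) f(6)[symmetric])
qed

text \<open>By the Cauchy-Riemann equations the gradient is the complex derivative times (1, \<i>),
  and the Laplacian is the second complex derivative times 1 + \<i>^2.\<close>

lemma has_jet2_holomorphic:
  assumes "f holomorphic_on A" "open A" "z \<in> A"
  shows "has_jet2 f (deriv f z) (\<i> * deriv f z) 0 z"
proof (rule has_jet2I)
  have "eventually (\<lambda>w. w \<in> A) (nhds z)" using assms by (simp add: eventually_nhds_in_open)
  then show "eventually (\<lambda>w. (f has_derivative lin2 (deriv f w) (\<i> * deriv f w)) (at w)) (nhds z)"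
  proof eventually_elim
    case (elim w)
    have "deriv f w * of_real (Re h) + (\<i> * deriv f w) * of_real (Im h) = deriv f w * h" for h
      by (simp add: complex_eq_iff algebra_simps)
    then show ?case
      using holomorphic_derivI[OF assms(1,2) elim] by (simp add: has_field_derivative_def)
  qed
  have d: "(deriv f has_derivative (*) (deriv (deriv f) z)) (at z)"
    using holomorphic_derivI[OF holomorphic_deriv[OF assms(1,2)] assms(2,3)] by (simp add: has_field_derivative_def)
  then show "(deriv f has_derivative (*) (deriv (deriv f) z)) (at z)" .
  show "((\<lambda>w. \<i> * deriv f w) has_derivative (\<lambda>h. \<i> * (deriv (deriv f) z * h))) (at z)"
    by (rule has_derivative_mult_right[OF d])
qed (auto simp: complex_eq_iff)

lemma has_jet2_inverse:
  assumes "has_jet2 f a b L z" "f z \<noteq> 0"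
  shows "\<exists>a' b' L'. has_jet2 (\<lambda>w. inverse (f w)) a' b' L' z"
proof -
  from assms(1) obtain fx fy fDx fDy where f:
    "eventually (\<lambda>w. (f has_derivative lin2 (fx w) (fy w)) (at w)) (nhds z)"
    "(fx has_derivative fDx) (at z)" "(fy has_derivative fDy) (at z)"
    "fx z = a" "fy z = b" "fDx 1 + fDy \<i> = L" "(f has_derivative lin2 a b) (at z)"
    by (rule has_jet2E)
  have ne: "eventually (\<lambda>w. f w \<noteq> 0) (nhds z)"
    using has_jet2_isCont[OF assms(1)] assms(2) by (rule isCont_eventually_nonzero)
  note i = Deriv.has_derivative_inverse[OF assms(2) f(7)]
  note d = has_derivative_minus[OF has_derivative_mult[OF has_derivative_mult[OF i] i]]
  have e: "eventually (\<lambda>w. ((\<lambda>w. inverse (f w)) has_derivative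
      lin2 (- (inverse (f w) * fx w * inverse (f w))) (- (inverse (f w) * fy w * inverse (f w)))) (at w)) (nhds z)"
    using f(1) ne
  proof eventually_elim
    case (elim w)
    show ?case using Deriv.has_derivative_inverse[OF elim(2,1)] by (simp add: algebra_simps)
  qed
  show ?thesis by (intro exI) (rule has_jet2I[OF e d[OF f(2)] d[OF f(3)] refl refl refl])
qed

lemma has_jet2_sum:
  assumes "finite A" "\<And>j. j \<in> A \<Longrightarrow> has_jet2 (f j) (a j) (b j) (L j) z"
  shows "has_jet2 (\<lambda>w. \<Sum>j\<in>A. f j w) (\<Sum>j\<in>A. a j) (\<Sum>j\<in>A. b j) (\<Sum>j\<in>A. L j) z"
  using assms
proof (induction A rule: finite_induct)
  case empty
  show ?case using has_jet2_const[of 0] by simp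
next
  case (insert x A)
  from has_jet2_add[OF insert.prems[of x] insert.IH] insert show ?case by simp
qed

text \<open>For quotients of determinants the mere existence of a jet is enough; its values follow
  later from differentiating the equation that the quotient solves.\<close>

definition twice_diff :: "(complex \<Rightarrow> complex) \<Rightarrow> complex \<Rightarrow> bool" where
  "twice_diff f z \<longleftrightarrow> (\<exists>a b L. has_jet2 f a b L z)"

lemma twice_diffI: "has_jet2 f a b L z \<Longrightarrow> twice_diff f z"
  by (auto simp: twice_diff_def)

lemma twice_diff_add: "twice_diff f z \<Longrightarrow> twice_diff g z \<Longrightarrow> twice_diff (\<lambda>w. f w + g w) z"
  unfolding twice_diff_def by (elim exE) (rule exI, rule exI, rule exI, rule has_jet2_add)

lemma twice_diff_mult: "twice_diff f z \<Longrightarrow> twice_diff g z \<Longrightarrow> twice_diff (\<lambda>w. f w * g w) z"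
  unfolding twice_diff_def by (elim exE) (rule exI, rule exI, rule exI, rule has_jet2_mult)

lemma twice_diff_const: "twice_diff (\<lambda>w. c) z"
  using has_jet2_const twice_diffI by blast

lemma twice_diff_divide:
  "twice_diff f z \<Longrightarrow> twice_diff g z \<Longrightarrow> g z \<noteq> 0 \<Longrightarrow> twice_diff (\<lambda>w. f w / g w) z"
  unfolding divide_inverse
  by (rule twice_diff_mult) (auto simp: twice_diff_def intro: has_jet2_inverse)

lemma twice_diff_sum:
  "finite A \<Longrightarrow> (\<And>j. j \<in> A \<Longrightarrow> twice_diff (f j) z) \<Longrightarrow> twice_diff (\<lambda>w. \<Sum>j\<in>A. f j w) z"
proof (induction A rule: finite_induct)
  case (insert x A)
  then show ?case by (simp add: twice_diff_add)
qed (simp add: twice_diff_const)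

lemma twice_diff_prod:
  "finite A \<Longrightarrow> (\<And>j. j \<in> A \<Longrightarrow> twice_diff (f j) z) \<Longrightarrow> twice_diff (\<lambda>w. \<Prod>j\<in>A. f j w) z"
  by (induction A rule: finite_induct) (auto intro: twice_diff_mult twice_diff_const)

lemma twice_diff_det:
  fixes A :: "complex \<Rightarrow> complex ^ 'n ^ 'n"
  assumes "\<And>i j. twice_diff (\<lambda>w. A w $ i $ j) z"
  shows "twice_diff (\<lambda>w. det (A w)) z"
  unfolding det_def
proof (rule twice_diff_sum)
  fix p assume "p \<in> {p. p permutes (UNIV :: 'n set)}"
  have "twice_diff (\<lambda>w. \<Prod>i\<in>UNIV. A w $ i $ p i) z" by (rule twice_diff_prod) (auto intro: assms)
  then show "twice_diff (\<lambda>w. of_int (sign p) * (\<Prod>i\<in>UNIV. A w $ i $ p i)) z"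
    by (rule twice_diff_mult[OF twice_diff_const])
qed (simp add: finite_permutations)

section \<open>Complex jets and real Laplacians\<close>

lemma Re_has_derivative_form:
  assumes "(f has_derivative D) (at z)"
  shows "((\<lambda>w. Re (f w)) has_derivative (\<lambda>h. Re (D 1) * Re h + Re (D \<i>) * Im h)) (at z)"
proof -
  interpret bounded_linear D by (rule has_derivative_bounded_linear[OF assms])
  have form: "D h = Re h *\<^sub>R D 1 + Im h *\<^sub>R D \<i>" for h
  proof -
    have "h = Re h *\<^sub>R 1 + Im h *\<^sub>R \<i>" by (simp add: complex_eq_iff)
    then have "D h = D (Re h *\<^sub>R 1 + Im h *\<^sub>R \<i>)" by (rule arg_cong)
    then show ?thesis by (simp only: add scaleR)
  qed
  have "(\<lambda>h. Re (D h)) = (\<lambda>h. Re (D 1) * Re h + Re (D \<i>) * Im h)"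
    by (rule ext) (rule trans[OF arg_cong[OF form, of Re]], simp)
  with has_derivative_Re[OF assms] show ?thesis by (simp only:)
qed

lemma has_jet2_imp_has_laplacian:
  assumes "has_jet2 f a b L z"
  shows "has_laplacian (\<lambda>w. Re (f w)) (Re L) z"
proof -
  from assms(1) obtain fx fy fDx fDy where f:
    "eventually (\<lambda>w. (f has_derivative lin2 (fx w) (fy w)) (at w)) (nhds z)"
    "(fx has_derivative fDx) (at z)" "(fy has_derivative fDy) (at z)"
    "fx z = a" "fy z = b" "fDx 1 + fDy \<i> = L" "(f has_derivative lin2 a b) (at z)"
    by (rule has_jet2E)
  have "eventually (\<lambda>w. ((\<lambda>w. Re (f w)) has_derivative
      (\<lambda>h. Re (fx w) * Re h + Re (fy w) * Im h)) (at w)) (nhds z)"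
    using f(1)
  proof eventually_elim
    case (elim w)
    show ?case using has_derivative_Re[OF elim] by simp
  qed
  with Re_has_derivative_form[OF f(2)] Re_has_derivative_form[OF f(3)] show ?thesis
    unfolding has_laplacian_def f(6)[symmetric] plus_complex.sel by (intro exI conjI) (assumption | rule refl)+
qed

lemma has_laplacian_imp_has_jet2:
  assumes "has_laplacian u L z"
  shows "\<exists>a b. has_jet2 (\<lambda>w. of_real (u w)) a b (of_real L) z"
proof -
  obtain ux uy uxx uxy uyx uyy where
    u: "eventually (\<lambda>w. (u has_derivative (\<lambda>h. ux w * Re h + uy w * Im h)) (at w)) (nhds z)"
    "(ux has_derivative (\<lambda>h. uxx * Re h + uxy * Im h)) (at z)"
    "(uy has_derivative (\<lambda>h. uyx * Re h + uyy * Im h)) (at z)" "L = uxx + uyy"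
    using assms unfolding has_laplacian_def by blast
  have "eventually (\<lambda>w. ((\<lambda>w. of_real (u w)) has_derivative lin2 (of_real (ux w)) (of_real (uy w))) (at w)) (nhds z)"
    using u(1)
  proof eventually_elim
    case (elim w)
    show ?case using has_derivative_of_real[OF elim] by simp
  qed
  from has_jet2I[OF this has_derivative_of_real[OF u(2)] has_derivative_of_real[OF u(3)] refl refl, of "of_real L"]
  show ?thesis by (auto simp: u(4))
qed

lemma has_laplacian_isCont:
  assumes "has_laplacian u L z"
  shows "isCont u z"
proof -
  obtain a b where "has_jet2 (\<lambda>w. of_real (u w)) a b (of_real L) z"
    using has_laplacian_imp_has_jet2[OF assms] by blast
  from isCont_Re[OF has_jet2_isCont[OF this]] show ?thesis by simp
qed

lemma has_laplacian_cong:
  assumes "has_laplacian u L z" "eventually (\<lambda>w. u w = v w) (nhds z)"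
  shows "has_laplacian v L z"
proof -
  obtain a b where "has_jet2 (\<lambda>w. of_real (u w)) a b (of_real L) z"
    using has_laplacian_imp_has_jet2[OF assms(1)] by blast
  moreover have "eventually (\<lambda>w. of_real (u w) = complex_of_real (v w)) (nhds z)"
    using assms(2) by (rule eventually_mono) simp
  ultimately have "has_jet2 (\<lambda>w. of_real (v w)) a b (of_real L) z" by (rule has_jet2_cong)
  from has_jet2_imp_has_laplacian[OF this] show ?thesis by simp
qed

lemma has_laplacian_add:
  assumes "has_laplacian u L z" "has_laplacian v K z"
  shows "has_laplacian (\<lambda>w. u w + v w) (L + K) z"
proof -
  obtain a b a' b' where "has_jet2 (\<lambda>w. of_real (u w)) a b (of_real L) z"
    "has_jet2 (\<lambda>w. of_real (v w)) a' b' (of_real K) z"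
    using assms[THEN has_laplacian_imp_has_jet2] by blast
  from has_jet2_imp_has_laplacian[OF has_jet2_add[OF this]] show ?thesis by simp
qed

lemma has_laplacian_cmult:
  assumes "has_laplacian u L z"
  shows "has_laplacian (\<lambda>w. c * u w) (c * L) z"
proof -
  obtain a b where "has_jet2 (\<lambda>w. of_real (u w)) a b (of_real L) z"
    using assms[THEN has_laplacian_imp_has_jet2] by blast
  from has_jet2_imp_has_laplacian[OF has_jet2_mult_const[OF this, of "of_real c"]] show ?thesis
    by (simp add: mult.commute)
qed

text \<open>The squared norm is the product of \<open>w - a\<close> and its conjugate, with
  gradients (1, \<i>) and (1, -\<i>); the cross term of the Leibniz rule gives 2 * (1 + 1) =
  4.\<close>

lemma has_laplacian_norm_sq: "has_laplacian (\<lambda>w. (cmod (w - a))\<^sup>2) 4 z"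
proof -
  have "has_jet2 (\<lambda>w. w - a) 1 \<i> 0 z"
    using has_jet2_holomorphic[of "\<lambda>w. w - a" UNIV z] by (simp add: holomorphic_intros)
  from has_jet2_imp_has_laplacian[OF has_jet2_mult[OF this has_jet2_cnj[OF this]]]
  show ?thesis unfolding cmod_power2 by (simp add: power2_eq_square algebra_simps)
qed

text \<open>Cramer's rule expresses the solution near \<open>z\<close> by quotients of determinants,
  which makes it twice differentiable. Since the matrix is the identity and \<open>x\<close>
  vanishes at \<open>z\<close>, the Leibniz rule for \<open>M w *v x w = y w\<close> first gives
  equal gradients of \<open>x\<close> and \<open>y\<close>. As \<open>M\<close> and \<open>y\<close>
  have Laplacian zero, it then expresses the Laplacian of \<open>x\<close> by the cross terms
  alone.\<close>

lemma has_jet2_linear_system: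
  fixes M :: "complex \<Rightarrow> complex ^ 'n ^ 'n" and y :: "complex \<Rightarrow> complex ^ 'n"
  assumes M: "\<And>i j. has_jet2 (\<lambda>w. M w $ i $ j) (Mx $ i $ j) (My $ i $ j) 0 z"
    and y: "\<And>i. has_jet2 (\<lambda>w. y w $ i) (yx $ i) (yy $ i) 0 z"
    and M1: "M z = mat 1" and y0: "y z = 0"
  shows "\<exists>x. eventually (\<lambda>w. M w *v x w = y w) (nhds z) \<and>
    (\<forall>i. has_jet2 (\<lambda>w. x w $ i) (yx $ i) (yy $ i) ((- 2 *s (Mx *v yx + My *v yy)) $ i) z)"
proof -
  let ?N = "\<lambda>w k. (\<chi> i j. if j = k then y w $ i else M w $ i $ j)"
  define x where "x w = (\<chi> k. det (?N w k) / det (M w))" for w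
  have dM: "twice_diff (\<lambda>w. det (M w)) z" by (rule twice_diff_det) (rule twice_diffI[OF M])
  have dN: "twice_diff (\<lambda>w. det (?N w k)) z" for k
  proof (rule twice_diff_det)
    show "twice_diff (\<lambda>w. ?N w k $ i $ j) z" for i j
      using twice_diffI[OF M] twice_diffI[OF y] by (cases "j = k") auto
  qed
  have dMz: "det (M z) \<noteq> 0" by (simp add: M1)
  have ne: "eventually (\<lambda>w. det (M w) \<noteq> 0) (nhds z)"
  proof -
    have "isCont (\<lambda>w. det (M w)) z" using dM has_jet2_isCont unfolding twice_diff_def by blast
    then show ?thesis using dMz by (rule isCont_eventually_nonzero)
  qed
  have eq: "eventually (\<lambda>w. M w *v x w = y w) (nhds z)"
    using ne
  proof eventually_elim
    case (elim w)
    show ?case by (subst cramer[OF elim]) (simp add: x_def)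
  qed
  have xz: "x z = 0" using eventually_nhds_x_imp_x[OF eq] by (simp add: M1 y0)
  have "\<forall>k. \<exists>a b L. has_jet2 (\<lambda>w. x w $ k) a b L z"
    using twice_diff_divide[OF dN dM dMz] by (simp add: x_def twice_diff_def)
  then obtain a b L where x: "\<And>k. has_jet2 (\<lambda>w. x w $ k) (a k) (b k) (L k) z" by metis
  have id: "(\<Sum>j\<in>UNIV. mat 1 $ i $ j * f j) = f i" for f :: "'n \<Rightarrow> complex" and i
    using arg_cong[OF matrix_vector_mul_lid[of "\<chi> j. f j"], of "\<lambda>v. v $ i"]
    by (simp add: matrix_vector_mult_def)
  have "a i = yx $ i \<and> b i = yy $ i \<and> L i + 2 * (\<Sum>j\<in>UNIV. Mx $ i $ j * a j + My $ i $ j * b j) = 0" for i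
  proof -
    have "has_jet2 (\<lambda>w. \<Sum>j\<in>UNIV. M w $ i $ j * x w $ j)
      (\<Sum>j\<in>UNIV. Mx $ i $ j * x z $ j + M z $ i $ j * a j) (\<Sum>j\<in>UNIV. My $ i $ j * x z $ j + M z $ i $ j * b j)
      (\<Sum>j\<in>UNIV. 0 * x z $ j + M z $ i $ j * L j + 2 * (Mx $ i $ j * a j + My $ i $ j * b j)) z"
    proof (rule has_jet2_sum[OF finite])
      fix j
      show "has_jet2 (\<lambda>w. M w $ i $ j * x w $ j) (Mx $ i $ j * x z $ j + M z $ i $ j * a j)
          (My $ i $ j * x z $ j + M z $ i $ j * b j)
          (0 * x z $ j + M z $ i $ j * L j + 2 * (Mx $ i $ j * a j + My $ i $ j * b j)) z"
        by (rule has_jet2_mult[OF M[of i j] x[of j]])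
    qed
    then have "has_jet2 (\<lambda>w. (M w *v x w) $ i) (a i) (b i)
        (L i + 2 * (\<Sum>j\<in>UNIV. Mx $ i $ j * a j + My $ i $ j * b j)) z"
      by (simp add: matrix_vector_mult_def xz M1 id sum.distrib flip: sum_distrib_left)
    moreover have "eventually (\<lambda>w. (M w *v x w) $ i = y w $ i) (nhds z)"
      using eq by (rule eventually_mono) simp
    ultimately have "has_jet2 (\<lambda>w. y w $ i) (a i) (b i)
        (L i + 2 * (\<Sum>j\<in>UNIV. Mx $ i $ j * a j + My $ i $ j * b j)) z"
      by (rule has_jet2_cong)
    from has_jet2_unique[OF this y[of i]] show ?thesis by blast
  qed
  then have ab: "\<And>i. a i = yx $ i" "\<And>i. b i = yy $ i"
    and L: "\<And>i. L i + 2 * (\<Sum>j\<in>UNIV. Mx $ i $ j * a j + My $ i $ j * b j) = 0" by blast+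
  have "L i = (- 2 *s (Mx *v yx + My *v yy)) $ i" for i
  proof -
    have "L i = - (2 * (\<Sum>j\<in>UNIV. Mx $ i $ j * a j + My $ i $ j * b j))"
      using L[of i] by (simp add: eq_neg_iff_add_eq_0)
    then show ?thesis by (simp add: ab matrix_vector_mult_def sum.distrib)
  qed
  then have "has_jet2 (\<lambda>w. x w $ i) (yx $ i) (yy $ i) ((- 2 *s (Mx *v yx + My *v yy)) $ i) z" for i
    using x[of i] ab by metis
  with eq show ?thesis by blast
qed

subsection \<open>Subharmonicity from a nonnegative Laplacian\<close>

text \<open>Real parts of polynomials are harmonic on the plane, and on the unit circle they are the
  trigonometric polynomials. They serve as boundary values whose harmonic extension is
  known.\<close>

inductive_set re_poly :: "(complex \<Rightarrow> real) set" where
  monom: "(\<lambda>z. Re (c * z ^ k)) \<in> re_poly"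
| add: "f \<in> re_poly \<Longrightarrow> g \<in> re_poly \<Longrightarrow> (\<lambda>z. f z + g z) \<in> re_poly"

lemma re_poly_eq_Re_holomorphic:
  assumes "f \<in> re_poly"
  shows "\<exists>p. p holomorphic_on UNIV \<and> f = (\<lambda>z. Re (p z))"
  using assms
proof induction
  case (monom c k)
  show ?case by (intro exI[of _ "\<lambda>z. c * z ^ k"] conjI holomorphic_intros) auto
next
  case (add f g)
  then obtain p q where "p holomorphic_on UNIV" "f = (\<lambda>z. Re (p z))"
    "q holomorphic_on UNIV" "g = (\<lambda>z. Re (q z))" by blast
  then show ?case by (intro exI[of _ "\<lambda>z. p z + q z"] conjI holomorphic_intros) auto
qed

text \<open>The product of two such functions is in general not harmonic, but on the circle
  \<open>cnj z\<close> is the inverse of \<open>z\<close>. In Re u * Re v = (Re (u * v) + Re (cnj u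
  * v)) / 2 the second term thereby becomes a monomial of degree \<open>k - j\<close>, provided that
  \<open>j \<le> k\<close>; the other case is symmetric.\<close>

lemma re_poly_mult_monom_on_circle:
  "\<exists>h \<in> re_poly. \<forall>z \<in> sphere 0 1. Re (a * z ^ j) * Re (b * z ^ k) = h z"
proof -
  have *: "\<exists>h \<in> re_poly. \<forall>z \<in> sphere 0 1. Re (a * z ^ j) * Re (b * z ^ k) = h z"
    if le: "j \<le> k" for a b j k
  proof (intro bexI ballI)
    show "(\<lambda>z. Re (a * b / 2 * z ^ (j + k)) + Re (cnj a * b / 2 * z ^ (k - j))) \<in> re_poly"
      by (intro re_poly.intros)
    fix z :: complex assume "z \<in> sphere 0 1"
    then have z: "cnj z * z = 1"
      by (metis complex_norm_square dist_0_norm mem_sphere mult.commute of_real_1 one_power2)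
    have "cnj z ^ j * z ^ k = (cnj z * z) ^ j * z ^ (k - j)"
      using le by (simp add: power_mult_distrib flip: power_add)
    then have e: "z ^ (k - j) = cnj z ^ j * z ^ k" by (simp add: z)
    have "Re u * Re v = Re (u * v) / 2 + Re (cnj u * v) / 2" for u v by (simp add: field_simps)
    from this[of "a * z ^ j" "b * z ^ k"]
    show "Re (a * z ^ j) * Re (b * z ^ k) =
        Re (a * b / 2 * z ^ (j + k)) + Re (cnj a * b / 2 * z ^ (k - j))"
      unfolding e by (simp add: power_add algebra_simps)
  qed
  show ?thesis
  proof (cases "j \<le> k")
    case False
    then obtain h where "h \<in> re_poly" "\<forall>z \<in> sphere 0 1. Re (b * z ^ k) * Re (a * z ^ j) = h z"
      using *[of k j b a] by (meson nat_le_linear)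
    then show ?thesis by (intro bexI[of _ h]) (metis mult.commute)
  qed (rule *)
qed

lemma re_poly_mult_on_circle:
  assumes "f \<in> re_poly" "g \<in> re_poly"
  shows "\<exists>h \<in> re_poly. \<forall>z \<in> sphere 0 1. f z * g z = h z"
  using assms(1)
proof induction
  case (monom a j)
  show ?case using assms(2)
  proof induction
    case (monom b k)
    show ?case by (rule re_poly_mult_monom_on_circle)
  next
    case (add f g)
    then obtain u v where "u \<in> re_poly" "v \<in> re_poly"
      "\<forall>z\<in>sphere 0 1. Re (a * z ^ j) * f z = u z" "\<forall>z\<in>sphere 0 1. Re (a * z ^ j) * g z = v z" by blast
    then show ?case by (intro bexI[of _ "\<lambda>z. u z + v z"]) (auto simp: distrib_left intro: re_poly.add)
  qed
next
  case (add f f')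
  then obtain u v where "u \<in> re_poly" "v \<in> re_poly"
    "\<forall>z\<in>sphere 0 1. f z * g z = u z" "\<forall>z\<in>sphere 0 1. f' z * g z = v z" by blast
  then show ?case by (intro bexI[of _ "\<lambda>z. u z + v z"]) (auto simp: distrib_right intro: re_poly.add)
qed

lemma re_poly_continuous_on:
  assumes "f \<in> re_poly" "continuous_on A h"
  shows "continuous_on A (\<lambda>z. f (h z))"
  using assms by (induction rule: re_poly.induct) (auto intro!: continuous_intros)

text \<open>Stone-Weierstrass: the restrictions to the circle form an algebra by the product
  formula, and \<open>Re\<close> and \<open>Im\<close> already separate points.\<close>

lemma re_poly_dense_on_circle:
  assumes "continuous_on (sphere 0 1) f" "e > 0"
  shows "\<exists>g \<in> re_poly. \<forall>z \<in> sphere 0 1. \<bar>f z - g z\<bar> < e"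
proof -
  define R where "R = {f. \<exists>g \<in> re_poly. \<forall>z \<in> sphere 0 1. f z = g z}"
  interpret function_ring_on R "sphere (0::complex) 1"
  proof
    show "compact (sphere (0::complex) 1)" by simp
    show "continuous_on (sphere 0 1) f" if "f \<in> R" for f
      using that re_poly_continuous_on[OF _ continuous_on_id] by (auto simp: R_def cong: continuous_on_cong_simp intro: continuous_on_eq)
    show "(\<lambda>x. f x + g x) \<in> R" if "f \<in> R" "g \<in> R" for f g
      using that re_poly.add by (fastforce simp: R_def)
    show "(\<lambda>x. f x * g x) \<in> R" if fg: "f \<in> R" "g \<in> R" for f g
    proof -
      obtain u v where uv: "u \<in> re_poly" "v \<in> re_poly" "\<forall>z\<in>sphere 0 1. f z = u z" "\<forall>z\<in>sphere 0 1. g z = v z"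
        using fg unfolding R_def by blast
      obtain h where "h \<in> re_poly" "\<forall>z\<in>sphere 0 1. u z * v z = h z"
        using re_poly_mult_on_circle[OF uv(1,2)] by blast
      with uv show ?thesis by (auto simp: R_def intro!: bexI[of _ h])
    qed
    show "(\<lambda>_. c) \<in> R" for c
      using re_poly.monom[of "of_real c" 0] by (force simp: R_def)
    show "\<exists>f\<in>R. f x \<noteq> f y" if "x \<noteq> y" for x y
    proof -
      have "Re \<in> R" using re_poly.monom[of 1 1] by (auto simp: R_def)
      moreover have "Im \<in> R" using re_poly.monom[of "-\<i>" 1] by (auto simp: R_def)
      ultimately show ?thesis using that complex_eqI by blast
    qed
  qed
  from Stone_Weierstrass_basic[OF assms] obtain g where g: "g \<in> R" "\<forall>x\<in>sphere 0 1. \<bar>f x - g x\<bar> < e" by blast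
  then obtain h where "h \<in> re_poly" "\<forall>x\<in>sphere 0 1. g x = h x" by (auto simp: R_def)
  with g show ?thesis by (intro bexI[of _ h]) auto
qed

text \<open>A maximum forces \<open>f' 0 = 0\<close>; a positive derivative of \<open>f'\<close>
  then makes \<open>f'\<close> positive just to the right of 0, and by the mean value theorem
  \<open>f\<close> exceeds \<open>f 0\<close> there.\<close>

lemma no_local_max_if_second_deriv_pos:
  fixes f :: "real \<Rightarrow> real"
  assumes "eventually (\<lambda>x. (f has_real_derivative f' x) (at x)) (nhds 0)"
    and "(f' has_real_derivative l) (at 0)" "l > 0"
    and max: "eventually (\<lambda>x. f x \<le> f 0) (nhds 0)"
  shows False
proof -
  obtain d1 where d1: "d1 > 0" "\<And>x. \<bar>x\<bar> < d1 \<Longrightarrow> (f has_real_derivative f' x) (at x)"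
    using assms(1) by (auto simp: eventually_nhds_metric)
  obtain d2 where d2: "d2 > 0" "\<And>x. \<bar>x\<bar> < d2 \<Longrightarrow> f x \<le> f 0"
    using max by (auto simp: eventually_nhds_metric)
  have f'0: "f' 0 = 0"
    by (rule DERIV_local_max[of f _ 0 d2]) (use d1 d2 in auto)
  obtain d3 where d3: "d3 > 0" "\<And>h. 0 < h \<Longrightarrow> h < d3 \<Longrightarrow> f' 0 < f' (0 + h)"
    using DERIV_pos_inc_right[OF assms(2,3)] by blast
  define x where "x = min d1 (min d2 d3) / 2"
  have x: "0 < x" "x < d1" "x < d2" "x < d3" using d1 d2 d3 by (auto simp: x_def)
  have "\<exists>z>0. z < x \<and> f x - f 0 = (x - 0) * f' z"
    by (rule MVT2) (use x d1 in auto)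
  then obtain z where z: "0 < z" "z < x" "f x - f 0 = x * f' z" by auto
  with d3(2)[of z] x f'0 have "f x - f 0 > 0" by auto
  with d2(2)[of x] x show False by auto
qed

text \<open>One of the two pure second derivatives must be positive, so the one-dimensional case
  applies along the horizontal or along the vertical line through \<open>z\<close>.\<close>

lemma no_local_max_if_laplacian_pos:
  assumes "has_laplacian u L z" "L > 0" "eventually (\<lambda>w. u w \<le> u z) (nhds z)"
  shows False
proof -
  obtain ux uy uxx uxy uyx uyy where
    u: "eventually (\<lambda>w. (u has_derivative (\<lambda>h. ux w * Re h + uy w * Im h)) (at w)) (nhds z)"
    and ux: "(ux has_derivative (\<lambda>h. uxx * Re h + uxy * Im h)) (at z)"
    and uy: "(uy has_derivative (\<lambda>h. uyx * Re h + uyy * Im h)) (at z)"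
    and L: "L = uxx + uyy"
    using assms(1) unfolding has_laplacian_def by blast
  have line: "False" if d: "dd > 0" and vd: "(vx has_derivative (\<lambda>h. wx * Re h + wy * Im h)) (at z)"
    and dd: "dd = wx * Re v + wy * Im v"
    and vx: "\<And>w. vx w = ux w * Re v + uy w * Im v" for v vx wx wy dd
  proof -
    let ?l = "\<lambda>x::real. z + of_real x * v"
    have l: "(?l has_derivative (\<lambda>h. of_real h * v)) (at x)" for x
      by (auto intro!: derivative_eq_intros)
    have tl: "filterlim ?l (nhds z) (nhds 0)"
      by (auto intro!: tendsto_eq_intros filterlim_ident)
    have "eventually (\<lambda>x. ((\<lambda>x. u (?l x)) has_real_derivative vx (?l x)) (at x)) (nhds 0)"
      using eventually_compose_filterlim[OF u tl]
    proof eventually_elim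
      case (elim x)
      have "((\<lambda>x. u (?l x)) has_derivative (\<lambda>h. ux (?l x) * Re (of_real h * v) + uy (?l x) * Im (of_real h * v))) (at x)"
        by (rule has_derivative_compose[OF l elim])
      moreover have "(\<lambda>h. ux (?l x) * Re (of_real h * v) + uy (?l x) * Im (of_real h * v)) = (*) (vx (?l x))"
        by (auto simp: vx algebra_simps)
      ultimately show ?case by (simp add: has_field_derivative_def)
    qed
    moreover have "((\<lambda>x. vx (?l x)) has_real_derivative dd) (at 0)"
    proof -
      have "((\<lambda>x. vx (?l x)) has_derivative (\<lambda>h. wx * Re (of_real h * v) + wy * Im (of_real h * v))) (at 0)"
        by (rule has_derivative_compose[OF l]) (use vd in simp)
      moreover have "(\<lambda>h. wx * Re (of_real h * v) + wy * Im (of_real h * v)) = (*) dd"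
        by (auto simp: dd algebra_simps)
      ultimately show ?thesis by (simp add: has_field_derivative_def)
    qed
    moreover have "eventually (\<lambda>x. u (?l x) \<le> u (?l 0)) (nhds 0)"
      using eventually_compose_filterlim[OF assms(3) tl] by simp
    ultimately show False using no_local_max_if_second_deriv_pos[where f = "\<lambda>x. u (?l x)" and f' = "\<lambda>x. vx (?l x)"] d by blast
  qed
  from L assms(2) have "uxx > 0 \<or> uyy > 0" by linarith
  then show False
    using line[of uxx ux uxx uxy 1] line[of uyy uy uyx uyy \<i>] ux uy by auto
qed

text \<open>A nonnegative Laplacian does not exclude interior maxima, so \<open>v\<close> is
  perturbed by a multiple of the squared distance to \<open>a\<close>, whose Laplacian is positive.
  The factor \<open>e / r\<^sup>2\<close> makes the perturbation equal to \<open>e\<close> on the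
  circle, while it vanishes at \<open>a\<close>.\<close>

lemma laplacian_max_principle:
  assumes "r > 0" "continuous_on (cball a r) v"
    and lap: "\<And>z. z \<in> ball a r \<Longrightarrow> \<exists>L\<ge>0. has_laplacian v L z"
    and bd: "\<And>z. z \<in> sphere a r \<Longrightarrow> v z \<le> m"
  shows "v a \<le> m"
proof (rule field_le_epsilon)
  fix e :: real assume "e > 0"
  define w where "w z = v z + e / r\<^sup>2 * (cmod (z - a))\<^sup>2" for z
  have cw: "continuous_on (cball a r) w"
    unfolding w_def by (intro continuous_intros assms)
  obtain z where z: "z \<in> cball a r" "\<And>y. y \<in> cball a r \<Longrightarrow> w y \<le> w z"
    using continuous_attains_sup[OF compact_cball _ cw] \<open>r > 0\<close> by auto
  have "z \<notin> ball a r"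
  proof
    assume zb: "z \<in> ball a r"
    then obtain L where L: "L \<ge> 0" "has_laplacian v L z" using lap by blast
    have "has_laplacian w (L + e / r\<^sup>2 * 4) z"
      unfolding w_def by (intro has_laplacian_add has_laplacian_cmult has_laplacian_norm_sq L)
    moreover have "L + e / r\<^sup>2 * 4 > 0" using L \<open>e > 0\<close> \<open>r > 0\<close> by (simp add: add_nonneg_pos)
    moreover have "eventually (\<lambda>y. y \<in> ball a r) (nhds z)" using zb by (intro eventually_nhds_in_open) auto
    then have "eventually (\<lambda>y. w y \<le> w z) (nhds z)" by eventually_elim (use z in auto)
    ultimately show False by (rule no_local_max_if_laplacian_pos)
  qed
  with z(1) have zs: "z \<in> sphere a r" by auto
  have "v a = w a" by (simp add: w_def)
  also have "\<dots> \<le> w z" using z(2) \<open>r > 0\<close> by simp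
  also have "\<dots> = v z + e" using zs \<open>r > 0\<close> by (simp add: w_def dist_norm norm_minus_commute)
  also have "\<dots> \<le> m + e" using bd[OF zs] by simp
  finally show "v a \<le> m + e" .
qed

lemma re_poly_mean_value:
  assumes "f \<in> re_poly"
  shows "((\<lambda>t. f (cis t)) has_integral 2 * pi * f 0) {0..2*pi}"
  using assms
proof induction
  case (monom c k)
  show ?case
  proof (cases "k = 0")
    case True
    then show ?thesis using has_integral_const_real[of "Re c" 0 "2*pi"] by simp
  next
    case False
    let ?F = "\<lambda>t. Re (c * cis (real k * t) / (\<i> * real k))"
    have "((\<lambda>t. Re (c * cis t ^ k)) has_integral ?F (2 * pi) - ?F 0) {0..2*pi}"
    proof (rule fundamental_theorem_of_calculus)
      fix t :: real
      have "((\<lambda>t. c * cis (real k * t) / (\<i> * real k)) has_vector_derivative c * cis t ^ k) (at t within {0..2*pi})"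
      proof -
        have "((\<lambda>w. c * exp (\<i> * of_nat k * w) / (\<i> * of_nat k)) has_field_derivative
            c * exp (\<i> * of_nat k * of_real t)) (at (of_real t))"
          using False by (auto intro!: derivative_eq_intros)
        from has_vector_derivative_real_field[OF this] show ?thesis
          by (simp add: cis_conv_exp exp_of_nat_mult[symmetric] mult_ac)
      qed
      then show "(?F has_vector_derivative Re (c * cis t ^ k)) (at t within {0..2*pi})"
        using bounded_linear.has_vector_derivative[OF bounded_linear_Re] by blast
    qed simp
    moreover have "cis (real k * (2 * pi)) = 1"
      using cis_multiple_2pi[of "real k"] by (simp add: mult.commute mult.left_commute)
    ultimately show ?thesis using False by (simp add: zero_power)
  qed
next
  case (add f g)
  from has_integral_add[OF add.IH] show ?case by (simp add: algebra_simps)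
qed

lemma subharmonic_onI_laplacian:
  assumes "open D" and lap: "\<And>z. z \<in> D \<Longrightarrow> \<exists>L\<ge>0. has_laplacian u L z"
  shows "subharmonic_on D u"
  unfolding subharmonic_on_def
proof (intro conjI ballI allI impI)
  have cont: "continuous_on D u"
    by (rule continuous_at_imp_continuous_on) (use lap has_laplacian_isCont in blast)
  show "eventually (\<lambda>w. u w < y) (nhds z)" if "z \<in> D" "y > u z" for z y
  proof -
    have "isCont u z" using has_laplacian_isCont lap[OF that(1)] by blast
    then have "(u \<longlongrightarrow> u z) (nhds z)" by (simp add: isCont_def tendsto_at_iff_tendsto_nhds)
    then show ?thesis using that(2) by (rule order_tendstoD(2))
  qed
  fix z assume "z \<in> D"
  then obtain R where R: "R > 0" "cball z R \<subseteq> D" using \<open>open D\<close> open_contains_cball by blast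
  show "\<exists>R>0. cball z R \<subseteq> D \<and> (\<forall>r. 0 < r \<and> r < R \<longrightarrow>
        (\<lambda>t. u (z + of_real r * cis t)) absolutely_integrable_on {0..2 * pi} \<and>
        u z \<le> integral {0..2 * pi} (\<lambda>t. u (z + of_real r * cis t)) / (2 * pi))"
  proof (intro exI conjI allI impI)
    fix r :: real assume r: "0 < r \<and> r < R"
    have sub: "z + of_real r * w \<in> D" if "cmod w \<le> 1" for w
    proof -
      have "cmod (of_real r * w) \<le> r * 1" using r that by (simp add: norm_mult)
      then have "z + of_real r * w \<in> cball z R" using r by (simp add: dist_norm)
      then show ?thesis using R by blast
    qed
    have cc: "continuous_on {0..2*pi} (\<lambda>t. u (z + of_real r * cis t))"
      by (rule continuous_on_compose2[OF cont]) (auto intro!: continuous_intros sub)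
    show "(\<lambda>t. u (z + of_real r * cis t)) absolutely_integrable_on {0..2 * pi}"
      using absolutely_integrable_continuous_real[OF cc] .
    have "u z \<le> integral {0..2 * pi} (\<lambda>t. u (z + of_real r * cis t)) / (2 * pi) + e" if "e > 0" for e
    proof -
      have cs: "continuous_on (sphere 0 1) (\<lambda>w. u (z + of_real r * w))"
        by (rule continuous_on_compose2[OF cont]) (auto intro!: continuous_intros sub)
      obtain g where g: "g \<in> re_poly" "\<And>w. w \<in> sphere 0 1 \<Longrightarrow> \<bar>u (z + of_real r * w) - g w\<bar> < e/2"
        using re_poly_dense_on_circle[OF cs, of "e/2"] \<open>e > 0\<close> by auto
      obtain p where p: "p holomorphic_on UNIV" "g = (\<lambda>w. Re (p w))"
        using re_poly_eq_Re_holomorphic[OF g(1)] by blast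
      have sc: "g ((w - z) / of_real r) = Re ((p \<circ> (\<lambda>w. (w - z) / of_real r)) w)" for w by (simp add: p)
      have hol: "(p \<circ> (\<lambda>w. (w - z) / of_real r)) holomorphic_on UNIV"
        by (rule holomorphic_on_compose[OF _ holomorphic_on_subset[OF p(1)]])
          (use r in \<open>auto intro!: holomorphic_intros\<close>)
      \<comment> \<open>The polynomial, rescaled from the unit circle to the circle of radius
        \<open>r\<close> about \<open>z\<close>, is harmonic; subtracting it keeps the Laplacian of
        \<open>u\<close> and leaves boundary values at most \<open>e/2\<close>.\<close>
      let ?v = "\<lambda>w. u w + (-1) * g ((w - z) / of_real r)"
      have "?v z \<le> e/2"
      proof (rule laplacian_max_principle[of r z ?v])
        have cb: "cball z r \<subseteq> D" using R r by auto
        show "continuous_on (cball z r) ?v"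
          by (intro continuous_intros continuous_on_subset[OF cont cb] re_poly_continuous_on[OF g(1)])
            (use r in auto)
        show "\<exists>L\<ge>0. has_laplacian ?v L w" if w: "w \<in> ball z r" for w
        proof -
          obtain L where "L \<ge> 0" "has_laplacian u L w" using lap[of w] w cb by force
          moreover have "has_laplacian (\<lambda>w. g ((w - z) / of_real r)) 0 w"
            unfolding sc using has_jet2_imp_has_laplacian[OF has_jet2_holomorphic[OF hol open_UNIV UNIV_I]] by simp
          ultimately have "has_laplacian ?v (L + (-1) * 0) w" by (intro has_laplacian_add has_laplacian_cmult)
          with \<open>L \<ge> 0\<close> show ?thesis by auto
        qed
        show "?v w \<le> e/2" if "w \<in> sphere z r" for w
        proof -
          have "(w - z) / of_real r \<in> sphere 0 1"
            using that r by (simp add: norm_divide dist_norm norm_minus_commute)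
          moreover have "z + of_real r * ((w - z) / of_real r) = w" using r by simp
          ultimately show ?thesis using g(2) by (smt (verit))
        qed
      qed (use r in auto)
      then have 1: "u z \<le> g 0 + e/2" by simp
      \<comment> \<open>The mean of \<open>g\<close> over the circle is \<open>g 0\<close>, and it
        exceeds the mean of \<open>u\<close> by at most \<open>e/2\<close>; together with
        \<open>1\<close> the total error is \<open>e\<close>.\<close>
      have "integral {0..2*pi} (\<lambda>t. g (cis t) - e/2) \<le> integral {0..2*pi} (\<lambda>t. u (z + of_real r * cis t))"
      proof (rule integral_le)
        show "(\<lambda>t. g (cis t) - e/2) integrable_on {0..2*pi}"
          by (intro integrable_continuous_real continuous_intros re_poly_continuous_on[OF g(1)])
        show "(\<lambda>t. u (z + of_real r * cis t)) integrable_on {0..2*pi}"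
          by (rule integrable_continuous_real[OF cc])
        show "g (cis t) - e/2 \<le> u (z + of_real r * cis t)" for t
          using g(2)[of "cis t"] by (smt (verit) dist_0_norm mem_sphere norm_cis)
      qed
      moreover have "((\<lambda>t. g (cis t) - e/2) has_integral (2 * pi * g 0 - (2*pi) * (e/2))) {0..2*pi}"
        using has_integral_diff[OF re_poly_mean_value[OF g(1)] has_integral_const_real[of "e/2" 0 "2*pi"]] by simp
      ultimately have "2 * pi * (g 0 - e/2) \<le> integral {0..2*pi} (\<lambda>t. u (z + of_real r * cis t))"
        by (simp add: integral_unique algebra_simps)
      then have "g 0 - e/2 \<le> integral {0..2*pi} (\<lambda>t. u (z + of_real r * cis t)) / (2 * pi)"
        by (simp add: field_simps)
      with 1 show ?thesis by linarith
    qed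
    then show "u z \<le> integral {0..2 * pi} (\<lambda>t. u (z + of_real r * cis t)) / (2 * pi)"
      by (rule field_le_epsilon)
  qed (use R in auto)
qed (use assms in auto)

subsection \<open>Bigradings and mixed Hodge structures of biextension type\<close>

lemma decomposes_sum:
  assumes "decomposes A c v" "finite K" "\<And>k. k \<notin> K \<Longrightarrow> c k = 0"
  shows "v = sum c K"
proof -
  have "{k. c k \<noteq> 0} \<subseteq> K" using assms(3) by auto
  from Sum_any.expand_superset[OF assms(2) this] show ?thesis using assms(1) by (simp add: decomposes_def)
qed

lemma decomposesI_finite:
  assumes "\<And>k. c k \<in> A k" "finite K" "\<And>k. k \<notin> K \<Longrightarrow> c k = 0" "v = sum c K"
  shows "decomposes A c v"
proof -
  have s: "{k. c k \<noteq> 0} \<subseteq> K" using assms(3) by auto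
  show ?thesis unfolding decomposes_def
    using assms(1,4) finite_subset[OF s assms(2)] Sum_any.expand_superset[OF assms(2) s] by simp
qed

lemma decomposes_map:
  assumes "decomposes A c v" "\<And>k x. x \<in> A k \<Longrightarrow> f x \<in> B k"
    and "f 0 = 0" "\<And>x y. f (x + y) = f x + f y"
  shows "decomposes B (\<lambda>k. f (c k)) (f v)"
proof (rule decomposesI_finite)
  let ?K = "{k. c k \<noteq> 0}"
  show fin: "finite ?K" using assms(1) by (simp add: decomposes_def)
  show "f (c k) \<in> B k" for k using assms(1,2) by (simp add: decomposes_def)
  show "f (c k) = 0" if "k \<notin> ?K" for k using that assms(3) by simp
  have "v = sum c ?K" by (rule decomposes_sum[OF assms(1) fin]) simp
  moreover have "f (sum c J) = (\<Sum>k\<in>J. f (c k))" if "finite J" for J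
    using that by (induction J rule: finite_induct) (simp_all add: assms(3,4))
  ultimately show "f v = (\<Sum>k\<in>?K. f (c k))" using fin by metis
qed

lemma decomposes_add:
  assumes "decomposes A c v" "decomposes A d w" "\<And>k x y. x \<in> A k \<Longrightarrow> y \<in> A k \<Longrightarrow> x + y \<in> A k"
  shows "decomposes A (\<lambda>k. c k + d k) (v + w)"
proof (rule decomposesI_finite)
  let ?K = "{k. c k \<noteq> 0} \<union> {k. d k \<noteq> 0}"
  show fin: "finite ?K" using assms(1,2) by (simp add: decomposes_def)
  show "c k + d k \<in> A k" for k using assms by (simp add: decomposes_def)
  show "c k + d k = 0" if "k \<notin> ?K" for k using that by simp
  have "v = sum c ?K" "w = sum d ?K"
    by (rule decomposes_sum[OF assms(1) fin] decomposes_sum[OF assms(2) fin]; simp)+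
  then show "v + w = (\<Sum>k\<in>?K. c k + d k)" by (metis sum.distrib)
qed

text \<open>Used with the exchange of the two degrees, for conjugation, and with translations of the
  degree, for the action of the Lie algebra.\<close>

lemma decomposes_reindex:
  assumes "decomposes A c v" "bij g"
  shows "decomposes (\<lambda>k. A (g k)) (\<lambda>k. c (g k)) v"
proof (rule decomposesI_finite)
  let ?K = "{k. c k \<noteq> 0}"
  have fin: "finite ?K" using assms(1) by (simp add: decomposes_def)
  then show "finite (g -` ?K)" by (rule finite_vimageI) (rule bij_is_inj[OF assms(2)])
  show "c (g k) \<in> A (g k)" for k using assms(1) by (simp add: decomposes_def)
  show "c (g k) = 0" if "k \<notin> g -` ?K" for k using that by simp
  have "v = sum c ?K" by (rule decomposes_sum[OF assms(1) fin]) simp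
  also have "\<dots> = (\<Sum>k\<in>g -` ?K. c (g k))"
    by (rule sum.reindex_bij_betw[symmetric])
      (metis assms(2) bij_betw_def bij_is_inj bij_is_surj inj_on_subset subset_UNIV surj_image_vimage_eq)
  finally show "v = (\<Sum>k\<in>g -` ?K. c (g k))" .
qed

lemma decomposes_single:
  assumes "v \<in> A k" "\<And>k. 0 \<in> A k"
  shows "decomposes A (\<lambda>k'. if k' = k then v else 0) v"
  by (rule decomposesI_finite[where K = "{k}"]) (use assms in auto)

text \<open>The index type is arbitrary and no relation to a filtration is assumed: the same facts
  serve the explicit bigrading and a competing one in the proof of uniqueness.\<close>

locale bigraded =
  fixes I :: "'k \<Rightarrow> (complex ^ 'n::finite) set"
  assumes subspace: "vec.subspace (I k)"
    and unique: "\<exists>!c. decomposes I c v"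
begin

lemma zero: "0 \<in> I k" and add: "x \<in> I k \<Longrightarrow> y \<in> I k \<Longrightarrow> x + y \<in> I k"
  and scale: "x \<in> I k \<Longrightarrow> a *s x \<in> I k"
  using subspace by (auto simp: vec.subspace_def)

lemma unique_eq: "decomposes I c v \<Longrightarrow> decomposes I d v \<Longrightarrow> c = d"
  using unique by blast

lemma sum_over_subspace: "vec.subspace (sum_over I K)"
proof (rule vec.subspaceI)
  have "decomposes I (\<lambda>k. 0) 0" by (rule decomposesI_finite[where K = "{}"]) (auto simp: zero)
  then show "0 \<in> sum_over I K" by (auto simp: sum_over_def)
  show "x + y \<in> sum_over I K" if xy: "x \<in> sum_over I K" "y \<in> sum_over I K" for x y
  proof -
    obtain c d where "decomposes I c x" "decomposes I d y" and z: "\<forall>k. k \<notin> K \<longrightarrow> c k = 0" "\<forall>k. k \<notin> K \<longrightarrow> d k = 0"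
      using xy by (auto simp: sum_over_def)
    then have "decomposes I (\<lambda>k. c k + d k) (x + y)" by (intro decomposes_add add)
    then show ?thesis using z unfolding sum_over_def by (auto intro!: exI[of _ "\<lambda>k. c k + d k"])
  qed
  show "a *s x \<in> sum_over I K" if x: "x \<in> sum_over I K" for a x
  proof -
    obtain c where "decomposes I c x" and z: "\<forall>k. k \<notin> K \<longrightarrow> c k = 0"
      using x by (auto simp: sum_over_def)
    then have "decomposes I (\<lambda>k. a *s c k) (a *s x)"
      by (intro decomposes_map[where B = I]) (auto intro: scale simp: vector_add_ldistrib)
    then show ?thesis using z unfolding sum_over_def by (auto intro!: exI[of _ "\<lambda>k. a *s c k"])
  qed
qed

lemma sum_over_mono: "K \<subseteq> K' \<Longrightarrow> sum_over I K \<subseteq> sum_over I K'"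
  by (auto simp: sum_over_def)

lemma sum_over_Int:
  assumes "v \<in> sum_over I K" "v \<in> sum_over I K'"
  shows "v \<in> sum_over I (K \<inter> K')"
proof -
  obtain c d where c: "decomposes I c v" "\<forall>k. k \<notin> K \<longrightarrow> c k = 0"
    and d: "decomposes I d v" "\<forall>k. k \<notin> K' \<longrightarrow> d k = 0"
    using assms by (auto simp: sum_over_def)
  then have "c = d" by (blast intro: unique_eq)
  with c d show ?thesis by (auto simp: sum_over_def)
qed

lemma sum_over_empty: "sum_over I {} = {0}"
proof -
  have "v = 0" if "v \<in> sum_over I {}" for v
    using that decomposes_sum[of I _ v "{}"] by (auto simp: sum_over_def)
  then show ?thesis using vec.subspace_0[OF sum_over_subspace] by auto
qed

lemma sum_over_disjoint:
  assumes "v \<in> sum_over I K" "v \<in> sum_over I K'" "K \<inter> K' = {}"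
  shows "v = 0"
  using sum_over_Int[OF assms(1,2)] sum_over_empty assms(3) by simp

lemma sum_over_single: "sum_over I {k} = I k"
proof (intro equalityI subsetI)
  fix v assume "v \<in> sum_over I {k}"
  then obtain c where c: "decomposes I c v" "\<And>j. j \<noteq> k \<Longrightarrow> c j = 0" by (auto simp: sum_over_def)
  have "v = sum c {k}" by (rule decomposes_sum[OF c(1)]) (use c in auto)
  moreover have "c k \<in> I k" using c(1) by (simp add: decomposes_def)
  ultimately show "v \<in> I k" by simp
next
  fix v assume "v \<in> I k"
  from decomposes_single[of v I k, OF this zero] show "v \<in> sum_over I {k}"
    by (force simp: sum_over_def)
qed

lemma sum_over_restrict:
  assumes "\<And>k. k \<in> K \<Longrightarrow> k \<notin> K' \<Longrightarrow> I k = {0}"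
  shows "sum_over I K \<subseteq> sum_over I K'"
proof
  fix v assume "v \<in> sum_over I K"
  then obtain c where c: "decomposes I c v" "\<And>k. k \<notin> K \<Longrightarrow> c k = 0" by (auto simp: sum_over_def)
  have "c k = 0" if "k \<notin> K'" for k
    using that c assms[of k] by (cases "k \<in> K") (auto simp: decomposes_def)
  then show "v \<in> sum_over I K'" using c by (auto simp: sum_over_def)
qed

lemma sum_over_split:
  assumes "v \<in> sum_over I (K \<union> K')"
  shows "\<exists>x \<in> sum_over I K. \<exists>y \<in> sum_over I K'. v = x + y"
proof -
  obtain c where c: "decomposes I c v" "\<And>k. k \<notin> K \<union> K' \<Longrightarrow> c k = 0"
    using assms by (auto simp: sum_over_def)
  let ?J = "{k. c k \<noteq> 0}"
  have fin: "finite ?J" using c(1) by (simp add: decomposes_def)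
  define d where "d k = (if k \<in> K then c k else 0)" for k
  define d' where "d' k = (if k \<in> K then 0 else c k)" for k
  have cI: "c k \<in> I k" for k using c(1) by (simp add: decomposes_def)
  have "decomposes I d (sum d ?J)" "decomposes I d' (sum d' ?J)"
    by (rule decomposesI_finite[OF _ fin]; simp add: d_def d'_def zero cI)+
  moreover have "d k = 0" if "k \<notin> K" for k using that by (simp add: d_def)
  moreover have "d' k = 0" if "k \<notin> K'" for k using that c(2) by (simp add: d'_def)
  ultimately have dd: "sum d ?J \<in> sum_over I K" "sum d' ?J \<in> sum_over I K'"
    unfolding sum_over_def by blast+
  moreover have "v = sum c ?J" by (rule decomposes_sum[OF c(1) fin]) simp
  moreover have "c k = d k + d' k" for k by (simp add: d_def d'_def)
  ultimately have "v = sum d ?J + sum d' ?J" by (simp add: sum.distrib)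
  with dd show ?thesis by blast
qed

end

section \<open>Conjugation and the lattice\<close>

lemma cnjv_simps [simp]:
  "cnjv (u + v) = cnjv u + cnjv v" "cnjv (u - v) = cnjv u - cnjv v" "cnjv (a *s v) = cnj a *s cnjv v"
  "cnjv 0 = 0" "cnjv (- v) = - cnjv v" "cnjv (cnjv v) = v"
  by (simp_all add: cnjv_def vec_eq_iff)

lemma cnjv_eq_iff: "cnjv u = v \<longleftrightarrow> u = cnjv v" by auto

lemma plus_cnjv_imageE:
  assumes "v \<in> A + cnjv ` B"
  obtains x y where "x \<in> A" "y \<in> B" "v = x + cnjv y"
  using assms by (auto simp: set_plus_def)

lemma cnjv_int_lattice: "v \<in> int_lattice \<Longrightarrow> cnjv v = v"
  by (simp add: int_lattice_def cnjv_def vec_eq_iff) (metis Ints_cases complex_cnj_of_int)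

lemma axis_int_lattice: "axis i 1 \<in> int_lattice"
  by (auto simp: int_lattice_def axis_def)

lemma vec_sum_axis: "(v :: complex ^ 'n::finite) = (\<Sum>i\<in>UNIV. v $ i *s axis i 1)"
  using basis_expansion[of v] by simp

locale biext_lat =
  fixes eps :: "complex ^ 'n::finite \<Rightarrow> complex" and tw :: "complex ^ 'n"
    and Q :: "complex ^ 'n \<Rightarrow> complex ^ 'n \<Rightarrow> complex"
  assumes lat: "biext_lattice eps tw Q"
begin

sublocale eps: Vector_Spaces.linear "(*s)" "(*)" eps
  using lat by (simp add: biext_lattice_def)

lemma eps_simps [simp]:
  "eps (u + v) = eps u + eps v" "eps (u - v) = eps u - eps v" "eps (a *s v) = a * eps v"
  "eps 0 = 0" "eps (- v) = - eps v" "eps tw = 0"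
  using lat by (simp_all add: eps.add eps.diff eps.scale eps.zero eps.neg biext_lattice_def)

lemma tw_nz [simp]: "tw \<noteq> 0" using lat by (simp add: biext_lattice_def)

lemma scale_tw_eq_0 [simp]: "a *s tw = 0 \<longleftrightarrow> a = 0"
  by (simp add: vec.scale_eq_0_iff)

lemma scale_tw_inj [simp]: "a *s tw = b *s tw \<longleftrightarrow> a = b"
  by (simp add: vec.scale_right_imp_eq)

lemma tw_lattice: "tw \<in> int_lattice"
proof -
  have "1 *s tw \<in> (\<lambda>a. a *s tw) ` \<int>" by (rule imageI) simp
  then show ?thesis using lat by (auto simp: biext_lattice_def)
qed

lemma cnjv_tw [simp]: "cnjv tw = tw" by (rule cnjv_int_lattice[OF tw_lattice])

text \<open>\<open>eps\<close> maps the standard basis into the integers, so its coefficients are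
  real.\<close>

lemma eps_cnjv [simp]: "eps (cnjv v) = cnj (eps v)"
proof -
  have i: "cnj (eps (axis i 1)) = eps (axis i 1)" for i
  proof -
    have "eps (axis i 1) \<in> \<int>" using lat axis_int_lattice by (auto simp: biext_lattice_def)
    then show ?thesis by (auto elim: Ints_cases)
  qed
  have e: "eps v = (\<Sum>i\<in>UNIV. v $ i * eps (axis i 1))" for v
    by (subst vec_sum_axis) (simp add: eps.sum)
  show ?thesis unfolding e[of v] e[of "cnjv v"] by (simp add: cnjv_def i)
qed

lemma wfil_simps:
  "k \<ge> 0 \<Longrightarrow> wfil eps tw k = UNIV" "wfil eps tw (-1) = {v. eps v = 0}"
  "wfil eps tw (-2) = range (\<lambda>a. a *s tw)" "k \<le> -3 \<Longrightarrow> wfil eps tw k = {0}"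
  by (simp_all add: wfil_def)

lemma obtain_lattice_lift: obtains er where "er \<in> int_lattice" "eps er = 1"
proof -
  have "1 \<in> eps ` int_lattice" using lat by (simp add: biext_lattice_def)
  then show ?thesis using that by auto
qed

end

section \<open>The types of the graded pieces\<close>

locale biext_mhs = biext_lat +
  fixes F :: "int \<Rightarrow> (complex ^ 'n::finite) set"
  assumes mhs: "mixed_hodge eps tw F"
begin

lemma F_subspace: "vec.subspace (F p)" using mhs by (simp add: mixed_hodge_def hodge_filtration_def)

lemma F_antimono: "p \<le> q \<Longrightarrow> v \<in> F q \<Longrightarrow> v \<in> F p"
  using mhs by (auto simp: mixed_hodge_def hodge_filtration_def antimono_def)

lemma F_closed [simp, intro]:
  "0 \<in> F p" "u \<in> F p \<Longrightarrow> v \<in> F p \<Longrightarrow> u + v \<in> F p" "u \<in> F p \<Longrightarrow> v \<in> F p \<Longrightarrow> u - v \<in> F p"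
  "v \<in> F p \<Longrightarrow> a *s v \<in> F p"
  using F_subspace by (simp_all add: vec.subspace_0 vec.subspace_add vec.subspace_diff vec.subspace_scale)

lemma opposed:
  "grF eps tw F k p + cnjv ` grF eps tw F k (k + 1 - p) = wfil eps tw k"
  "grF eps tw F k p \<inter> cnjv ` grF eps tw F k (k + 1 - p) = wfil eps tw (k - 1)"
  using mhs by (auto simp: mixed_hodge_def)

lemma grF_0: "grF eps tw F 0 p = F p + {v. eps v = 0}"
  by (simp add: grF_def wfil_simps)

lemma grF_m1: "v \<in> grF eps tw F (-1) p \<longleftrightarrow> (\<exists>x \<in> F p. eps x = 0 \<and> (\<exists>a. v = x + a *s tw))"
  by (auto simp: grF_def wfil_simps set_plus_def)

lemma grF_m2: "grF eps tw F (-2) p = F p \<inter> range (\<lambda>a. a *s tw)"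
  by (simp add: grF_def wfil_simps)

text \<open>Otherwise step \<open>p\<close> would fill gr 0, and so would the larger step
  \<open>1 - p\<close>; their intersection would be everything, against opposedness. Thus gr 0 has
  type (0, 0).\<close>

lemma F_pos_eps:
  assumes "v \<in> F p" "p \<ge> 1"
  shows "eps v = 0"
proof (rule ccontr)
  assume v: "eps v \<noteq> 0"
  have *: "grF eps tw F 0 q = UNIV" if "q \<le> p" for q
  proof -
    have "w \<in> F q + {v. eps v = 0}" for w
    proof -
      let ?u = "(eps w / eps v) *s v"
      have "?u \<in> F q" by (rule F_closed(4)[OF F_antimono[OF that assms(1)]])
      moreover have "w - ?u \<in> {v. eps v = 0}" using v by simp
      ultimately have "?u + (w - ?u) \<in> F q + {v. eps v = 0}" by (rule set_plus_intro)
      then show ?thesis by simp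
    qed
    then show ?thesis by (auto simp: grF_0)
  qed
  have surj: "surj cnjv" by (rule surjI[of _ cnjv]) simp
  have "UNIV \<inter> range cnjv = wfil eps tw (-1)"
    using opposed(2)[of 0 p] *[of p] *[of "1 - p"] assms(2) by simp
  then have "UNIV = wfil eps tw (-1)" unfolding surj by simp
  then have "v \<in> wfil eps tw (-1)" by blast
  then show False using v by (simp add: wfil_simps)
qed

text \<open>Opposedness on gr 0 at step 1: there \<open>F 1\<close> contributes nothing, so that
  \<open>F 0\<close> has to reach the value 1 of \<open>eps\<close>.\<close>

lemma obtain_F0: obtains f where "f \<in> F 0" "eps f = 1"
proof -
  obtain er where er: "eps er = 1" by (rule obtain_lattice_lift)
  have "er \<in> grF eps tw F 0 1 + cnjv ` grF eps tw F 0 0"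
    using opposed(1)[of 0 1] by (simp add: wfil_simps)
  then obtain g h where gh: "g \<in> grF eps tw F 0 1" "h \<in> grF eps tw F 0 0" "er = g + cnjv h"
    by (rule plus_cnjv_imageE)
  from gh(1) obtain x u where "x \<in> F 1" "eps u = 0" "g = x + u"
    unfolding grF_0 by (elim set_plus_elim) blast
  then have "eps g = 0" using F_pos_eps[of x 1] by simp
  moreover from gh(2) obtain y w where "y \<in> F 0" "eps w = 0" "h = y + w"
    unfolding grF_0 by (elim set_plus_elim) blast
  ultimately have "cnj (eps y) = 1" using er gh(3) by simp
  then have "eps y = 1" by (metis complex_cnj_cnj complex_cnj_one)
  with \<open>y \<in> F 0\<close> show ?thesis by (rule that)
qed

text \<open>Opposedness on the line W (-2) at step 0: one of \<open>F 0\<close> and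
  \<open>F (-1)\<close> contains \<open>tw\<close>, and both lie in \<open>F (-1)\<close>.\<close>

lemma tw_F: "tw \<in> F (-1)"
proof -
  have "1 *s tw \<in> wfil eps tw (-2)" unfolding wfil_simps by (rule rangeI)
  then have "1 *s tw \<in> grF eps tw F (-2) 0 + cnjv ` grF eps tw F (-2) (-1)"
    using opposed(1)[of "-2" 0] by simp
  then obtain x y where xy: "x \<in> F 0 \<inter> range (\<lambda>a. a *s tw)" "y \<in> F (-1) \<inter> range (\<lambda>a. a *s tw)"
    "1 *s tw = x + cnjv y"
    unfolding grF_m2 by (rule plus_cnjv_imageE)
  obtain a b where ab: "x = a *s tw" "y = b *s tw" using xy(1,2) by blast
  have "x \<in> F 0" "y \<in> F (-1)" using xy by blast+
  then have "x \<in> F (-1)" by (intro F_antimono[of "-1" 0]) simp_all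
  have "1 *s tw = (a + cnj b) *s tw"
    unfolding xy(3) ab by (simp add: vec.scale_left_distrib)
  then have "1 = a + cnj b" by (rule scale_tw_inj[THEN iffD1])
  then have "a \<noteq> 0 \<or> b \<noteq> 0" by auto
  then show ?thesis
  proof
    assume "a \<noteq> 0"
    then have "inverse a *s x = tw" using ab by simp
    moreover have "inverse a *s x \<in> F (-1)" by (rule F_closed(4)) (rule \<open>x \<in> F (-1)\<close>)
    ultimately show ?thesis by (simp only:)
  next
    assume "b \<noteq> 0"
    then have "inverse b *s y = tw" using ab by simp
    moreover have "inverse b *s y \<in> F (-1)" by (rule F_closed(4)) fact
    ultimately show ?thesis by (simp only:)
  qed
qed

lemma tw_F_neg: "p \<le> -1 \<Longrightarrow> a *s tw \<in> F p"
  using F_antimono[OF _ tw_F] by blast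

text \<open>The other half of opposedness: since the conjugate of step -1 is the whole line, step 0
  must meet the line in zero. With \<open>tw_F\<close> this says that the line has type (-1,
  -1).\<close>

lemma tw_F0:
  assumes "a *s tw \<in> F p" "p \<ge> 0"
  shows "a = 0"
proof -
  have "a *s tw \<in> F 0" using F_antimono assms by blast
  then have "a *s tw \<in> grF eps tw F (-2) 0" by (auto simp: grF_m2)
  moreover have "cnj a *s tw \<in> grF eps tw F (-2) (-1)" using tw_F_neg by (auto simp: grF_m2)
  then have "a *s tw \<in> cnjv ` grF eps tw F (-2) (-1)" by (rule rev_image_eqI) simp
  ultimately have "a *s tw \<in> wfil eps tw (-3)" using opposed(2)[of "-2" 0] by auto
  then show ?thesis by (simp add: wfil_simps)
qed

text \<open>In weight -1 the step opposed to \<open>p\<close> is \<open>- p\<close>. Vectors of the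
  graded piece are lifted to \<open>F\<close>, at the cost of a multiple of
  \<open>tw\<close>.\<close>

lemma W1_split:
  assumes "eps v = 0"
  obtains x y a where "x \<in> F p" "y \<in> F (-p)" "eps x = 0" "eps y = 0" "v = x + cnjv y + a *s tw"
proof -
  have "v \<in> grF eps tw F (-1) p + cnjv ` grF eps tw F (-1) (-p)"
    using opposed(1)[of "-1" p] assms by (simp add: wfil_simps)
  then obtain g h where gh: "g \<in> grF eps tw F (-1) p" "h \<in> grF eps tw F (-1) (-p)" "v = g + cnjv h"
    by (rule plus_cnjv_imageE)
  obtain x a where "x \<in> F p" "eps x = 0" "g = x + a *s tw" using gh(1) unfolding grF_m1 by blast
  moreover obtain y b where "y \<in> F (-p)" "eps y = 0" "h = y + b *s tw"
    using gh(2) unfolding grF_m1 by blast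
  moreover note gh(3)
  ultimately show ?thesis
    by (intro that[of x y "a + cnj b"]) (simp_all add: vec.scale_left_distrib)
qed

lemma W1_disjoint:
  assumes "x \<in> F p" "y \<in> F (-p)" "eps x = 0" "eps y = 0" "x = cnjv y + a *s tw"
  obtains b where "x = b *s tw"
proof -
  have "x = x + 0 *s tw" by simp
  with assms(1,3) have "x \<in> grF eps tw F (-1) p" unfolding grF_m1 by blast
  moreover have "x \<in> cnjv ` grF eps tw F (-1) (-p)"
  proof (rule rev_image_eqI)
    show "y + cnj a *s tw \<in> grF eps tw F (-1) (-p)" using assms(2,4) unfolding grF_m1 by blast
  qed (simp add: assms(5))
  ultimately have "x \<in> wfil eps tw (-2)" using opposed(2)[of "-1" p] by auto
  then show ?thesis using that by (auto simp: wfil_simps)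
qed

text \<open>The graded pieces of weight \<open>-1\<close>: since only one weight lies below, the formula for \<open>I\<^sup>p\<^sup>,\<^sup>q\<close>
  has no correction terms.\<close>

definition H :: "int \<Rightarrow> (complex ^ 'n) set" where
  "H p = {v \<in> F p. eps v = 0 \<and> cnjv v \<in> F (-1 - p)}"

lemma H_closed [simp, intro]:
  "0 \<in> H p" "u \<in> H p \<Longrightarrow> v \<in> H p \<Longrightarrow> u + v \<in> H p" "v \<in> H p \<Longrightarrow> a *s v \<in> H p"
  by (auto simp: H_def)

lemma H_cnjv: "cnjv v \<in> H p \<longleftrightarrow> v \<in> H (-1 - p)"
  by (auto simp: H_def)

lemma H_tw: "a *s tw \<in> H p \<Longrightarrow> a = 0"
  using tw_F0[of a p] tw_F0[of "cnj a" "-1 - p"] by (cases "p \<ge> 0") (auto simp: H_def)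

text \<open>The difference of a lift \<open>f\<close> and its conjugate lies in W (-1); its two
  parts correct \<open>f\<close> on the one side and the conjugate of \<open>f\<close> on the other.
  The corrected vectors \<open>e\<close> and \<open>e'\<close> agree up to a multiple of
  \<open>tw\<close>, and as both lie in \<open>F 0\<close>, which contains no nonzero multiple of
  \<open>tw\<close>, they are equal.\<close>

lemma obtain_e:
  obtains e a where "e \<in> F 0" "eps e = 1" "cnjv e = e + a *s tw"
proof -
  obtain f where f: "f \<in> F 0" "eps f = 1" by (rule obtain_F0)
  have "eps (f - cnjv f) = 0" using f by simp
  from W1_split[OF this, of 0] obtain x y b where
    xy: "x \<in> F 0" "y \<in> F 0" "eps x = 0" "eps y = 0" "f - cnjv f = x + cnjv y + b *s tw" by auto
  define e where "e = f - x"
  define e' where "e' = f + y"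
  have e: "e = cnjv e' + b *s tw" using xy(5) by (simp add: e_def e'_def algebra_simps)
  have F: "e \<in> F 0" "e' \<in> F 0" and eps: "eps e = 1" "eps e' = 1"
    using f xy by (auto simp: e_def e'_def)
  have ce: "cnjv e = e' + cnj b *s tw" by (simp add: e)
  have "e - e' = cnjv (e' - e) + (b + cnj b) *s tw"
    using e ce by (simp add: vec.scale_left_distrib algebra_simps)
  then obtain c where c: "e - e' = c *s tw"
    by (rule W1_disjoint[of "e - e'" 0 "e' - e", rotated 4]) (use F eps in auto)
  moreover have "e - e' \<in> F 0" using F by blast
  ultimately have "c = 0" using tw_F0[of c 0] by simp
  then have "cnjv e = e + cnj b *s tw" using c ce by simp
  with F(1) eps(1) show ?thesis by (rule that)
qed

end

abbreviation Fge :: "int \<Rightarrow> (int \<times> int) set" where "Fge p \<equiv> {(a, b). a \<ge> p}"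
abbreviation Wle :: "int \<Rightarrow> (int \<times> int) set" where "Wle k \<equiv> {(a, b). a + b \<le> k}"

text \<open>\<open>ea\<close> measures how far the generator \<open>e\<close> of I^{0,0} is from
  being real; it will turn out to be \<open>- 2 * \<i>\<close> times the splitting.\<close>

locale biext_split = biext_mhs eps tw Q F
    for eps :: "complex ^ 'n::finite \<Rightarrow> complex" and tw Q F +
  fixes e :: "complex ^ 'n" and ea :: complex
  assumes e_F: "e \<in> F 0" and eps_e [simp]: "eps e = 1" and cnjv_e: "cnjv e = e + ea *s tw"
begin

definition BI :: "int \<times> int \<Rightarrow> (complex ^ 'n) set" where
  "BI k = (if k = (0, 0) then range (\<lambda>a. a *s e) else if k = (-1, -1) then range (\<lambda>a. a *s tw)
     else if fst k + snd k = -1 then H (fst k) else {0})"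

text \<open>Deligne's description of I^{0,0} as the intersection of \<open>F 0\<close> with the
  conjugate of \<open>F 0\<close> up to W (-2). As the left side does not mention \<open>e\<close>,
  any lift of this kind can be recognized as a multiple of \<open>e\<close>.\<close>

lemma I00_eq: "{v \<in> F 0. \<exists>a. cnjv v - a *s tw \<in> F 0} = range (\<lambda>a. a *s e)"
proof (intro equalityI subsetI)
  fix v assume "v \<in> {v \<in> F 0. \<exists>a. cnjv v - a *s tw \<in> F 0}"
  then obtain b where v: "v \<in> F 0" "cnjv v - b *s tw \<in> F 0" by blast
  define u where "u = v - eps v *s e"
  define y where "y = cnjv v - b *s tw - cnj (eps v) *s e"
  have u: "u \<in> F 0" "eps u = 0" unfolding u_def using v(1) e_F by simp_all
  have y: "y \<in> F (- 0)" "eps y = 0" unfolding y_def using v(2) e_F by simp_all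
  have "cnjv u = y + (b - cnj (eps v) * ea) *s tw"
    by (simp add: u_def y_def cnjv_e vec.scale_left_diff_distrib vec.scale_right_distrib algebra_simps)
  then have "cnjv (cnjv u) = cnjv (y + (b - cnj (eps v) * ea) *s tw)" by (rule arg_cong)
  then have "u = cnjv y + cnj (b - cnj (eps v) * ea) *s tw" by simp
  from W1_disjoint[OF u(1) y(1) u(2) y(2) this] obtain d where d: "u = d *s tw" by blast
  then have "d = 0" using tw_F0[of d 0] u(1) by simp
  then have "v = eps v *s e" using d by (simp add: u_def)
  then show "v \<in> range (\<lambda>a. a *s e)" by (rule range_eqI)
next
  fix v assume "v \<in> range (\<lambda>a. a *s e)"
  then obtain a where v: "v = a *s e" by blast
  have "cnjv v - (cnj a * ea) *s tw = cnj a *s e"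
    by (simp add: v cnjv_e vec.scale_right_distrib)
  moreover have "cnj a *s e \<in> F 0" "v \<in> F 0" using e_F by (simp_all add: v)
  ultimately have "cnjv v - (cnj a * ea) *s tw \<in> F 0" "v \<in> F 0" by (simp_all only:)
  then show "v \<in> {v \<in> F 0. \<exists>a. cnjv v - a *s tw \<in> F 0}" by blast
qed

text \<open>A bound for the Hodge types: \<open>H p\<close> is zero unless \<open>p\<close> lies in
  \<open>{-N..N}\<close>, so decompositions in weight -1 become sums over a fixed finite
  range.\<close>

definition N :: int where "N = (SOME N. N \<ge> 0 \<and> F N = {0})"

lemma N: "N \<ge> 0" "F N = {0}"
proof -
  obtain p where p: "F p = {0}" using mhs by (auto simp: mixed_hodge_def hodge_filtration_def)
  have "F (max 0 p) = {0}"
  proof (intro equalityI subsetI)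
    fix v assume "v \<in> F (max 0 p)"
    then have "v \<in> F p" by (rule F_antimono[rotated]) simp
    then show "v \<in> {0}" by (simp add: p)
  qed simp
  then have "max 0 p \<ge> 0 \<and> F (max 0 p) = {0}" by simp
  from someI[of "\<lambda>N. N \<ge> 0 \<and> F N = {0}", OF this] show "N \<ge> 0" "F N = {0}" by (simp_all add: N_def)
qed

lemma F_large: "v \<in> F p \<Longrightarrow> N \<le> p \<Longrightarrow> v = 0"
  using F_antimono[of N p v] by (simp add: N)

lemma H_outside:
  assumes "v \<in> H p" "p \<notin> {-N..N}"
  shows "v = 0"
proof (cases "p \<ge> N")
  case True
  then show ?thesis using assms(1) F_large[of v p] by (simp add: H_def)
next
  case False
  then have "cnjv v = 0" using assms F_large[of "cnjv v" "-1 - p"] by (simp add: H_def)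
  then show ?thesis by (simp add: cnjv_eq_iff)
qed

abbreviation nf :: "complex \<Rightarrow> complex \<Rightarrow> (int \<Rightarrow> complex ^ 'n) \<Rightarrow> complex ^ 'n" where
  "nf a b h \<equiv> a *s e + b *s tw + (\<Sum>q\<in>{-N..N}. h q)"

text \<open>Downward induction on the step, from \<open>F N\<close>, which is zero: opposedness at
  step p + 1 splits off a vector of \<open>F (p + 1)\<close>, and the remainder has type (p, -1 - p)
  up to a multiple of \<open>tw\<close>.\<close>

lemma span_F:
  assumes "v \<in> F p" "eps v = 0"
  shows "\<exists>h b. (\<forall>q. h q \<in> H q) \<and> (\<forall>q<p. h q = 0) \<and> (p \<ge> 0 \<longrightarrow> b = 0) \<and> v = b *s tw + (\<Sum>q\<in>{-N..N}. h q)"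
proof (cases "p \<ge> N")
  case True
  then have "v = 0" using F_large assms by blast
  then show ?thesis by (intro exI[of _ "\<lambda>q. 0"] exI[of _ 0]) simp
next
  case False
  then have "p \<le> N" by simp
  then show ?thesis using assms
  proof (induction arbitrary: v rule: int_le_induct)
    case base
    then have "v = 0" using F_large by blast
    then show ?case by (intro exI[of _ "\<lambda>q. 0"] exI[of _ 0]) simp
  next
    case (step i)
    define p where "p = i - 1"
    have i: "i = p + 1" by (simp add: p_def)
    from W1_split[OF step.prems(2), of i] obtain x y a where
      xy: "x \<in> F i" "y \<in> F (- i)" "eps x = 0" "eps y = 0" "v = x + cnjv y + a *s tw" by blast
    have vp: "v \<in> F p" using step.prems(1) by (simp add: p_def)
    have xp: "x \<in> F p" by (rule F_antimono[OF _ xy(1)]) (simp add: i)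
    have yp: "y \<in> F (-1 - p)" using xy(2) by (simp add: i algebra_simps)
    \<comment> \<open>Where the multiple of \<open>tw\<close> belongs depends on the sign of
      \<open>p\<close>. For \<open>p \<ge> 0\<close> it stays inside \<open>u\<close>, which is
      harmless because its conjugate lies in \<open>F (-1 - p)\<close>; for negative
      \<open>p\<close> it lies in \<open>F p\<close> and is split off.\<close>
    obtain u b' where u: "u \<in> H p" "v = x + u + b' *s tw" "p \<ge> 0 \<longrightarrow> b' = 0"
    proof (cases "p \<ge> 0")
      case True
      have ta: "cnj a *s tw \<in> F (-1 - p)" using True by (intro tw_F_neg) simp
      have e1: "v - x = cnjv y + a *s tw" using xy(5) by simp
      have "cnjv (v - x) = y + cnj a *s tw" unfolding e1 by simp
      then have "cnjv (v - x) \<in> F (-1 - p)" using yp ta by simp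
      moreover have "v - x \<in> F p" using vp xp by simp
      moreover have "eps (v - x) = 0" using step.prems(2) xy(3) by simp
      ultimately have "v - x \<in> H p" by (simp add: H_def)
      then show ?thesis by (rule that[of _ 0]) auto
    next
      case False
      have e1: "cnjv y = v - x - a *s tw" using xy(5) by simp
      have "v - x - a *s tw \<in> F p" using vp xp False by (intro F_closed tw_F_neg) simp_all
      then have "cnjv y \<in> F p" by (simp only: e1)
      moreover have "cnjv (cnjv y) \<in> F (-1 - p)" using yp by simp
      moreover have "eps (cnjv y) = 0" using xy(4) by simp
      ultimately have "cnjv y \<in> H p" unfolding H_def by blast
      then show ?thesis by (rule that[of _ a]) (use xy(5) False in auto)
    qed
    obtain h b where h: "\<And>q. h q \<in> H q" "\<And>q. q < i \<Longrightarrow> h q = 0" "i \<ge> 0 \<longrightarrow> b = 0"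
      "x = b *s tw + (\<Sum>q\<in>{-N..N}. h q)"
      using step.IH[OF xy(1,3)] by blast
    have "p \<notin> {-N..N} \<Longrightarrow> u = 0" using H_outside u(1) by blast
    then have "u = (\<Sum>q\<in>{-N..N}. if q = p then u else 0)" by auto
    then have "v = (b + b') *s tw + (\<Sum>q\<in>{-N..N}. h q + (if q = p then u else 0))"
      unfolding sum.distrib using u(2) h(4) by (simp add: vec.scale_left_distrib)
    moreover have "\<forall>q. h q + (if q = p then u else 0) \<in> H q" using h(1) u(1) by auto
    moreover have "\<forall>q<p. h q + (if q = p then u else 0) = 0" using h(2) by (auto simp: i)
    moreover have "p \<ge> 0 \<longrightarrow> b + b' = 0" using h(3) u(3) by (auto simp: i)
    ultimately show ?case unfolding p_def[symmetric]
      by (intro exI[of _ "\<lambda>q. h q + (if q = p then u else 0)"] exI[of _ "b + b'"]) blast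
  qed
qed

lemma span_W1:
  assumes "eps v = 0"
  shows "\<exists>h b. (\<forall>q. h q \<in> H q) \<and> v = b *s tw + (\<Sum>q\<in>{-N..N}. h q)"
proof -
  \<comment> \<open>At step \<open>-N\<close> the conjugate part comes from \<open>F N\<close>,
    which is zero, so \<open>span_F\<close> covers all of W (-1).\<close>
  obtain x y a where xy: "x \<in> F (-N)" "y \<in> F (- (- N))" "eps x = 0" "v = x + cnjv y + a *s tw"
    by (rule W1_split[OF assms, of "-N"])
  from span_F[OF xy(1,3)] obtain h b where
    h: "\<forall>q. h q \<in> H q" "x = b *s tw + (\<Sum>q\<in>{-N..N}. h q)" by (elim exE conjE) (rule that)
  have "y = 0" using F_large[OF xy(2)] by simp
  then have "v = (a + b) *s tw + (\<Sum>q\<in>{-N..N}. h q)"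
    unfolding xy(4) h(2) by (simp add: vec.scale_left_distrib)
  with h(1) show ?thesis by (intro exI conjI)
qed

lemma sum_H_F:
  assumes "\<And>q. h q \<in> H q" "\<And>q. q \<in> A \<Longrightarrow> h q \<noteq> 0 \<Longrightarrow> p \<le> q"
  shows "(\<Sum>q\<in>A. h q) \<in> F p"
proof (rule vec.subspace_sum[OF F_subspace])
  fix q assume q: "q \<in> A"
  have "h q \<in> F q" using assms(1)[of q] by (simp add: H_def)
  then show "h q \<in> F p" using assms(2)[OF q] F_antimono[of p q "h q"] by (cases "h q = 0") simp_all
qed

lemma eps_sum_H: "(\<And>q. h q \<in> H q) \<Longrightarrow> eps (\<Sum>q\<in>A. h q) = 0"
  by (simp add: eps.sum H_def)

text \<open>Take the least type \<open>p\<close> with a nonzero component. All other components lie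
  in \<open>F (p + 1)\<close>, while the conjugate of \<open>h p\<close> lies in
  \<open>F (- (p + 1))\<close>; opposedness leaves only multiples of \<open>tw\<close>, and
  \<open>H p\<close> contains no nonzero one.\<close>

lemma independent:
  assumes h: "\<And>q. h q \<in> H q" and z: "nf a b h = 0"
  shows "a = 0" "b = 0" "h q = 0"
proof -
  have "eps (nf a b h) = 0" by (simp add: z)
  then show a: "a = 0" by (simp add: eps_sum_H h)
  have "h q = 0" for q
  proof (rule ccontr)
    assume "h q \<noteq> 0"
    then have ne: "{q \<in> {-N..N}. h q \<noteq> 0} \<noteq> {}" using H_outside[OF h[of q]] by blast
    define p where "p = Min {q \<in> {-N..N}. h q \<noteq> 0}"
    have "p \<in> {q \<in> {-N..N}. h q \<noteq> 0}" unfolding p_def by (rule Min_in[OF _ ne]) (rule finite_subset[of _ "{-N..N}"]; auto)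
    then have p: "p \<in> {-N..N}" "h p \<noteq> 0" by auto
    have min: "p \<le> q" if "q \<in> {-N..N}" "h q \<noteq> 0" for q
      unfolding p_def by (rule Min_le[OF finite_subset[of _ "{-N..N}"]]) (use that in auto)
    define x where "x = (\<Sum>q\<in>{-N..N} - {p}. h q)"
    have "x \<in> F (p + 1)" unfolding x_def
    proof (rule sum_H_F[OF h])
      fix q assume "q \<in> {-N..N} - {p}" "h q \<noteq> 0"
      then have "p \<le> q" "q \<noteq> p" using min by blast+
      then show "p + 1 \<le> q" by simp
    qed
    then have xF: "- 1 *s x \<in> F (p + 1)" by (rule F_closed)
    have ex: "eps (- 1 *s x) = 0" unfolding x_def by (simp add: eps_sum_H h)
    have "(\<Sum>q\<in>{-N..N}. h q) = h p + x" unfolding x_def by (rule sum.remove) (use p in auto)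
    then have "x + (h p + b *s tw) = 0" using z a by (simp add: add_ac)
    then have e1: "- 1 *s x = h p + b *s tw" by (simp add: neg_eq_iff_add_eq_0)
    have y: "cnjv (h p) \<in> F (- (p + 1))" "eps (cnjv (h p)) = 0"
      using h[of p] by (simp_all add: H_def algebra_simps)
    have "- 1 *s x = cnjv (cnjv (h p)) + b *s tw" using e1 by simp
    from W1_disjoint[OF xF y(1) ex y(2) this] obtain c where "- 1 *s x = c *s tw" by blast
    then have "h p = (c - b) *s tw" using e1 by (simp add: vec.scale_left_diff_distrib eq_diff_eq)
    then show False using H_tw[of "c - b" p] h[of p] p(2) by simp
  qed
  then show "h q = 0" by blast
  with \<open>\<And>q. h q = 0\<close> show "b = 0" using z a by simp
qed

definition cof :: "complex \<Rightarrow> complex \<Rightarrow> (int \<Rightarrow> complex ^ 'n) \<Rightarrow> int \<times> int \<Rightarrow> complex ^ 'n" where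
  "cof a b h = (\<lambda>k. if k = (0, 0) then a *s e else if k = (-1, -1) then b *s tw
     else if fst k + snd k = -1 then h (fst k) else 0)"

lemma cof_H: "cof a b h (q, -1 - q) = h q"
  by (auto simp: cof_def)

lemma decomposes_BI_iff:
  "decomposes BI c v \<longleftrightarrow> (\<exists>a b h. (\<forall>q. h q \<in> H q) \<and> c = cof a b h \<and>
     v = nf a b h)"
proof -
  let ?K = "insert (0, 0) (insert (-1, -1) ((\<lambda>q. (q, -1 - q)) ` {-N..N}))"
  have off: "cof a b h k = 0" if "\<And>q. h q \<in> H q" "k \<notin> ?K" for a b h k
  proof (cases "fst k + snd k = -1")
    case True
    then have "k = (fst k, -1 - fst k)" by (simp add: prod_eq_iff)
    then have "fst k \<notin> {-N..N}" using that(2) by auto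
    then have "h (fst k) = 0" using H_outside that(1) by blast
    then show ?thesis using that(2) by (auto simp: cof_def)
  qed (use that(2) in \<open>auto simp: cof_def\<close>)
  have sum: "sum (cof a b h) ?K = nf a b h" for a b h
  proof -
    have "inj_on (\<lambda>q::int. (q, -1 - q)) {-N..N}" by (rule inj_onI) simp
    then have "sum (cof a b h) ((\<lambda>q. (q, -1 - q)) ` {-N..N}) = (\<Sum>q\<in>{-N..N}. cof a b h (q, -1 - q))"
      by (simp add: sum.reindex)
    also have "\<dots> = (\<Sum>q\<in>{-N..N}. h q)" by (rule sum.cong) (auto simp: cof_def)
    finally have "sum (cof a b h) ((\<lambda>q. (q, -1 - q)) ` {-N..N}) = (\<Sum>q\<in>{-N..N}. h q)" .
    moreover have "(0, 0) \<notin> insert (-1, -1) ((\<lambda>q::int. (q, -1 - q)) ` {-N..N})"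
      "(-1, -1) \<notin> (\<lambda>q::int. (q, -1 - q)) ` {-N..N}" by auto
    ultimately show ?thesis by (simp add: cof_def)
  qed
  have mem: "cof a b h k \<in> BI k" if "\<And>q. h q \<in> H q" for a b h k
    using that by (auto simp: cof_def BI_def)
  show ?thesis
  proof
    assume d: "decomposes BI c v"
    then have c: "c k \<in> BI k" for k unfolding decomposes_def by blast
    obtain a where a: "c (0, 0) = a *s e" using c[of "(0, 0)"] by (auto simp: BI_def)
    obtain b where b: "c (-1, -1) = b *s tw" using c[of "(-1, -1)"] by (auto simp: BI_def)
    define h where "h q = c (q, -1 - q)" for q
    have h: "h q \<in> H q" for q using c[of "(q, -1 - q)"] by (auto simp: BI_def h_def split: if_splits)
    have "c k = cof a b h k" for k
    proof (cases "fst k + snd k = -1")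
      case True
      then have k: "k = (fst k, -1 - fst k)" by (simp add: prod_eq_iff)
      have "c k = h (fst k)" unfolding h_def using k by simp
      moreover have "k \<noteq> (0, 0)" "k \<noteq> (-1, -1)" using True by auto
      ultimately show ?thesis using True by (simp add: cof_def)
    next
      case False
      then show ?thesis using c[of k] a b by (auto simp: cof_def BI_def split: if_splits)
    qed
    then have c_eq: "c = cof a b h" by (rule ext)
    have "v = sum c ?K" by (rule decomposes_sum[OF d]) (use off[OF h] c_eq in auto)
    then show "\<exists>a b h. (\<forall>q. h q \<in> H q) \<and> c = cof a b h \<and> v = nf a b h"
      using h c_eq sum by blast
  next
    assume "\<exists>a b h. (\<forall>q. h q \<in> H q) \<and> c = cof a b h \<and> v = nf a b h"
    then obtain a b h where h: "\<And>q. h q \<in> H q" and c: "c = cof a b h"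
      and v: "v = nf a b h" by blast
    show "decomposes BI c v"
    proof (rule decomposesI_finite[where K = ?K])
      show "c k \<in> BI k" for k unfolding c by (rule mem[OF h])
      show "c k = 0" if "k \<notin> ?K" for k unfolding c by (rule off[OF h that])
      show "v = sum c ?K" unfolding c sum by (rule v)
    qed simp
  qed
qed

text \<open>This turns every membership question about the bigrading into the vanishing of
  coefficients; both filtrations are read off from it.\<close>

lemma sum_over_BI_iff:
  "v \<in> sum_over BI K \<longleftrightarrow> (\<exists>a b h. (\<forall>q. h q \<in> H q) \<and> ((0, 0) \<notin> K \<longrightarrow> a = 0) \<and> ((-1, -1) \<notin> K \<longrightarrow> b = 0) \<and>
     (\<forall>q. (q, -1 - q) \<notin> K \<longrightarrow> h q = 0) \<and> v = nf a b h)"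
  (is "_ \<longleftrightarrow> ?R")
proof
  assume "v \<in> sum_over BI K"
  then obtain a b h where h: "\<forall>q. h q \<in> H q" and off: "\<And>k. k \<notin> K \<Longrightarrow> cof a b h k = 0"
    and v: "v = nf a b h"
    unfolding sum_over_def decomposes_BI_iff by blast
  have "e \<noteq> 0" using eps_e by force
  then have "(0, 0) \<notin> K \<longrightarrow> a = 0" using off[of "(0, 0)"] by (auto simp: cof_def)
  moreover have "(-1, -1) \<notin> K \<longrightarrow> b = 0" using off[of "(-1, -1)"] by (auto simp: cof_def)
  moreover have "\<forall>q. (q, -1 - q) \<notin> K \<longrightarrow> h q = 0"
    using off cof_H by metis
  ultimately show ?R using h v by blast
next
  assume ?R
  then obtain a b h where h: "\<forall>q. h q \<in> H q" "(0, 0) \<notin> K \<longrightarrow> a = 0" "(-1, -1) \<notin> K \<longrightarrow> b = 0"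
    "\<forall>q. (q, -1 - q) \<notin> K \<longrightarrow> h q = 0" and v: "v = nf a b h" by blast
  have "cof a b h k = 0" if "k \<notin> K" for k
  proof -
    have "k = (fst k, -1 - fst k)" if "fst k + snd k = -1" using that by (simp add: prod_eq_iff)
    then show ?thesis using that h(2-4) unfolding cof_def by (metis (no_types) vec.scale_zero_left)
  qed
  moreover have "decomposes BI (cof a b h) v" unfolding decomposes_BI_iff using h(1) v by blast
  ultimately show "v \<in> sum_over BI K" unfolding sum_over_def by blast
qed

end

subsection \<open>The Deligne bigrading\<close>

context biext_split
begin

lemma BI_00: "BI (0, 0) = range (\<lambda>a. a *s e)" and BI_m1_m1: "BI (-1, -1) = range (\<lambda>a. a *s tw)"
  by (simp_all add: BI_def)

lemma BI_H: "p + q = -1 \<Longrightarrow> BI (p, q) = H p"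
  by (auto simp: BI_def)

lemma BI_trivial: "(p, q) \<noteq> (0, 0) \<Longrightarrow> (p, q) \<noteq> (-1, -1) \<Longrightarrow> p + q \<noteq> -1 \<Longrightarrow> BI (p, q) = {0}"
  by (simp only: BI_def fst_conv snd_conv if_False)

lemma BI_subspace: "vec.subspace (BI k)"
proof -
  have r: "vec.subspace (range (\<lambda>a. a *s w))" for w :: "complex ^ 'n"
    using vec.subspace_span[of "{w}"] by (simp add: vec.span_singleton)
  have "vec.subspace (H q)" for q by (rule vec.subspaceI) (rule H_closed | assumption)+
  then show ?thesis using r by (simp add: BI_def)
qed

lemma BI_unique: "\<exists>!c. decomposes BI c v"
proof (rule ex_ex1I)
  have "eps (v - eps v *s e) = 0" by simp
  from span_W1[OF this] obtain h b where h: "\<forall>q. h q \<in> H q"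
    and "v - eps v *s e = b *s tw + (\<Sum>q\<in>{-N..N}. h q)" by (elim exE conjE) (rule that)
  then have "v = nf (eps v) b h" by (simp add: algebra_simps)
  with h have "decomposes BI (cof (eps v) b h) v" unfolding decomposes_BI_iff by blast
  then show "\<exists>c. decomposes BI c v" by blast
next
  fix c d assume "decomposes BI c v" "decomposes BI d v"
  then obtain a b h a' b' h' where h: "\<forall>q. h q \<in> H q" "\<forall>q. h' q \<in> H q"
    and c: "c = cof a b h" "d = cof a' b' h'"
    and v: "v = nf a b h" "v = nf a' b' h'"
    unfolding decomposes_BI_iff by (elim exE conjE) (rule that)
  have H: "h q + (-1) *s h' q \<in> H q" for q using h by (intro H_closed) blast+
  have "nf a b h - nf a' b' h' = 0"
    using v by simp
  then have z: "(a - a') *s e + (b - b') *s tw + (\<Sum>q\<in>{-N..N}. h q + (-1) *s h' q) = 0"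
    by (simp add: vec.scale_left_diff_distrib sum_subtractf algebra_simps)
  have "h = h'"
  proof
    show "h q = h' q" for q using independent(3)[OF H z, of q] by simp
  qed
  moreover have "a = a'" "b = b'" using independent(1,2)[OF H z] by simp_all
  ultimately
  show "c = d" by (simp add: c)
qed

sublocale BI: bigraded BI
  by unfold_locales (rule BI_subspace BI_unique)+

lemma e_F_le: "p \<le> 0 \<Longrightarrow> a *s e \<in> F p"
  by (rule F_closed(4)[OF F_antimono[OF _ e_F]])

lemma F_eq_sum_over: "F p = sum_over BI (Fge p)"
proof (intro equalityI subsetI)
  fix v assume v: "v \<in> F p"
  define a where "a = eps v"
  have a: "p \<le> 0 \<or> a = 0" using F_pos_eps[OF v] unfolding a_def by (cases "p \<le> 0") simp_all
  have "a *s e \<in> F p" using a e_F_le[of p a] by auto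
  then have "v - a *s e \<in> F p" using v by simp
  moreover have "eps (v - a *s e) = 0" by (simp add: a_def)
  ultimately have "\<exists>h b. (\<forall>q. h q \<in> H q) \<and> (\<forall>q<p. h q = 0) \<and> (p \<ge> 0 \<longrightarrow> b = 0) \<and>
    v - a *s e = b *s tw + (\<Sum>q\<in>{-N..N}. h q)" by (rule span_F)
  then obtain h b where h: "\<forall>q. h q \<in> H q" "\<forall>q<p. h q = 0" "p \<ge> 0 \<longrightarrow> b = 0"
    "v - a *s e = b *s tw + (\<Sum>q\<in>{-N..N}. h q)" by (elim exE conjE) (rule that)
  have "v = nf a b h" using h(4) by (simp add: diff_eq_eq add_ac)
  moreover have "(0::int, 0::int) \<notin> Fge p \<longrightarrow> a = 0" using a by auto
  moreover have "(-1::int, -1::int) \<notin> Fge p \<longrightarrow> b = 0" using h(3) by auto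
  moreover have "\<forall>q. (q, -1 - q) \<notin> Fge p \<longrightarrow> h q = 0" using h(2) by auto
  ultimately show "v \<in> sum_over BI (Fge p)"
    unfolding sum_over_BI_iff using h(1) by (intro exI[of _ a] exI[of _ b] exI[of _ h] conjI)
next
  fix v assume "v \<in> sum_over BI (Fge p)"
  then obtain a b h where h: "\<forall>q. h q \<in> H q" "(0::int, 0::int) \<notin> Fge p \<longrightarrow> a = 0"
    "(-1::int, -1::int) \<notin> Fge p \<longrightarrow> b = 0" "\<forall>q. (q, -1 - q) \<notin> Fge p \<longrightarrow> h q = 0"
    "v = nf a b h"
    unfolding sum_over_BI_iff by (elim exE conjE) (rule that)
  have "a *s e \<in> F p" using h(2) e_F_le[of p a] by auto
  moreover have "b *s tw \<in> F p" using h(3) tw_F_neg[of p b] by auto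
  moreover have "(\<Sum>q\<in>{-N..N}. h q) \<in> F p"
  proof (rule sum_H_F)
    show "h q \<in> H q" for q using h(1) by blast
    show "p \<le> q" if "h q \<noteq> 0" for q using h(4) that by auto
  qed
  ultimately show "v \<in> F p" unfolding h(5) by (intro F_closed(2))
qed

lemma normal_form:
  "\<exists>b h. (\<forall>q. h q \<in> H q) \<and> v = nf (eps v) b h"
proof -
  obtain c where "decomposes BI c v" using BI_unique by blast
  then obtain a b h where h: "\<forall>q. h q \<in> H q" and v: "v = nf a b h"
    unfolding decomposes_BI_iff by (elim exE conjE) (rule that)
  have a: "eps v = a" unfolding v by (simp add: eps_sum_H h)
  show ?thesis unfolding a using h v by (intro exI[of _ b] exI[of _ h] conjI)
qed

lemma wfil_eq_sum_over: "wfil eps tw k = sum_over BI (Wle k)"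
proof -
  consider "k \<ge> 0" | "k = -1" | "k = -2" | "k \<le> -3" by linarith
  then show ?thesis
  proof cases
    case 1
    have "v \<in> sum_over BI (Wle k)" for v
    proof -
      obtain b h where "\<forall>q. h q \<in> H q" "v = nf (eps v) b h"
        using normal_form[of v] by (elim exE conjE) (rule that)
      then show ?thesis unfolding sum_over_BI_iff using 1
        by (intro exI[of _ "eps v"] exI[of _ b] exI[of _ h]) auto
    qed
    then show ?thesis using 1 by (auto simp: wfil_simps)
  next
    case 2
    have "eps v = 0 \<longleftrightarrow> v \<in> sum_over BI (Wle k)" for v
    proof
      assume v: "eps v = 0"
      obtain b h where "\<forall>q. h q \<in> H q" "v = nf (eps v) b h"
        using normal_form[of v] by (elim exE conjE) (rule that)
      then show "v \<in> sum_over BI (Wle k)" unfolding sum_over_BI_iff using 2 v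
        by (intro exI[of _ 0] exI[of _ b] exI[of _ h]) auto
    next
      assume "v \<in> sum_over BI (Wle k)"
      then obtain a b h where h: "\<forall>q. h q \<in> H q" "a = 0" "v = nf a b h"
        unfolding sum_over_BI_iff using 2 by auto
      show "eps v = 0" unfolding h(2,3) by (simp add: eps_sum_H h(1))
    qed
    then show ?thesis by (auto simp: 2 wfil_simps)
  next
    case 3
    have "v \<in> range (\<lambda>a. a *s tw) \<longleftrightarrow> v \<in> sum_over BI (Wle k)" for v
    proof
      assume "v \<in> range (\<lambda>a. a *s tw)"
      then obtain b where "v = b *s tw" by blast
      then show "v \<in> sum_over BI (Wle k)" unfolding sum_over_BI_iff using 3
        by (intro exI[of _ 0] exI[of _ b] exI[of _ "\<lambda>q. 0"]) auto
    next
      assume "v \<in> sum_over BI (Wle k)"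
      then obtain a b h where "a = 0" "\<forall>q. h q = 0" "v = nf a b h"
        unfolding sum_over_BI_iff using 3 by auto
      then show "v \<in> range (\<lambda>a. a *s tw)" by simp
    qed
    then show ?thesis by (auto simp: 3 wfil_simps)
  next
    case 4
    have "v = 0 \<longleftrightarrow> v \<in> sum_over BI (Wle k)" for v
    proof
      assume "v \<in> sum_over BI (Wle k)"
      then obtain a b h where "a = 0" "b = 0" "\<forall>q. h q = 0" "v = nf a b h"
        unfolding sum_over_BI_iff using 4 by auto
      then show "v = 0" by simp
    qed (simp add: vec.subspace_0 BI.sum_over_subspace)
    then show ?thesis using 4 by (auto simp: wfil_simps)
  qed
qed

lemma cnjv_tw_line: "cnjv ` range (\<lambda>a. a *s tw) = range (\<lambda>a. a *s tw)"
proof -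
  have "cnjv (cnj a *s tw) \<in> cnjv ` range (\<lambda>a. a *s tw)" for a by (intro imageI rangeI)
  then show ?thesis by auto
qed

lemma cnjv_H: "cnjv ` H p = H (-1 - p)"
proof -
  have "x \<in> cnjv ` H p \<longleftrightarrow> x \<in> H (-1 - p)" for x
    using H_cnjv[of x p] by (metis cnjv_simps(6) image_iff)
  then show ?thesis by blast
qed

lemma cnjv_BI: "(p, q) \<noteq> (0, 0) \<Longrightarrow> cnjv ` BI (p, q) = BI (q, p)"
proof -
  assume pq: "(p, q) \<noteq> (0, 0)"
  show ?thesis
  proof (cases "p + q = -1")
    case True
    then have q: "q = -1 - p" by simp
    have "p = 0 \<Longrightarrow> q \<noteq> 0" "p = -1 \<Longrightarrow> q \<noteq> -1" using True by simp_all
    then have "BI (p, q) = H p" "BI (q, p) = H (-1 - p)" by (auto simp: BI_def q)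
    then show ?thesis by (simp add: cnjv_H)
  next
    case False
    then show ?thesis using pq cnjv_tw_line by (auto simp: BI_def)
  qed
qed

lemma sum_over_00: "sum_over BI {(a, b). a < 0 \<and> b < 0} = range (\<lambda>a. a *s tw)"
proof -
  have "sum_over BI {(a, b). a < 0 \<and> b < 0} = sum_over BI {(-1, -1)}"
    by (rule equalityI[OF BI.sum_over_restrict BI.sum_over_mono]) (auto simp: BI_def)
  then show ?thesis by (simp add: BI.sum_over_single) (simp add: BI_def)
qed

lemma deligne_bigrading_BI: "deligne_bigrading eps tw F BI"
  unfolding deligne_bigrading_def
proof (intro conjI allI)
  fix p q
  show "cnjv ` BI (p, q) + sum_over BI {(a, b). a < q \<and> b < p} = BI (q, p) + sum_over BI {(a, b). a < q \<and> b < p}"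
  proof (cases "(p, q) = (0, 0)")
    case True
    have "a *s cnjv e + b *s tw = a *s e + (b + a * ea) *s tw" for a b
      by (simp add: cnjv_e vec.scale_left_distrib vec.scale_right_distrib)
    then have 1: "cnjv (a *s e) + b *s tw = cnj a *s e + (b + cnj a * ea) *s tw" for a b by simp
    have "cnjv ` range (\<lambda>a. a *s e) + range (\<lambda>a. a *s tw) = range (\<lambda>a. a *s e) + range (\<lambda>a. a *s tw)"
    proof (intro equalityI subsetI)
      fix v assume "v \<in> cnjv ` range (\<lambda>a. a *s e) + range (\<lambda>a. a *s tw)"
      then obtain a b where v: "v = cnjv (a *s e) + b *s tw" by (auto simp: set_plus_def)
      show "v \<in> range (\<lambda>a. a *s e) + range (\<lambda>a. a *s tw)" unfolding v 1 by (intro set_plus_intro rangeI)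
    next
      fix v assume "v \<in> range (\<lambda>a. a *s e) + range (\<lambda>a. a *s tw)"
      then obtain a b where v: "v = a *s e + b *s tw" by (auto simp: set_plus_def)
      have v': "v = cnjv (cnj a *s e) + (b - a * ea) *s tw" unfolding v 1 by simp
      show "v \<in> cnjv ` range (\<lambda>a. a *s e) + range (\<lambda>a. a *s tw)"
        unfolding v' by (intro set_plus_intro rangeI imageI)
    qed
    moreover have "p = 0" "q = 0" using True by auto
    ultimately show ?thesis using sum_over_00 by (simp add: BI_def)
  qed (simp add: cnjv_BI)
qed (rule BI_subspace BI_unique F_eq_sum_over wfil_eq_sum_over)+

text \<open>\<open>F\<close> and \<open>W\<close> locate \<open>J (-1, -1)\<close>, the types in weight
  \<open>0\<close> and the vanishing pieces; in weight \<open>-1\<close> the congruence is an equality, which gives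
  \<open>J (p, q)\<close>; then the congruence for \<open>J (0, 0)\<close> is modulo \<open>tw\<close>.\<close>

lemma deligne_bigrading_unique:
  assumes "deligne_bigrading eps tw F J"
  shows "J = BI"
proof -
  have J_F: "F p = sum_over J (Fge p)" and J_W: "wfil eps tw k = sum_over J (Wle k)"
    and J_c: "cnjv ` J (p, q) + sum_over J {(a, b). a < q \<and> b < p} = J (q, p) + sum_over J {(a, b). a < q \<and> b < p}"
    for p q k using assms unfolding deligne_bigrading_def by blast+
  interpret J: bigraded J
    using assms unfolding deligne_bigrading_def by unfold_locales blast+
  have J_sub_F: "J (a, b) \<subseteq> F p" if "p \<le> a" for a b p
    unfolding J_F using J.sum_over_mono[of "{(a, b)}"] that by (auto simp: J.sum_over_single)
  have J_sub_W: "J (a, b) \<subseteq> wfil eps tw k" if "a + b \<le> k" for a b k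
    unfolding J_W using J.sum_over_mono[of "{(a, b)}"] that by (auto simp: J.sum_over_single)
  \<comment> \<open>A piece is shown to be zero by placing its elements in a sum of other
    pieces.\<close>
  have J_zero: "J k = {0}" if "\<And>v. v \<in> J k \<Longrightarrow> v \<in> sum_over J K" "k \<notin> K" for k K
  proof (intro equalityI subsetI)
    fix v assume v: "v \<in> J k"
    then have "v \<in> sum_over J {k}" by (simp add: J.sum_over_single)
    from J.sum_over_disjoint[OF this that(1)[OF v]] that(2) show "v \<in> {0}" by simp
  qed (simp add: J.zero)
  have low: "J (a, b) = {0}" if "a + b \<le> -3" for a b
    using J_sub_W[OF that] J.zero[of "(a, b)"] by (auto simp: wfil_simps)
  have high: "J (a, b) = {0}" if "a + b > 0" for a b
  proof (rule J_zero)
    show "v \<in> sum_over J (Wle 0)" for v using J_W[of 0] by (simp add: wfil_simps)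
  qed (use that in simp)
  have w2: "J (a, b) = {0}" if "a + b = -2" "a \<noteq> -1" for a b
  proof (cases "a \<ge> 0")
    case True
    have "v = 0" if v: "v \<in> J (a, b)" for v
    proof -
      have "v \<in> wfil eps tw (-2)" using J_sub_W[of a b "-2"] v \<open>a + b = -2\<close> by auto
      then obtain c where c: "v = c *s tw" by (auto simp: wfil_simps)
      moreover have "v \<in> F 0" using J_sub_F[OF True] v by blast
      ultimately show ?thesis using tw_F0[of c 0] by simp
    qed
    then show ?thesis using J.zero[of "(a, b)"] by blast
  next
    case False
    show ?thesis
    proof (rule J_zero)
      show "v \<in> sum_over J (Fge (-1))" if v: "v \<in> J (a, b)" for v
      proof -
        have "v \<in> wfil eps tw (-2)" using J_sub_W[of a b "-2"] v \<open>a + b = -2\<close> by auto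
        then obtain c where c: "v = c *s tw" by (auto simp: wfil_simps)
        show ?thesis unfolding J_F[symmetric] c by (rule tw_F_neg) simp
      qed
    qed (use False that in auto)
  qed
  have J11: "J (-1, -1) = range (\<lambda>a. a *s tw)"
  proof (intro equalityI subsetI)
    show "v \<in> range (\<lambda>a. a *s tw)" if "v \<in> J (-1, -1)" for v
      using J_sub_W[of "-1" "-1" "-2"] that by (auto simp: wfil_simps)
    fix v assume v: "v \<in> range (\<lambda>a. a *s tw)"
    then have "v \<in> sum_over J (Wle (-2))" unfolding J_W[symmetric] by (simp add: wfil_simps)
    moreover have "sum_over J (Wle (-2)) \<subseteq> sum_over J {(-1, -1)}"
    proof (rule J.sum_over_restrict)
      fix k :: "int \<times> int" assume "k \<in> Wle (-2)" "k \<notin> {(-1, -1)}"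
      then have "fst k + snd k \<le> -2" "fst k \<noteq> -1 \<or> snd k \<noteq> -1" by (auto simp: prod_eq_iff)
      then have "fst k + snd k \<le> -3 \<or> fst k + snd k = -2 \<and> fst k \<noteq> -1" by linarith
      then show "J k = {0}" using low[of "fst k" "snd k"] w2[of "fst k" "snd k"] by auto
    qed
    ultimately show "v \<in> J (-1, -1)" by (auto simp: J.sum_over_single)
  qed
  have w0: "J (a, b) = {0}" if "a + b = 0" "a \<noteq> 0" for a b
  proof (cases "a \<ge> 1")
    case True
    show ?thesis
    proof (rule J_zero)
      show "v \<in> sum_over J (Wle (-1))" if "v \<in> J (a, b)" for v
        using F_pos_eps[of v a] J_sub_F[of a a b] that True
        unfolding J_W[symmetric] by (auto simp: wfil_simps)
    qed (use that in simp)
  next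
    case False
    show ?thesis
    proof (rule J_zero)
      fix v
      \<comment> \<open>As \<open>e\<close> lies in \<open>F 0\<close>, the step \<open>F 0\<close>
        and W (-1) together span everything, so there is no room for a piece of weight 0 with
        negative first degree.\<close>
      have "v - eps v *s e \<in> wfil eps tw (-1)" by (simp add: wfil_simps)
      then have "v - eps v *s e \<in> sum_over J (Fge 0 \<union> Wle (-1))"
        unfolding J_W using J.sum_over_mono[of "Wle (-1)"] by blast
      moreover have "eps v *s e \<in> sum_over J (Fge 0)"
        unfolding J_F[symmetric] by (rule e_F_le) simp
      then have "eps v *s e \<in> sum_over J (Fge 0 \<union> Wle (-1))"
        using J.sum_over_mono[of "Fge 0"] by blast
      ultimately have "(v - eps v *s e) + eps v *s e \<in> sum_over J (Fge 0 \<union> Wle (-1))"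
        by (rule vec.subspace_add[OF J.sum_over_subspace])
      then show "v \<in> sum_over J (Fge 0 \<union> Wle (-1))" by simp
    qed (use False that in auto)
  qed
  have cJ: "cnjv ` J (p, q) = J (q, p)" if "p + q \<le> -1" for p q
  proof -
    have "sum_over J {(a, b). a < q \<and> b < p} \<subseteq> sum_over J {}"
      by (rule J.sum_over_restrict) (use that in \<open>auto intro!: low\<close>)
    then have "sum_over J {(a, b). a < q \<and> b < p} = {0}"
      using vec.subspace_0[OF J.sum_over_subspace] by (auto simp: J.sum_over_empty)
    then show ?thesis using J_c[of p q] by (simp add: set_plus_def)
  qed
  \<comment> \<open>In negative weights conjugation exchanges the pieces exactly, not only modulo
    lower ones; hence the restriction to \<open>Wle (-1)\<close>.\<close>
  have swap: "cnjv v \<in> sum_over J (prod.swap -` K)" if vK: "v \<in> sum_over J K" "K \<subseteq> Wle (-1)" for v K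
  proof -
    obtain c where c: "decomposes J c v" "\<And>k. k \<notin> K \<Longrightarrow> c k = 0"
      using vK(1) unfolding sum_over_def by blast
    have "decomposes (\<lambda>k. cnjv ` J k) (\<lambda>k. cnjv (c k)) (cnjv v)"
      by (rule decomposes_map[OF c(1)]) auto
    from decomposes_reindex[OF this bij_swap]
    have d: "decomposes (\<lambda>k. cnjv ` J (prod.swap k)) (\<lambda>k. cnjv (c (prod.swap k))) (cnjv v)" .
    have off: "cnjv (c (prod.swap k)) = 0" if "k \<notin> prod.swap -` K" for k
      using c(2)[of "prod.swap k"] that by simp
    have mem: "cnjv (c (prod.swap k)) \<in> J k" for k
    proof (cases "k \<in> prod.swap -` K")
      case True
      then have "snd k + fst k \<le> -1" using vK(2) by (cases k) auto
      from cJ[OF this] have "cnjv ` J (prod.swap k) = J k" by (cases k) simp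
      then show ?thesis using d unfolding decomposes_def by blast
    qed (simp add: off J.zero)
    have "decomposes J (\<lambda>k. cnjv (c (prod.swap k))) (cnjv v)"
      using d mem unfolding decomposes_def by blast
    then show ?thesis using off unfolding sum_over_def by blast
  qed
  have w1: "J (p, q) = H p" if pq: "p + q = -1" for p q
  proof (intro equalityI subsetI)
    fix v assume v: "v \<in> J (p, q)"
    then have "cnjv v \<in> J (q, p)" using cJ[of p q] pq by auto
    then have "cnjv v \<in> F q" using J_sub_F[of q q p] by blast
    moreover have "v \<in> F p" using J_sub_F[of p p q] v by blast
    moreover have "eps v = 0" using J_sub_W[of p q "-1"] v pq by (auto simp: wfil_simps)
    moreover have "q = -1 - p" using pq by simp
    ultimately show "v \<in> H p" by (simp add: H_def)
  next
    fix v assume "v \<in> H p"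
    moreover have q: "q = -1 - p" using pq by simp
    ultimately have v: "v \<in> F p" "eps v = 0" "cnjv v \<in> F q" unfolding q by (simp_all add: H_def)
    have F1: "w \<in> sum_over J {(a, b). a \<ge> r \<and> a + b \<le> -1}" if "w \<in> F r" "eps w = 0" for w r
    proof -
      have "w \<in> sum_over J (Wle (-1))" unfolding J_W[symmetric] using that by (simp add: wfil_simps)
      from J.sum_over_Int[OF that(1)[unfolded J_F] this] show ?thesis
        by (rule rev_subsetD[OF _ J.sum_over_mono]) auto
    qed
    have "cnjv (cnjv v) \<in> sum_over J (prod.swap -` {(a, b). a \<ge> q \<and> a + b \<le> -1})"
      by (rule swap[OF F1[OF v(3)]]) (use v(2) in auto)
    then have "v \<in> sum_over J (prod.swap -` {(a, b). a \<ge> q \<and> a + b \<le> -1})" by simp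
    from J.sum_over_Int[OF F1[OF v(1,2)] this] have "v \<in> sum_over J {(p, q)}"
      by (rule rev_subsetD[OF _ J.sum_over_mono]) (use pq in auto)
    then show "v \<in> J (p, q)" by (simp add: J.sum_over_single)
  qed
  have J00: "J (0, 0) = range (\<lambda>a. a *s e)"
  proof -
    have S: "sum_over J {(a, b). a < 0 \<and> b < 0} = range (\<lambda>a. a *s tw)"
    proof -
      have "sum_over J {(a, b). a < 0 \<and> b < 0} = sum_over J {(-1, -1)}"
      proof (rule equalityI[OF J.sum_over_restrict J.sum_over_mono])
        fix k :: "int \<times> int" assume "k \<in> {(a, b). a < 0 \<and> b < 0}" "k \<notin> {(-1, -1)}"
        then have "fst k < 0" "snd k < 0" "fst k \<noteq> -1 \<or> snd k \<noteq> -1" by (auto simp: prod_eq_iff)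
        then have "fst k + snd k \<le> -3" by linarith
        then show "J k = {0}" using low[of "fst k" "snd k"] by auto
      qed auto
      then show ?thesis by (simp add: J.sum_over_single J11)
    qed
    have c00: "cnjv ` J (0, 0) + range (\<lambda>a. a *s tw) = J (0, 0) + range (\<lambda>a. a *s tw)"
      using J_c[of 0 0] unfolding S .
    have tw0: "0 \<in> range (\<lambda>a. a *s tw)" by (rule range_eqI[of _ _ 0]) simp
    have mod: "\<exists>i \<in> J (0, 0). \<exists>a. cnjv v = i + a *s tw" if "v \<in> J (0, 0)" for v
    proof -
      have "cnjv v + 0 \<in> J (0, 0) + range (\<lambda>a. a *s tw)"
        unfolding c00[symmetric] using that tw0 by (intro set_plus_intro imageI)
      then show ?thesis by (auto simp: set_plus_def)
    qed
    show ?thesis unfolding I00_eq[symmetric]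
    proof (intro equalityI subsetI)
      fix v assume v: "v \<in> J (0, 0)"
      from mod[OF v] obtain i a where i: "i \<in> J (0, 0)" "cnjv v = i + a *s tw" by blast
      have "cnjv v - a *s tw \<in> F 0" using i J_sub_F[of 0 0 0] by auto
      moreover have "v \<in> F 0" using v J_sub_F[of 0 0 0] by auto
      ultimately show "v \<in> {v \<in> F 0. \<exists>a. cnjv v - a *s tw \<in> F 0}" by blast
    next
      fix v assume "v \<in> {v \<in> F 0. \<exists>a. cnjv v - a *s tw \<in> F 0}"
      then obtain b where v: "v \<in> F 0" and w: "cnjv v - b *s tw \<in> F 0" by blast
      let ?L = "{(a::int, b::int). a \<ge> 0 \<and> a + b \<le> -1}"
      let ?L' = "{(a::int, b::int). b \<ge> 0 \<and> a + b \<le> -1}"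
      let ?K = "{(0, 0), (-1, -1)} \<union> ?L'"
      \<comment> \<open>All other pieces of \<open>F 0\<close> of nonnegative weight were shown to
        be zero, so only type (0, 0) and negative weights remain.\<close>
      have "sum_over J (Fge 0) \<subseteq> sum_over J ({(0, 0)} \<union> ?L)"
      proof (rule J.sum_over_restrict)
        fix k :: "int \<times> int" assume "k \<in> Fge 0" "k \<notin> {(0, 0)} \<union> ?L"
        then have "fst k \<ge> 0" "fst k \<noteq> 0 \<or> snd k \<noteq> 0" "fst k + snd k \<ge> 0"
          by (auto simp: prod_eq_iff)
        then have "fst k + snd k > 0 \<or> fst k + snd k = 0 \<and> fst k \<noteq> 0" by linarith
        then show "J k = {0}" using high[of "fst k" "snd k"] w0[of "fst k" "snd k"] by auto
      qed
      then have "cnjv v - b *s tw \<in> sum_over J ({(0, 0)} \<union> ?L)" using w unfolding J_F by blast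
      from J.sum_over_split[OF this] obtain x y where xy: "x \<in> J (0, 0)" "y \<in> sum_over J ?L"
        "cnjv v - b *s tw = x + y" by (auto simp: J.sum_over_single)
      from mod[OF xy(1)] obtain i a where i: "i \<in> J (0, 0)" "cnjv x = i + a *s tw" by blast
      have "cnjv (cnjv v) = cnjv (x + y + b *s tw)" using xy(3) by (simp add: diff_eq_eq)
      then have v_eq: "v = i + (a + cnj b) *s tw + cnjv y" using i(2) by (simp add: vec.scale_left_distrib)
      have sub: "J k \<subseteq> sum_over J ?K" if "k \<in> ?K" for k
        using J.sum_over_mono[of "{k}" ?K] that by (simp only: J.sum_over_single) blast
      have "i \<in> sum_over J ?K" using sub[of "(0, 0)"] i(1) by auto
      moreover have "(a + cnj b) *s tw \<in> J (-1, -1)" unfolding J11 by (rule rangeI)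
      then have "(a + cnj b) *s tw \<in> sum_over J ?K" using sub[of "(-1, -1)"] by blast
      moreover have "cnjv y \<in> sum_over J (prod.swap -` ?L)" by (rule swap[OF xy(2)]) auto
      then have "cnjv y \<in> sum_over J ?K" by (rule rev_subsetD[OF _ J.sum_over_mono]) auto
      ultimately have "v \<in> sum_over J ?K" unfolding v_eq
        by (intro vec.subspace_add[OF J.sum_over_subspace])
      \<comment> \<open>The types in \<open>?K\<close> other than (0, 0) have negative first degree,
        so intersecting with \<open>F 0\<close> leaves (0, 0) alone.\<close>
      from J.sum_over_Int[OF this v[unfolded J_F]] have "v \<in> sum_over J {(0, 0)}"
        by (rule rev_subsetD[OF _ J.sum_over_mono]) auto
      then show "v \<in> J (0, 0)" by (simp add: J.sum_over_single)
    qed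
  qed
  have "J (a, b) = BI (a, b)" for a b
  proof -
    consider "a + b > 0" | "a + b = 0" "a = 0" | "a + b = 0" "a \<noteq> 0" | "a + b = -1" | "a + b = -2" "a = -1"
      | "a + b = -2" "a \<noteq> -1" | "a + b \<le> -3" by linarith
    then show ?thesis
    proof cases
      case 1
      then have "BI (a, b) = {0}" by (intro BI_trivial) auto
      then show ?thesis using high[OF 1] by (simp only:)
    next
      case 2
      then show ?thesis using J00 by (simp add: BI_def)
    next
      case 3
      then have "BI (a, b) = {0}" by (intro BI_trivial) auto
      then show ?thesis using w0[OF 3] by (simp only:)
    next
      case 4
      then show ?thesis by (simp only: BI_H[OF 4] w1[OF 4])
    next
      case 5
      then have "(a, b) = (-1, -1)" by simp
      then show ?thesis using J11 by (simp add: BI_def)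
    next
      case 6
      then have "BI (a, b) = {0}" by (intro BI_trivial) auto
      then show ?thesis using w2[OF 6] by (simp only:)
    next
      case 7
      then have "BI (a, b) = {0}" by (intro BI_trivial) auto
      then show ?thesis using low[OF 7] by (simp only:)
    qed
  qed
  then have "J k = BI k" for k by (metis surj_pair)
  then show ?thesis by (rule ext)
qed

lemma Ipq_eq: "Ipq eps tw F = BI"
  unfolding Ipq_def using deligne_bigrading_BI deligne_bigrading_unique by (rule the_equality)

text \<open>Type (0, 0) is the only one that can fail to be real, and there the conjugate of
  \<open>e\<close> is \<open>e + ea *s tw\<close>, which lies on the line of \<open>e\<close> only
  for \<open>ea = 0\<close>.\<close>

lemma split_over_reals_iff: "split_over_reals eps tw F \<longleftrightarrow> ea = 0"
proof
  assume "split_over_reals eps tw F"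
  then obtain J where "deligne_bigrading eps tw F J" "cnjv ` J (0, 0) = J (0, 0)"
    unfolding split_over_reals_def by blast
  then have "cnjv ` BI (0, 0) = BI (0, 0)" using deligne_bigrading_unique by simp
  moreover have "1 *s e \<in> BI (0, 0)" unfolding BI_00 by (rule rangeI)
  ultimately have "cnjv (1 *s e) \<in> BI (0, 0)" by blast
  then obtain a where a: "e + ea *s tw = a *s e" by (auto simp: BI_def cnjv_e)
  then have "eps (e + ea *s tw) = eps (a *s e)" by (rule arg_cong)
  then have "a = 1" by simp
  then show "ea = 0" using a by simp
next
  assume "ea = 0"
  then have e: "cnjv e = e" by (simp add: cnjv_e)
  have "cnjv ` BI (0, 0) = BI (0, 0)"
  proof -
    have "cnjv (cnj a *s e) \<in> cnjv ` range (\<lambda>a. a *s e)" for a by (intro imageI rangeI)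
    then show ?thesis by (auto simp: BI_def e)
  qed
  then have "cnjv ` BI (p, q) = BI (q, p)" for p q using cnjv_BI[of p q] by (cases "(p, q) = (0, 0)") auto
  then show "split_over_reals eps tw F" unfolding split_over_reals_def using deligne_bigrading_BI by blast
qed

end

subsection \<open>The splitting of a mixed Hodge structure of biextension type\<close>

lemma cnjv_real_matrix:
  assumes "real_matrix X"
  shows "cnjv (X *v v) = X *v cnjv v"
proof -
  have "cnj (X $ i $ j) = X $ i $ j" for i j using assms by (simp add: real_matrix_def Reals_cnj_iff)
  then show ?thesis by (simp add: cnjv_def matrix_vector_mult_def vec_eq_iff)
qed

lemma cscale_matrix_mult: "cscale_matrix c A *v v = c *s (A *v v)"
  by (simp add: cscale_matrix_def matrix_vector_mult_def vec_eq_iff sum_distrib_left mult.assoc)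

lemma mexp_nilpotent:
  fixes A :: "complex ^ 'n::finite ^ 'n"
  assumes "(((**) A) ^^ N) (mat 1) = 0"
  shows "mexp A = (\<Sum>k<N. (((**) A) ^^ k) (mat 1) /\<^sub>R fact k)"
proof -
  have "(((**) A) ^^ k) (mat 1) = 0" if "k \<ge> N" for k
  proof -
    have z: "(((**) A) ^^ m) 0 = 0" for m by (induction m) simp_all
    have "(((**) A) ^^ k) (mat 1) = (((**) A) ^^ (k - N)) ((((**) A) ^^ N) (mat 1))"
      using that by (simp flip: comp_apply[of "((**) A) ^^ (k - N)"] funpow_add)
    then show ?thesis by (simp add: assms z)
  qed
  then have "suminf (\<lambda>k. (((**) A) ^^ k) (mat 1) /\<^sub>R fact k) = (\<Sum>k<N. (((**) A) ^^ k) (mat 1) /\<^sub>R fact k)"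
    by (intro suminf_finite) auto
  then show ?thesis by (simp add: mexp_def)
qed

lemma matrix_vector_mult_funpow:
  "(((**) A) ^^ k) (mat 1) *v v = (((*v) A) ^^ k) v" for A :: "complex ^ 'n::finite ^ 'n"
  by (induction k) (simp_all add: matrix_vector_mul_assoc[symmetric])

lemma scaleR_matrix_vector_mult: "(c *\<^sub>R A) *v v = c *\<^sub>R (A *v v)" for A :: "complex ^ 'n::finite ^ 'n"
  by (simp add: vec_eq_iff matrix_vector_mult_def scaleR_sum_right)

lemma sum_matrix_vector_mult: "sum f S *v v = (\<Sum>k\<in>S. f k *v v)" for f :: "'k \<Rightarrow> complex ^ 'n::finite ^ 'n"
  by (induction S rule: infinite_finite_induct) (simp_all add: matrix_vector_mult_add_rdistrib)

lemma mexp_nilpotent_mult: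
  fixes A :: "complex ^ 'n::finite ^ 'n"
  assumes "\<And>v. (((*v) A) ^^ N) v = 0"
  shows "mexp A *v v = (\<Sum>k<N. (((*v) A) ^^ k) v /\<^sub>R fact k)"
proof -
  have "(((**) A) ^^ N) (mat 1) = 0"
    by (rule matrix_eq[THEN iffD2]) (simp add: matrix_vector_mult_funpow assms)
  from mexp_nilpotent[OF this] show ?thesis
    by (simp add: sum_matrix_vector_mult scaleR_matrix_vector_mult matrix_vector_mult_funpow)
qed

section \<open>Translations along \<open>tw\<close>\<close>

context biext_lat
begin

text \<open>The unipotent map exp (- c * X), where \<open>X\<close> sends vectors of
  \<open>eps\<close>-value 1 to \<open>tw\<close> and kills W (-1); these are the exponentials of
  g^{-1,-1}.\<close>

definition gmap :: "complex \<Rightarrow> complex ^ 'n \<Rightarrow> complex ^ 'n" where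
  "gmap c v = v - (c * eps v) *s tw"

lemma eps_gmap [simp]: "eps (gmap c v) = eps v"
  by (simp add: gmap_def)

lemma gmap_W1: "eps v = 0 \<Longrightarrow> gmap c v = v"
  by (simp add: gmap_def)

lemma gmap_gmap: "gmap c (gmap d v) = gmap (c + d) v"
  by (simp add: gmap_def vec.scale_left_distrib distrib_right)

lemma gmap_0 [simp]: "gmap 0 v = v"
  by (simp add: gmap_def)

lemma gmap_linear: "gmap c (u + v) = gmap c u + gmap c v" "gmap c (a *s v) = a *s gmap c v"
proof -
  show "gmap c (u + v) = gmap c u + gmap c v"
    by (simp add: gmap_def vec.scale_left_distrib distrib_left)
  have "c * (a * eps v) = a * (c * eps v)" by (rule mult.left_commute)
  then show "gmap c (a *s v) = a *s gmap c v"
    by (simp add: gmap_def vec.scale_right_diff_distrib)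
qed

lemma tw_wfil: "k \<ge> -2 \<Longrightarrow> a *s tw \<in> wfil eps tw k"
  by (simp add: wfil_def)

lemma wfil_subspace: "vec.subspace (wfil eps tw k)"
proof -
  have "vec.subspace (range (\<lambda>a. a *s tw))"
    using vec.subspace_span[of "{tw}"] by (simp add: vec.span_singleton)
  moreover have "vec.subspace {v. eps v = 0}" by (rule vec.subspaceI) auto
  ultimately show ?thesis by (simp add: wfil_def)
qed

text \<open>The map changes a vector by a multiple of \<open>tw\<close>, which lies in W (k - 1) for
  \<open>k \<ge> 0\<close>, and it fixes W (-1): it is the identity on every graded piece and so
  preserves mixed Hodge structures.\<close>

lemma grF_gmap_subset: "grF eps tw (\<lambda>p. gmap c ` F p) k p \<subseteq> grF eps tw F k p"
proof
  fix v assume "v \<in> grF eps tw (\<lambda>p. gmap c ` F p) k p"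
  then obtain x w where x: "x \<in> F p" "gmap c x \<in> wfil eps tw k" and w: "w \<in> wfil eps tw (k - 1)"
    and v: "v = gmap c x + w"
    unfolding grF_def by (elim set_plus_elim IntE imageE) blast
  show "v \<in> grF eps tw F k p"
  proof (cases "k \<ge> 0")
    case True
    have "(- (c * eps x)) *s tw + w \<in> wfil eps tw (k - 1)"
      using True w by (intro vec.subspace_add[OF wfil_subspace] tw_wfil) simp_all
    moreover have "v = x + ((- (c * eps x)) *s tw + w)" by (simp add: v gmap_def)
    moreover have "x \<in> F p \<inter> wfil eps tw k" using x(1) True by (simp add: wfil_simps)
    ultimately show ?thesis unfolding grF_def by (simp only: set_plus_intro)
  next
    case False
    then have "wfil eps tw k \<subseteq> {v. eps v = 0}" by (auto simp: wfil_def)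
    then have "eps x = 0" using x(2) by auto
    then have "x \<in> F p \<inter> wfil eps tw k" "v = x + w" using x v by (simp_all add: gmap_W1)
    then show ?thesis unfolding grF_def using w by (simp only: set_plus_intro)
  qed
qed

lemma grF_gmap: "grF eps tw (\<lambda>p. gmap c ` F p) k p = grF eps tw F k p"
proof
  have "(\<lambda>p. gmap (-c) ` gmap c ` F p) = F" by (simp add: image_image gmap_gmap)
  then show "grF eps tw F k p \<subseteq> grF eps tw (\<lambda>p. gmap c ` F p) k p"
    using grF_gmap_subset[of "-c" "\<lambda>p. gmap c ` F p" k p] by simp
qed (rule grF_gmap_subset)

lemma hodge_filtration_image:
  assumes F: "hodge_filtration F" and "bij f"
    and lin: "\<And>u v. f (u + v) = f u + f v" "\<And>a v. f (a *s v) = a *s f v"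
  shows "hodge_filtration (\<lambda>p. f ` F p)"
  unfolding hodge_filtration_def
proof (intro conjI allI)
  show "vec.subspace (f ` F p)" for p
  proof -
    have s: "vec.subspace (F p)" using F by (simp add: hodge_filtration_def)
    show ?thesis
    proof (rule vec.subspaceI)
      have "f 0 = 0" using lin(2)[of 0 0] by simp
      then show "0 \<in> f ` F p" using vec.subspace_0[OF s] by (metis imageI)
      show "x + y \<in> f ` F p" if "x \<in> f ` F p" "y \<in> f ` F p" for x y
        using that vec.subspace_add[OF s] by (auto simp: lin[symmetric])
      show "a *s x \<in> f ` F p" if "x \<in> f ` F p" for a x
        using that vec.subspace_scale[OF s] by (auto simp: lin[symmetric])
    qed
  qed
  show "antimono (\<lambda>p. f ` F p)" using F unfolding hodge_filtration_def antimono_def by (blast intro: image_mono)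
  obtain p q where "F p = UNIV" "F q = {0}" using F by (auto simp: hodge_filtration_def)
  moreover have "f 0 = 0" using lin(2)[of 0 0] by simp
  ultimately have "f ` F p = UNIV" "f ` F q = {0}" using \<open>bij f\<close> by (auto simp: bij_is_surj)
  then show "\<exists>p. f ` F p = UNIV" "\<exists>p. f ` F p = {0}" by blast+
qed

lemma gmap_bij: "bij (gmap c)"
  by (rule o_bij[of "gmap (-c)"]) (auto simp: gmap_gmap)

end

context biext_mhs
begin

lemma mhs_gmap: "mixed_hodge eps tw (\<lambda>p. gmap c ` F p)"
  using mhs hodge_filtration_image[OF _ gmap_bij gmap_linear, of F c]
  unfolding mixed_hodge_def grF_gmap by blast

end

context biext_split
begin

lemma split_gmap: "biext_split eps tw Q (\<lambda>p. gmap c ` F p) (e - c *s tw) (ea + c - cnj c)"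
proof
  show "mixed_hodge eps tw (\<lambda>p. gmap c ` F p)" by (rule mhs_gmap)
  show "e - c *s tw \<in> gmap c ` F 0" by (rule rev_image_eqI[OF e_F]) (simp add: gmap_def)
  show "cnjv (e - c *s tw) = e - c *s tw + (ea + c - cnj c) *s tw"
    by (simp add: cnjv_e vec.scale_left_distrib vec.scale_left_diff_distrib)
qed simp

lemma ea_imaginary: "cnj ea = - ea"
proof -
  have "cnjv (cnjv e) = e + (ea + cnj ea) *s tw" by (simp add: cnjv_e vec.scale_left_distrib)
  then have "(ea + cnj ea) *s tw = 0" by simp
  then have "ea + cnj ea = 0" by (simp only: scale_tw_eq_0)
  then show ?thesis by (simp add: eq_neg_iff_add_eq_0 add.commute)
qed

definition dmat :: "complex \<Rightarrow> complex ^ 'n ^ 'n" where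
  "dmat c = matrix (\<lambda>v. (c * eps v) *s tw)"

lemma dmat_mult: "dmat c *v v = (c * eps v) *s tw"
proof -
  have "Vector_Spaces.linear (*s) (*s) (\<lambda>v. (c * eps v) *s tw)"
    by unfold_locales (simp_all add: distrib_left vec.scale_left_distrib mult.left_commute)
  then show ?thesis unfolding dmat_def by (rule matrix_works)
qed

lemma mexp_dmat: "mexp (cscale_matrix (- \<i>) (dmat c)) *v v = gmap (\<i> * c) v"
proof -
  let ?A = "cscale_matrix (- \<i>) (dmat c)"
  have A: "?A *v v = (- \<i>) *s (dmat c *v v)" for v
    by (rule cscale_matrix_mult)
  have "(((*v) ?A) ^^ 2) v = 0" for v by (simp add: numeral_2_eq_2 A dmat_mult)
  from mexp_nilpotent_mult[OF this] show ?thesis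
    by (simp add: numeral_2_eq_2 A dmat_mult gmap_def)
qed

lemma dmat_lie_comp: "dmat c \<in> lie_comp eps tw Q F (-1, -1)"
proof -
  have "eps x = 0" if "x \<in> BI (p, q)" "(p, q) \<noteq> (0, 0)" for x p q
    using that by (auto simp: BI_def H_def split: if_splits)
  then have "dmat c *v x \<in> BI (p - 1, q - 1)" if "x \<in> BI (p, q)" for x p q
    using that BI.zero by (cases "(p, q) = (0, 0)") (auto simp: dmat_mult BI_m1_m1)
  moreover have "dmat c \<in> lie_alg eps tw Q"
  proof -
    have Q0: "Q 0 v = 0" "Q v 0 = 0" if "eps v = 0" for v
    proof -
      have "bilinear_on (wfil eps tw (-1)) (wfil eps tw (-1)) Q" using lat by (simp add: biext_lattice_def)
      then have "Q (0 *s v) v = 0 * Q v v" "Q v (0 *s v) = 0 * Q v v"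
        using that unfolding bilinear_on_def wfil_simps by blast+
      then show "Q 0 v = 0" "Q v 0 = 0" by simp_all
    qed
    then show ?thesis by (simp add: lie_alg_def dmat_mult wfil_simps)
  qed
  ultimately show ?thesis by (auto simp: lie_comp_def Ipq_eq)
qed

end

lemma Ints_imp_Reals: "(x :: complex) \<in> \<int> \<Longrightarrow> x \<in> \<real>"
  by (auto elim: Ints_cases)

lemma matrix_entry: "A $ i $ j = (A *v axis j 1) $ i" for A :: "complex ^ 'n::finite ^ 'n"
  by (simp add: matrix_vector_mult_def axis_def if_distrib[of "\<lambda>x. _ * x"] cong: if_cong)

context biext_lat
begin

lemma eps_axis_real: "eps (axis i 1) \<in> \<real>"
proof -
  have "eps (axis i 1) \<in> \<int>" using lat axis_int_lattice by (auto simp: biext_lattice_def)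
  then show ?thesis by (rule Ints_imp_Reals)
qed

lemma tw_nth_real: "tw $ i \<in> \<real>"
  using tw_lattice by (simp add: int_lattice_def Ints_imp_Reals)

lemma mixed_hodge_biext_split:
  assumes "mixed_hodge eps tw F"
  obtains e ea where "biext_split eps tw Q F e ea"
proof -
  interpret biext_mhs eps tw Q F by unfold_locales (rule assms)
  obtain e ea where "e \<in> F 0" "eps e = 1" "cnjv e = e + ea *s tw" by (rule obtain_e)
  then have "biext_split eps tw Q F e ea" by unfold_locales
  then show ?thesis by (rule that)
qed

end

context biext_split
begin

text \<open>An element of type (-1, -1) kills \<open>tw\<close> and sends weight -1 to weight -3,
  where all pieces are zero; it is determined by the image of \<open>e\<close>, a multiple of
  \<open>tw\<close>.\<close>

lemma lie_comp_m1_m1: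
  assumes "X \<in> lie_comp eps tw Q F (-1, -1)"
  obtains c where "X = dmat c"
proof -
  have X: "X *v v \<in> BI (p + -1, q + -1)" if "v \<in> BI (p, q)" for p q v
    using assms that unfolding lie_comp_def Ipq_eq by blast
  have tw: "X *v tw = 0" using assms by (simp add: lie_comp_def lie_alg_def)
  have "1 *s e \<in> BI (0, 0)" unfolding BI_00 by (rule rangeI)
  then have "X *v e \<in> BI (-1, -1)" using X[of e 0 0] by simp
  then obtain c where c: "X *v e = c *s tw" unfolding BI_m1_m1 by blast
  have H: "X *v w = 0" if "w \<in> H q" for w q
  proof -
    have "w \<in> BI (q, -1 - q)" using that by (simp add: BI_H)
    then have "X *v w \<in> BI (q + -1, -1 - q + -1)" by (rule X)
    moreover have "BI (q + -1, -1 - q + -1) = {0}" by (rule BI_trivial) auto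
    ultimately show ?thesis by blast
  qed
  have "X *v v = dmat c *v v" for v
  proof -
    obtain b h where h: "\<forall>q. h q \<in> H q" and v: "v = nf (eps v) b h"
      using normal_form[of v] by (elim exE conjE) (rule that)
    have "X *v v = X *v (nf (eps v) b h)" by (rule arg_cong[OF v])
    also have "\<dots> = eps v *s (X *v e) + b *s (X *v tw) + (\<Sum>q\<in>{-N..N}. X *v h q)"
      by (simp add: matrix_vector_right_distrib vector_scalar_commute vec.linear_sum)
    also have "(\<Sum>q\<in>{-N..N}. X *v h q) = 0" by (rule sum.neutral) (use h H in blast)
    also have "eps v *s (X *v e) + b *s (X *v tw) + 0 = eps v *s (c *s tw)" by (simp add: tw c)
    finally show ?thesis by (simp add: dmat_mult mult.commute)
  qed
  then have "X = dmat c" by (simp add: matrix_eq)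
  then show ?thesis by (rule that)
qed

lemma real_matrix_dmat_iff: "real_matrix (dmat c) \<longleftrightarrow> c \<in> \<real>"
proof
  assume "c \<in> \<real>"
  then show "real_matrix (dmat c)"
    by (simp add: real_matrix_def matrix_entry dmat_mult eps_axis_real tw_nth_real)
next
  assume r: "real_matrix (dmat c)"
  obtain er where er: "er \<in> int_lattice" "eps er = 1" by (rule obtain_lattice_lift)
  have "cnjv (dmat c *v er) = dmat c *v cnjv er" by (rule cnjv_real_matrix[OF r])
  then have "cnj c *s tw = c *s tw" by (simp add: dmat_mult er cnjv_int_lattice)
  then have "cnj c = c" by (simp only: scale_tw_inj)
  then show "c \<in> \<real>" by (simp add: Reals_cnj_iff)
qed

lemma split_dmat_iff:
  "split_over_reals eps tw (\<lambda>p. (*v) (mexp (cscale_matrix (- \<i>) (dmat c))) ` F p) \<longleftrightarrow> ea + \<i> * (c + cnj c) = 0"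
proof -
  have "(*v) (mexp (cscale_matrix (- \<i>) (dmat c))) = gmap (\<i> * c)" by (rule ext) (rule mexp_dmat)
  then show ?thesis
    using biext_split.split_over_reals_iff[OF split_gmap[of "\<i> * c"]] by (simp add: algebra_simps)
qed

text \<open>For real \<open>c\<close> the condition of \<open>split_dmat_iff\<close> reads
  \<open>ea + 2 * \<i> * c = 0\<close>. It is solvable because \<open>ea\<close> is purely
  imaginary, and \<open>- Im ea / 2\<close> is its only solution.\<close>

lemma deligne_delta_eq: "ea = - 2 * \<i> * of_real (deligne_delta eps tw Q F)"
proof -
  define d where "d = - Im ea / 2"
  have "Re ea = 0" using arg_cong[OF ea_imaginary, of Re] by simp
  then have ea: "ea = - 2 * \<i> * of_real d" by (simp add: complex_eq_iff d_def)
  have uniq: "c = of_real d" if "c \<in> \<real>" "ea + \<i> * (c + cnj c) = 0" for c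
  proof -
    have "cnj c = c" using that(1) by (simp add: Reals_cnj_iff)
    then have "- 2 * \<i> * of_real d + \<i> * (c + c) = 0" using that(2) by (simp only: ea)
    moreover have "2 * \<i> * (c - of_real d) = - 2 * \<i> * of_real d + \<i> * (c + c)"
      by (simp add: complex_eq_iff)
    ultimately have "2 * \<i> * (c - of_real d) = 0" by (simp only:)
    then show ?thesis by simp
  qed
  have "deligne_delta_op eps tw Q F = dmat (of_real d)"
    unfolding deligne_delta_op_def
  proof (rule the_equality)
    show "dmat (of_real d) \<in> lie_comp eps tw Q F (-1, -1) \<and> real_matrix (dmat (of_real d)) \<and>
       split_over_reals eps tw (\<lambda>p. (*v) (mexp (cscale_matrix (- \<i>) (dmat (of_real d)))) ` F p)"
      unfolding real_matrix_dmat_iff split_dmat_iff by (simp add: dmat_lie_comp ea)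
    fix X assume X: "X \<in> lie_comp eps tw Q F (-1, -1) \<and> real_matrix X \<and>
       split_over_reals eps tw (\<lambda>p. (*v) (mexp (cscale_matrix (- \<i>) X)) ` F p)"
    then obtain c where c: "X = dmat c" using lie_comp_m1_m1 by blast
    have "c = of_real d"
      by (rule uniq) (use X in \<open>simp_all only: c real_matrix_dmat_iff split_dmat_iff\<close>)
    then show "X = dmat (of_real d)" by (simp only: c)
  qed
  then have D: "deligne_delta_op eps tw Q F *v v = (of_real d * eps v) *s tw" for v
    by (simp add: dmat_mult)
  have "deligne_delta eps tw Q F = d"
    unfolding deligne_delta_def
  proof (rule the_equality)
    show "\<forall>v. deligne_delta_op eps tw Q F *v v = (of_real d * eps v) *s tw" using D by blast
    fix d' assume "\<forall>v. deligne_delta_op eps tw Q F *v v = (of_real d' * eps v) *s tw"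
    then have "(of_real d' * eps e) *s tw = (of_real d * eps e) *s tw" using D by metis
    then show "d' = d" by (simp only: scale_tw_inj eps_e) simp
  qed
  then show ?thesis using ea by simp
qed

end

text \<open>The criterion for evaluating the splitting at nearby points, where a lift
  \<open>e\<close> and a conjugate partner \<open>y\<close> arise separately. That they coincide
  need not be known beforehand: \<open>y - e\<close> is a multiple of \<open>tw\<close> in
  \<open>F 0\<close>, hence zero.\<close>

lemma (in biext_mhs) deligne_deltaI:
  assumes "e \<in> F 0" "eps e = 1" "y \<in> F 0" "e = cnjv y + b *s tw"
  shows "b = 2 * \<i> * of_real (deligne_delta eps tw Q F)"
    and "biext_split eps tw Q F e (- b)"
proof -
  obtain e0 ea where "biext_split eps tw Q F e0 ea" using mixed_hodge_biext_split mhs by blast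
  then interpret S: biext_split eps tw Q F e0 ea .
  have y: "cnjv e - cnj b *s tw = y" by (simp add: assms(4))
  then have "e \<in> {v \<in> F 0. \<exists>a. cnjv v - a *s tw \<in> F 0}" using assms(1,3) by blast
  then obtain a where a: "e = a *s e0" unfolding S.I00_eq by blast
  then have "a = 1" using assms(2) by simp
  then have e: "e = e0" using a by simp
  have "y = e + (ea - cnj b) *s tw" unfolding y[symmetric] e S.cnjv_e by (simp add: vec.scale_left_diff_distrib)
  then have "(ea - cnj b) *s tw = y - e" by simp
  moreover have "y - e \<in> F 0" using assms(1,3) by blast
  ultimately have "ea - cnj b = 0" using tw_F0[of "ea - cnj b" 0] by simp
  then have "ea = cnj b" by simp
  then have "b = cnj ea" by simp
  then have b: "b = - ea" by (simp only: S.ea_imaginary)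
  then show "b = 2 * \<i> * of_real (deligne_delta eps tw Q F)" using S.deligne_delta_eq by simp
  show "biext_split eps tw Q F e (- b)" unfolding b e by (simp add: S.biext_split_axioms)
qed

section \<open>Transport by automorphisms of the lattice\<close>

locale biext_iso = biext_lat eps tw Q for eps :: "complex ^ 'n::finite \<Rightarrow> complex" and tw Q +
  fixes g :: "complex ^ 'n ^ 'n"
  assumes aut: "biext_aut eps tw Q g"
begin

lemma g_bij: "bij ((*v) g)" and g_eps [simp]: "eps (g *v v) = eps v" and g_tw [simp]: "g *v tw = tw"
  and g_Q: "eps u = 0 \<Longrightarrow> eps v = 0 \<Longrightarrow> Q (g *v u) (g *v v) = Q u v"
  using aut by (auto simp: biext_aut_def wfil_simps)

lemma g_lin [simp]: "g *v (u + v) = g *v u + g *v v" "g *v (a *s v) = a *s (g *v v)" "g *v 0 = 0"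
  by (simp_all add: matrix_vector_right_distrib vector_scalar_commute)

lemma g_cnjv: "cnjv (g *v v) = g *v cnjv v"
proof (rule cnjv_real_matrix)
  have "g *v axis j 1 \<in> int_lattice" for j using aut axis_int_lattice by (auto simp: biext_aut_def)
  then show "real_matrix g" unfolding real_matrix_def matrix_entry
    by (simp add: int_lattice_def Ints_imp_Reals)
qed

lemma g_wfil: "(*v) g ` wfil eps tw k = wfil eps tw k"
proof -
  have "(*v) g ` {v. eps v = 0} = {v. eps v = 0}"
  proof (intro equalityI subsetI)
    fix v assume v: "v \<in> {v. eps v = 0}"
    obtain u where "v = g *v u" using g_bij by (metis bij_pointE)
    with v show "v \<in> (*v) g ` {v. eps v = 0}" by auto
  qed auto
  moreover have "(*v) g ` range (\<lambda>a. a *s tw) = range (\<lambda>a. a *s tw)" by (simp add: image_image)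
  moreover have "(*v) g ` UNIV = UNIV" using g_bij by (rule bij_is_surj)
  ultimately show ?thesis by (simp add: wfil_def)
qed

lemma g_set_plus: "(*v) g ` (A + B) = (*v) g ` A + (*v) g ` B"
proof (intro equalityI subsetI)
  show "x \<in> (*v) g ` A + (*v) g ` B" if x: "x \<in> (*v) g ` (A + B)" for x
    using x by (elim imageE set_plus_elim) (simp add: set_plus_intro)
  show "x \<in> (*v) g ` (A + B)" if x: "x \<in> (*v) g ` A + (*v) g ` B" for x
    using x by (elim imageE set_plus_elim) (simp add: set_plus_intro flip: g_lin(1))
qed

lemma g_inter: "(*v) g ` (A \<inter> B) = (*v) g ` A \<inter> (*v) g ` B"
  by (rule image_Int[OF bij_is_inj[OF g_bij]])

lemma g_grF: "grF eps tw (\<lambda>p. (*v) g ` F p) k p = (*v) g ` grF eps tw F k p"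
  unfolding grF_def g_set_plus g_inter g_wfil ..

lemma g_cnjv_image: "cnjv ` (*v) g ` A = (*v) g ` cnjv ` A"
  by (simp add: image_image g_cnjv)

lemma mixed_hodge_transport:
  assumes "mixed_hodge eps tw F"
  shows "mixed_hodge eps tw (\<lambda>p. (*v) g ` F p)"
  unfolding mixed_hodge_def
proof (intro conjI allI)
  show "hodge_filtration (\<lambda>p. (*v) g ` F p)"
    by (rule hodge_filtration_image[OF _ g_bij g_lin(1,2)]) (use assms in \<open>simp add: mixed_hodge_def\<close>)
  have F: "grF eps tw F k p + cnjv ` grF eps tw F k (k + 1 - p) = wfil eps tw k"
    "grF eps tw F k p \<inter> cnjv ` grF eps tw F k (k + 1 - p) = wfil eps tw (k - 1)" for k p
    using assms by (simp_all add: mixed_hodge_def)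
  show "grF eps tw (\<lambda>p. (*v) g ` F p) k p + cnjv ` grF eps tw (\<lambda>p. (*v) g ` F p) k (k + 1 - p) = wfil eps tw k"
    for k p unfolding g_grF g_cnjv_image g_set_plus[symmetric] F g_wfil ..
  show "grF eps tw (\<lambda>p. (*v) g ` F p) k p \<inter> cnjv ` grF eps tw (\<lambda>p. (*v) g ` F p) k (k + 1 - p) = wfil eps tw (k - 1)"
    for k p unfolding g_grF g_cnjv_image g_inter[symmetric] F g_wfil ..
qed

text \<open>An automorphism of the lattice is real and fixes \<open>eps\<close> and
  \<open>tw\<close>, so it carries the relation between \<open>e\<close> and its conjugate to the
  transported filtration. The splitting may therefore be computed in a flat frame.\<close>

lemma deligne_delta_transport:
  assumes "mixed_hodge eps tw F"
  shows "deligne_delta eps tw Q (\<lambda>p. (*v) g ` F p) = deligne_delta eps tw Q F"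
proof -
  interpret A: biext_mhs eps tw Q F by unfold_locales (rule assms)
  interpret B: biext_mhs eps tw Q "\<lambda>p. (*v) g ` F p" by unfold_locales (rule mixed_hodge_transport[OF assms])
  obtain e a where e: "e \<in> F 0" "eps e = 1" "cnjv e = e + a *s tw" by (rule A.obtain_e)
  have c: "e = cnjv e + (- a) *s tw" using e(3) by simp
  have 1: "- a = 2 * \<i> * of_real (deligne_delta eps tw Q F)"
    by (rule A.deligne_deltaI(1)[OF e(1,2) e(1) c])
  have "g *v e = g *v cnjv e + g *v ((- a) *s tw)"
    unfolding g_lin(1)[symmetric] by (rule arg_cong[OF c])
  then have "g *v e = cnjv (g *v e) + (- a) *s tw" unfolding g_cnjv g_lin(2) g_tw .
  then have 2: "- a = 2 * \<i> * of_real (deligne_delta eps tw Q (\<lambda>p. (*v) g ` F p))"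
    by (rule B.deligne_deltaI(1)[OF imageI[OF e(1)] _ imageI[OF e(1)], rotated]) (simp add: e)
  from 1 2 show ?thesis by simp
qed

end

subsection \<open>The Lie algebra and its exponential\<close>

context bigraded
begin

lemma sum_over_complement: "\<exists>x \<in> sum_over I K. v - x \<in> sum_over I (- K)"
proof -
  have "v \<in> sum_over I (K \<union> - K)" using unique[of v] unfolding sum_over_def by auto
  from sum_over_split[OF this] obtain x y where "x \<in> sum_over I K" "y \<in> sum_over I (- K)" "v = x + y" by blast
  then show ?thesis by (intro bexI[of _ x]) simp_all
qed

definition proj :: "'k set \<Rightarrow> complex ^ 'n \<Rightarrow> complex ^ 'n" where
  "proj K v = (SOME x. x \<in> sum_over I K \<and> v - x \<in> sum_over I (- K))"

lemma proj: "proj K v \<in> sum_over I K" "v - proj K v \<in> sum_over I (- K)"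
  using someI_ex[of "\<lambda>x. x \<in> sum_over I K \<and> v - x \<in> sum_over I (- K)"] sum_over_complement[of K v]
  unfolding proj_def by blast+

lemma proj_unique:
  assumes "x \<in> sum_over I K" "v - x \<in> sum_over I (- K)"
  shows "proj K v = x"
proof -
  have "proj K v - x \<in> sum_over I K" by (rule vec.subspace_diff[OF sum_over_subspace proj(1) assms(1)])
  moreover have "(v - x) - (v - proj K v) \<in> sum_over I (- K)"
    by (rule vec.subspace_diff[OF sum_over_subspace assms(2) proj(2)])
  then have "proj K v - x \<in> sum_over I (- K)" by simp
  ultimately have "proj K v - x = 0" by (rule sum_over_disjoint) simp
  then show ?thesis by simp
qed

lemma proj_id: "v \<in> sum_over I K \<Longrightarrow> proj K v = v"
  by (rule proj_unique) (simp_all add: vec.subspace_0[OF sum_over_subspace])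

lemma proj_0:
  assumes "v \<in> sum_over I K'" "K \<inter> K' = {}"
  shows "proj K v = 0"
proof (rule proj_unique)
  show "v - 0 \<in> sum_over I (- K)"
    using assms sum_over_mono[of K' "- K"] by auto
qed (rule vec.subspace_0[OF sum_over_subspace])

lemma proj_add: "proj K (u + v) = proj K u + proj K v"
proof (rule proj_unique)
  have "(u - proj K u) + (v - proj K v) \<in> sum_over I (- K)"
    by (intro vec.subspace_add[OF sum_over_subspace] proj)
  then show "u + v - (proj K u + proj K v) \<in> sum_over I (- K)" by (simp add: algebra_simps)
qed (intro vec.subspace_add[OF sum_over_subspace] proj)

lemma proj_scale: "proj K (a *s v) = a *s proj K v"
proof (rule proj_unique)
  have "a *s (v - proj K v) \<in> sum_over I (- K)"
    by (intro vec.subspace_scale[OF sum_over_subspace] proj)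
  then show "a *s v - a *s proj K v \<in> sum_over I (- K)" by (simp add: vec.scale_right_diff_distrib)
qed (intro vec.subspace_scale[OF sum_over_subspace] proj)

definition pmat :: "'k set \<Rightarrow> complex ^ 'n ^ 'n" where
  "pmat K = matrix (proj K)"

lemma pmat: "pmat K *v v = proj K v"
proof -
  have "Vector_Spaces.linear (*s) (*s) (proj K)"
    by unfold_locales (simp_all add: proj_add proj_scale)
  then show ?thesis unfolding pmat_def by (rule matrix_works)
qed

lemma additive_into_subspace:
  assumes "v \<in> sum_over I K" and f: "f 0 = 0" "\<And>x y. f (x + y) = f x + f y"
    and S: "vec.subspace S" and "\<And>k x. k \<in> K \<Longrightarrow> x \<in> I k \<Longrightarrow> f x \<in> S"
  shows "f v \<in> S"
proof -
  obtain c where c: "decomposes I c v" "\<And>k. k \<notin> K \<Longrightarrow> c k = 0"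
    using assms(1) unfolding sum_over_def by blast
  have d: "decomposes (\<lambda>k. S) (\<lambda>k. f (c k)) (f v)"
  proof -
    have "decomposes (\<lambda>k. if k \<in> K then I k else {0}) c v"
      using c by (auto simp: decomposes_def)
    then show ?thesis
      by (rule decomposes_map) (use assms vec.subspace_0[OF S] in \<open>auto split: if_splits\<close>)
  qed
  then have fin: "finite {k. f (c k) \<noteq> 0}" and S': "f (c k) \<in> S" for k
    unfolding decomposes_def by blast+
  have "f v = (\<Sum>k\<in>{k. f (c k) \<noteq> 0}. f (c k))" by (rule decomposes_sum[OF d fin]) simp
  also have "\<dots> \<in> S" by (rule vec.subspace_sum[OF S S'])
  finally show ?thesis .
qed

lemma matrix_eq_on_pieces:
  fixes A B :: "complex ^ 'n ^ 'n"
  assumes "\<And>k v. v \<in> I k \<Longrightarrow> A *v v = B *v v"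
  shows "A = B"
proof -
  have "A *v v - B *v v \<in> {0}" for v
  proof (rule additive_into_subspace[where v = v and K = UNIV and f = "\<lambda>v. A *v v - B *v v" and S = "{0}"])
    show "v \<in> sum_over I UNIV" using unique[of v] unfolding sum_over_def by auto
    show "vec.subspace {0 :: complex ^ 'n}" by (rule vec.subspace_single_0)
    show "A *v x - B *v x \<in> {0}" if "x \<in> I k" for k x using assms[OF that] by simp
  qed (simp_all add: matrix_vector_right_distrib)
  then show ?thesis by (simp add: matrix_eq)
qed

end

context biext_split
begin

abbreviation LC where "LC \<equiv> lie_comp eps tw Q F"

lemma LC_BI: "X \<in> LC j \<Longrightarrow> v \<in> BI k \<Longrightarrow> X *v v \<in> BI (k + j)"
  unfolding lie_comp_def Ipq_eq by (cases j; cases k) auto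

text \<open>A component of degree \<open>j\<close> sends degree \<open>k\<close> to
  \<open>k + j\<close>; reindexing by the target degree yields the decomposition of the
  image.\<close>

lemma LC_action:
  assumes "decomposes LC c X" "v \<in> BI k"
  shows "decomposes BI (\<lambda>j. c (j - k) *v v) (X *v v)"
proof -
  have "decomposes (\<lambda>j. BI (k + j)) (\<lambda>j. c j *v v) (X *v v)"
    by (rule decomposes_map[OF assms(1)]) (simp_all add: LC_BI assms(2) matrix_vector_mult_add_rdistrib)
  moreover have "bij (\<lambda>j. j - k)" by (rule o_bij[of "\<lambda>j. j + k"]) auto
  ultimately have "decomposes (\<lambda>j. BI (k + (j - k))) (\<lambda>j. c (j - k) *v v) (X *v v)"
    by (rule decomposes_reindex)
  then show ?thesis by simp
qed

text \<open>The sum of the g^{a,b} is direct because the bigrading of the vector space is: on a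
  piece of degree \<open>k\<close> the component of degree \<open>j\<close> is read off in degree
  \<open>j + k\<close>. This makes \<open>component\<close> meaningful.\<close>

lemma LC_unique:
  assumes "decomposes LC c X" "decomposes LC d X"
  shows "c = d"
proof
  fix j
  show "c j = d j"
  proof (rule BI.matrix_eq_on_pieces)
    fix k v assume "v \<in> BI k"
    then have "(\<lambda>j. c (j - k) *v v) = (\<lambda>j. d (j - k) *v v)"
      using BI.unique_eq[OF LC_action[OF assms(1)] LC_action[OF assms(2)]] by blast
    from fun_cong[OF this, of "j + k"] show "c j *v v = d j *v v" by simp
  qed
qed

lemma LC_sum_over_action:
  assumes "X \<in> sum_over LC K" "v \<in> BI k"
  shows "X *v v \<in> sum_over BI ((\<lambda>j. k + j) ` K)"
proof -
  obtain c where c: "decomposes LC c X" "\<And>j. j \<notin> K \<Longrightarrow> c j = 0"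
    using assms(1) unfolding sum_over_def by blast
  have "c (j - k) *v v = 0" if "j \<notin> (\<lambda>j. k + j) ` K" for j
  proof -
    have "j - k \<notin> K" using that by (auto simp: image_iff)
    then show ?thesis using c(2) by simp
  qed
  with LC_action[OF c(1) assms(2)] show ?thesis unfolding sum_over_def by blast
qed

lemma LC_sum_over_eps_tw:
  assumes "X \<in> sum_over LC K"
  shows "eps (X *v v) = 0" "X *v tw = 0"
proof -
  obtain c where c: "decomposes LC c X" using assms unfolding sum_over_def by blast
  have m: "eps (c k *v v) = 0" "c k *v tw = 0" for k v
  proof -
    have "c k \<in> LC k" using c unfolding decomposes_def by blast
    then show "eps (c k *v v) = 0" "c k *v tw = 0" by (cases k; simp add: lie_comp_def lie_alg_def)+
  qed
  have X: "X = (\<Sum>k\<in>{k. c k \<noteq> 0}. c k)"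
    using c decomposes_sum[OF c] by (auto simp: decomposes_def)
  show "eps (X *v v) = 0" "X *v tw = 0"
    by (subst X; simp add: sum_matrix_vector_mult eps.sum m)+
qed

text \<open>A filtration opposite to \<open>F\<close>: \<open>lower r\<close> is complementary to
  \<open>F r\<close>, and elements of negative first degree lower the index by one.\<close>

definition lower :: "int \<Rightarrow> (complex ^ 'n) set" where
  "lower r = sum_over BI {(a, b). a < r}"

lemma lower_subspace: "vec.subspace (lower r)"
  unfolding lower_def by (rule BI.sum_over_subspace)

text \<open>The lower bound \<open>- N - 1\<close> in place of \<open>- N\<close> keeps type (-1,
  -1) within the range on the strength of \<open>N \<ge> 0\<close> alone.\<close>

lemma BI_outside: "a > N \<or> a < - N - 1 \<Longrightarrow> BI (a, b) = {0}"
proof -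
  assume a: "a > N \<or> a < - N - 1"
  then have "(a, b) \<noteq> (0, 0)" "(a, b) \<noteq> (-1, -1)" using N(1) by auto
  moreover have "H a = {0}" using H_outside[of _ a] a by auto
  ultimately show ?thesis using BI_trivial[of a b] BI_H[of a b] by (cases "a + b = -1") auto
qed

lemma lower_top: "v \<in> lower (N + 1)"
proof -
  have "sum_over BI UNIV \<subseteq> lower (N + 1)" unfolding lower_def
  proof (rule BI.sum_over_restrict)
    show "BI k = {0}" if "k \<notin> {(a, b). a < N + 1}" for k
      using that BI_outside[of "fst k" "snd k"] by (cases k) auto
  qed
  moreover have "v \<in> sum_over BI UNIV" using BI_unique[of v] unfolding sum_over_def by auto
  ultimately show ?thesis by blast
qed

lemma lower_bot: "r \<le> - N - 1 \<Longrightarrow> lower r = {0}"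
proof -
  assume r: "r \<le> - N - 1"
  have "lower r \<subseteq> sum_over BI {}" unfolding lower_def
  proof (rule BI.sum_over_restrict)
    show "BI k = {0}" if "k \<in> {(a, b). a < r}" for k
      using that r BI_outside[of "fst k" "snd k"] by (cases k) auto
  qed
  then show ?thesis using vec.subspace_0[OF lower_subspace] by (auto simp: BI.sum_over_empty)
qed

lemma neg_lower:
  assumes "X \<in> sum_over LC {(a, b). a < 0}" "v \<in> lower r"
  shows "X *v v \<in> lower (r - 1)"
proof (rule BI.additive_into_subspace[OF assms(2)[unfolded lower_def], of "(*v) X"])
  fix k x assume k: "k \<in> {(a, b). a < r}" and x: "x \<in> BI k"
  have "(\<lambda>j. k + j) ` {(a, b). a < 0} \<subseteq> {(a, b). a < r - 1}" using k by (cases k) auto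
  then show "X *v x \<in> lower (r - 1)"
    using LC_sum_over_action[OF assms(1) x] BI.sum_over_mono unfolding lower_def by blast
qed (simp_all add: matrix_vector_right_distrib lower_subspace)

text \<open>The number of steps from \<open>lower (N + 1)\<close>, which is everything, to
  \<open>lower (- N - 1)\<close>, which is zero.\<close>

definition nil :: nat where "nil = nat (2 * N + 2)"

lemma neg_nilpotent:
  assumes "X \<in> sum_over LC {(a, b). a < 0}"
  shows "(((*v) X) ^^ nil) v = 0"
proof -
  have "(((*v) X) ^^ k) v \<in> lower (N + 1 - int k)" for k
  proof (induction k)
    case (Suc k)
    from neg_lower[OF assms this] show ?case by (simp add: algebra_simps)
  qed (simp add: lower_top)
  from this[of nil] show ?thesis using lower_bot[of "- N - 1"] N(1) by (simp add: nil_def)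
qed

lemma mexp_neg:
  assumes "X \<in> sum_over LC {(a, b). a < 0}"
  shows "mexp X *v v = (\<Sum>k<nil. (((*v) X) ^^ k) v /\<^sub>R fact k)"
  by (rule mexp_nilpotent_mult) (rule neg_nilpotent[OF assms])

lemma nil_ge: "nil \<ge> 2" using N(1) by (simp add: nil_def)

lemma scaleR_scale: "c *\<^sub>R v = of_real c *s (v :: complex ^ 'n)"
  by (simp add: vec_eq_iff) (simp add: scaleR_conv_of_real)

lemma mexp_neg_split:
  assumes "X \<in> sum_over LC {(a, b). a < 0}"
  shows "mexp X *v v = v + (\<Sum>k\<in>{0<..<nil}. (((*v) X) ^^ k) v /\<^sub>R fact k)"
proof -
  have "{..<nil} = insert 0 {0<..<nil}" using nil_ge by auto
  then show ?thesis by (simp add: mexp_neg[OF assms])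
qed

lemma funpow_pos: "0 < k \<Longrightarrow> (f ^^ k) x = f ((f ^^ (k - 1)) x)"
  by (cases k) simp_all

lemma mexp_neg_eps_tw:
  assumes "X \<in> sum_over LC {(a, b). a < 0}"
  shows "eps (mexp X *v v) = eps v" "mexp X *v tw = tw"
proof -
  have "eps ((((*v) X) ^^ k) v) = 0" if "0 < k" for k
    using that LC_sum_over_eps_tw(1)[OF assms] by (simp add: funpow_pos)
  then show "eps (mexp X *v v) = eps v" unfolding mexp_neg_split[OF assms] by (simp add: eps.sum scaleR_scale)
  have "(((*v) X) ^^ k) tw = 0" if "0 < k" for k
    using that
  proof (induction k)
    case (Suc k)
    then show ?case by (cases "k = 0") (simp_all add: LC_sum_over_eps_tw(2)[OF assms])
  qed simp
  then show "mexp X *v tw = tw" unfolding mexp_neg_split[OF assms] by simp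
qed

text \<open>The exponential is the identity plus terms that lower the filtration, so a vector in its
  kernel that lies in one step also lies in the next lower one, and finally in zero.\<close>

lemma mexp_neg_injective:
  assumes X: "X \<in> sum_over LC {(a, b). a < 0}" and z: "mexp X *v v = 0"
  shows "v = 0"
proof -
  have "v \<in> lower (N + 1 - int m)" for m
  proof (induction m)
    case (Suc m)
    let ?r = "N + 1 - int m"
    have low: "lower (r - 1) \<subseteq> lower r" for r
      unfolding lower_def by (rule BI.sum_over_mono) auto
    have p: "(((*v) X) ^^ k) v \<in> lower ?r" for k
    proof (induction k)
      case (Suc k)
      have "X *v ((((*v) X) ^^ k) v) \<in> lower ?r" by (rule subsetD[OF low neg_lower[OF X Suc]])
      then show ?case by simp
    qed (use Suc.IH in simp)
    have "(((*v) X) ^^ k) v \<in> lower (?r - 1)" if "0 < k" for k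
      using that neg_lower[OF X p] by (simp add: funpow_pos)
    then have s: "(\<Sum>k\<in>{0<..<nil}. (((*v) X) ^^ k) v /\<^sub>R fact k) \<in> lower (?r - 1)" (is "?s \<in> _")
      unfolding scaleR_scale by (intro vec.subspace_sum[OF lower_subspace] vec.subspace_scale[OF lower_subspace]) auto
    have "v = - ?s" using z unfolding mexp_neg_split[OF X] by (simp add: eq_neg_iff_add_eq_0)
    then have "v \<in> lower (?r - 1)" using vec.subspace_neg[OF lower_subspace s] by simp
    then show ?case by (simp add: algebra_simps)
  qed (simp add: lower_top)
  from this[of nil] show ?thesis using lower_bot[of "- N - 1"] N(1) by (simp add: nil_def)
qed

end

lemma matrix_vector_mult_nth: "(A *v v) $ i = (\<Sum>j\<in>UNIV. A $ i $ j * v $ j)"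
  by (simp add: matrix_vector_mult_def)

lemma funpow_matrix_holomorphic:
  fixes G :: "complex \<Rightarrow> complex ^ 'n::finite ^ 'n"
  assumes "\<And>i j. (\<lambda>z. G z $ i $ j) holomorphic_on A"
  shows "(\<lambda>z. ((((*v) (G z)) ^^ k) v) $ i) holomorphic_on A"
proof (induction k arbitrary: i)
  case (Suc k)
  have "(\<lambda>z. \<Sum>j\<in>UNIV. G z $ i $ j * ((((*v) (G z)) ^^ k) v) $ j) holomorphic_on A"
    by (intro holomorphic_intros assms Suc)
  then show ?case by (simp add: matrix_vector_mult_nth)
qed simp

text \<open>As \<open>G\<close> vanishes at \<open>z\<close>, its k-th power vanishes there to order
  at least k; only the linear term of the exponential contributes to the derivative.\<close>

lemma funpow_matrix_deriv:
  fixes G :: "complex \<Rightarrow> complex ^ 'n::finite ^ 'n"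
  assumes "\<And>i j. ((\<lambda>z. G z $ i $ j) has_field_derivative D $ i $ j) (at z)" and "G z = 0"
  shows "((\<lambda>w. ((((*v) (G w)) ^^ k) v) $ i) has_field_derivative (if k = 1 then (D *v v) $ i else 0)) (at z)"
proof (induction k arbitrary: i)
  case (Suc k)
  have w: "(((*v) (G z)) ^^ k) v = (if k = 0 then v else 0)" using assms(2) by (cases k) simp_all
  have "((\<lambda>w. \<Sum>j\<in>UNIV. G w $ i $ j * ((((*v) (G w)) ^^ k) v) $ j) has_field_derivative
      (\<Sum>j\<in>UNIV. D $ i $ j * ((((*v) (G z)) ^^ k) v) $ j + (if k = 1 then (D *v v) $ j else 0) * G z $ i $ j)) (at z)"
    by (intro DERIV_sum DERIV_mult assms Suc)
  moreover have "(\<Sum>j\<in>UNIV. D $ i $ j * ((((*v) (G z)) ^^ k) v) $ j + (if k = 1 then (D *v v) $ j else 0) * G z $ i $ j)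
     = (if Suc k = 1 then (D *v v) $ i else 0)"
    unfolding w by (simp add: matrix_vector_mult_nth assms(2))
  ultimately show ?case by (simp add: matrix_vector_mult_nth)
qed simp

subsection \<open>Pairings and the decomposition of weight \<open>-1\<close>\<close>

lemma bilinear_on_sum:
  assumes B: "bilinear_on V W B" and V: "vec.subspace V" and W: "vec.subspace W"
  shows "(\<And>i. i \<in> S \<Longrightarrow> f i \<in> V) \<Longrightarrow> w \<in> W \<Longrightarrow> B (\<Sum>i\<in>S. f i) w = (\<Sum>i\<in>S. B (f i) w)"
    and "v \<in> V \<Longrightarrow> (\<And>i. i \<in> S \<Longrightarrow> h i \<in> W) \<Longrightarrow> B v (\<Sum>i\<in>S. h i) = (\<Sum>i\<in>S. B v (h i))"
proof -
  have l: "B (x + y) w = B x w + B y w" "B (a *s x) w = a * B x w" if "x \<in> V" "y \<in> V" "w \<in> W" for x y w a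
    using B that unfolding bilinear_on_def by blast+
  have r: "B v (x + y) = B v x + B v y" "B v (a *s x) = a * B v x" if "x \<in> W" "y \<in> W" "v \<in> V" for x y v a
    using B that unfolding bilinear_on_def by blast+
  have z: "w \<in> W \<Longrightarrow> B 0 w = 0" "v \<in> V \<Longrightarrow> B v 0 = 0" for v w
    using l(2)[of 0 0 w 0] r(2)[of 0 0 v 0] vec.subspace_0[OF V] vec.subspace_0[OF W] by simp_all
  show "B (\<Sum>i\<in>S. f i) w = (\<Sum>i\<in>S. B (f i) w)" if "\<And>i. i \<in> S \<Longrightarrow> f i \<in> V" "w \<in> W"
    using that
  proof (induction S rule: infinite_finite_induct)
    case (insert x S)
    have "sum f S \<in> V" by (rule vec.subspace_sum[OF V]) (use insert in auto)
    with insert show ?case by (simp add: l)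
  qed (simp_all add: z vec.subspace_0[OF V])
  show "B v (\<Sum>i\<in>S. h i) = (\<Sum>i\<in>S. B v (h i))" if "v \<in> V" "\<And>i. i \<in> S \<Longrightarrow> h i \<in> W"
    using that
  proof (induction S rule: infinite_finite_induct)
    case (insert x S)
    have "sum h S \<in> W" by (rule vec.subspace_sum[OF W]) (use insert in auto)
    with insert show ?case by (simp add: r)
  qed (simp_all add: z vec.subspace_0[OF W])
qed

context biext_lat
begin

definition er :: "complex ^ 'n" where "er = (SOME v. v \<in> int_lattice \<and> eps v = 1)"

lemma er: "er \<in> int_lattice" "eps er = 1"
proof -
  obtain v where "v \<in> int_lattice \<and> eps v = 1" using obtain_lattice_lift by blast
  from someI[of "\<lambda>v. v \<in> int_lattice \<and> eps v = 1", OF this]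
  show "er \<in> int_lattice" "eps er = 1" by (simp_all add: er_def)
qed

text \<open>Integral vectors which span \<open>W (-1)\<close>.\<close>

definition wb :: "'n \<Rightarrow> complex ^ 'n" where "wb j = axis j 1 - eps (axis j 1) *s er"

lemma wb: "eps (wb j) = 0" "wb j \<in> int_lattice"
proof -
  show "eps (wb j) = 0" by (simp add: wb_def er)
  have "eps (axis j 1) \<in> \<int>" using lat axis_int_lattice by (auto simp: biext_lattice_def)
  then show "wb j \<in> int_lattice" using er(1) axis_int_lattice[of j] by (simp add: wb_def int_lattice_def)
qed

lemma W1_sum_wb: "eps w = 0 \<Longrightarrow> w = (\<Sum>j\<in>UNIV. w $ j *s wb j)"
proof -
  assume w: "eps w = 0"
  have "eps w = (\<Sum>j\<in>UNIV. w $ j * eps (axis j 1))" by (subst vec_sum_axis) (simp add: eps.sum)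
  then have z: "(\<Sum>j\<in>UNIV. w $ j * eps (axis j 1)) = 0" using w by simp
  have "(\<Sum>j\<in>UNIV. w $ j *s wb j) = (\<Sum>j\<in>UNIV. w $ j *s axis j 1) - (\<Sum>j\<in>UNIV. w $ j * eps (axis j 1)) *s er"
    by (simp add: wb_def vec.scale_right_diff_distrib sum_subtractf vec.scale_sum_left)
  also have "\<dots> = w" unfolding z vec_sum_axis[symmetric] by simp
  finally show ?thesis by simp
qed

text \<open>Bilinearity of \<open>B\<close> is known only for second arguments in W (-1), so that
  argument is expanded in the spanning vectors \<open>wb\<close> instead of the standard
  basis.\<close>

lemma bilinear_coordinates:
  assumes B: "bilinear_on UNIV (wfil eps tw (-1)) B" and w: "eps w = 0"
  shows "B v w = (\<Sum>i\<in>UNIV. \<Sum>j\<in>UNIV. v $ i * (w $ j * B (axis i 1) (wb j)))"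
proof -
  have W: "vec.subspace {v. eps v = 0}" using wfil_subspace[of "-1"] by (simp add: wfil_simps)
  note B' = B[unfolded wfil_simps]
  have s: "B (a *s x) (b *s y) = a * (b * B x y)" if "eps y = 0" for a b x y
    using B' that vec.subspace_scale[OF W, of y b] unfolding bilinear_on_def by auto
  have "B v w = B (\<Sum>i\<in>UNIV. v $ i *s axis i 1) (\<Sum>j\<in>UNIV. w $ j *s wb j)"
    using vec_sum_axis[of v] W1_sum_wb[OF w] by simp
  also have "\<dots> = (\<Sum>i\<in>UNIV. B (v $ i *s axis i 1) (\<Sum>j\<in>UNIV. w $ j *s wb j))"
    by (rule bilinear_on_sum(1)[OF B' vec.subspace_UNIV W]) (simp_all add: eps.sum wb)
  also have "\<dots> = (\<Sum>i\<in>UNIV. \<Sum>j\<in>UNIV. B (v $ i *s axis i 1) (w $ j *s wb j))"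
    by (intro sum.cong refl bilinear_on_sum(2)[OF B' vec.subspace_UNIV W]) (simp_all add: wb)
  finally show ?thesis by (simp add: s wb)
qed

lemma bilinear_deriv:
  assumes B: "bilinear_on UNIV (wfil eps tw (-1)) B"
    and v: "\<And>i. ((\<lambda>z. v z $ i) has_field_derivative v' $ i) (at z0)"
    and w: "\<And>i. ((\<lambda>z. w z $ i) has_field_derivative w' $ i) (at z0)"
    and W: "\<And>z. z \<in> A \<Longrightarrow> eps (w z) = 0" "eps w' = 0" and A: "open A" "z0 \<in> A"
  shows "((\<lambda>z. B (v z) (w z)) has_field_derivative B v' (w z0) + B (v z0) w') (at z0)"
proof -
  have "((\<lambda>z. \<Sum>i\<in>UNIV. \<Sum>j\<in>UNIV. v z $ i * (w z $ j * B (axis i 1) (wb j))) has_field_derivative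
      (\<Sum>i\<in>UNIV. \<Sum>j\<in>UNIV. v' $ i * (w z0 $ j * B (axis i 1) (wb j)) + (w' $ j * B (axis i 1) (wb j)) * v z0 $ i)) (at z0)"
    by (intro DERIV_sum DERIV_mult DERIV_cmult_right v w)
  moreover have "(\<Sum>i\<in>UNIV. \<Sum>j\<in>UNIV. v' $ i * (w z0 $ j * B (axis i 1) (wb j)) + (w' $ j * B (axis i 1) (wb j)) * v z0 $ i)
      = B v' (w z0) + B (v z0) w'"
    unfolding bilinear_coordinates[OF B W(1)[OF A(2)]] bilinear_coordinates[OF B W(2)]
    by (simp only: sum.distrib mult.commute[of "v z0 $ _"])
  ultimately have d: "((\<lambda>z. \<Sum>i\<in>UNIV. \<Sum>j\<in>UNIV. v z $ i * (w z $ j * B (axis i 1) (wb j))) has_field_derivative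
      B v' (w z0) + B (v z0) w') (at z0)" by (simp only:)
  have "B (v z) (w z) = (\<Sum>i\<in>UNIV. \<Sum>j\<in>UNIV. v z $ i * (w z $ j * B (axis i 1) (wb j)))" if "z \<in> A" for z
    by (rule bilinear_coordinates[OF B W(1)[OF that]])
  then show ?thesis
    by (intro has_field_derivative_transform_within_open[OF d A]) simp
qed

text \<open>The coefficients of \<open>B\<close> on integral vectors are integers, hence
  real.\<close>

lemma bilinear_cnj:
  assumes B: "bilinear_on UNIV (wfil eps tw (-1)) B"
    and int: "\<forall>v \<in> int_lattice. \<forall>w \<in> wfil eps tw (-1) \<inter> int_lattice. B v w \<in> \<int>"
    and w: "eps w = 0"
  shows "cnj (B v w) = B (cnjv v) (cnjv w)"
proof -
  have "B (axis i 1) (wb j) \<in> \<int>" for i j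
    using int axis_int_lattice[of i] wb[of j] unfolding wfil_simps by blast
  then have "cnj (B (axis i 1) (wb j)) = B (axis i 1) (wb j)" for i j
    by (metis Ints_imp_Reals Reals_cnj_iff)
  moreover have "eps (cnjv w) = 0" using w by simp
  ultimately show ?thesis
    unfolding bilinear_coordinates[OF B w] bilinear_coordinates[OF B \<open>eps (cnjv w) = 0\<close>] by (simp add: cnjv_def)
qed

end

context biext_split
begin

text \<open>The \<open>tw\<close>-coordinate of the component of type (-1, -1); self-duality will
  identify it on W (-1) with \<open>B e\<close>.\<close>

definition pc :: "complex ^ 'n \<Rightarrow> complex" where
  "pc v = (SOME c. BI.proj {(-1, -1)} v = c *s tw)"

lemma pc: "BI.proj {(-1, -1)} v = pc v *s tw"
proof -
  have "BI.proj {(-1, -1)} v \<in> BI (-1, -1)" using BI.proj(1)[where K = "{(-1, -1)}" and v = v] by (simp add: BI.sum_over_single)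
  then have "\<exists>c. BI.proj {(-1, -1)} v = c *s tw" unfolding BI_m1_m1 by blast
  then show ?thesis unfolding pc_def by (rule someI_ex)
qed

lemma pc_unique: "BI.proj {(-1, -1)} v = c *s tw \<Longrightarrow> pc v = c"
  using pc[of v] by simp

lemma pc_add: "pc (u + v) = pc u + pc v"
  by (rule pc_unique) (simp add: BI.proj_add pc vec.scale_left_distrib)

lemma pc_scale: "pc (a *s v) = a * pc v"
  by (rule pc_unique) (simp add: BI.proj_scale pc)

lemma tw_in_BI: "a *s tw \<in> sum_over BI {(-1, -1)}"
  unfolding BI.sum_over_single BI_m1_m1 by (rule rangeI)

lemma pc_tw [simp]: "pc (a *s tw) = a"
  by (rule pc_unique) (rule BI.proj_id[OF tw_in_BI])

lemma pc_0:
  assumes "v \<in> sum_over BI K" "(-1, -1) \<notin> K"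
  shows "pc v = 0"
  by (rule pc_unique) (use BI.proj_0[OF assms(1), of "{(-1, -1)}"] assms(2) in simp)

lemma pc_coordinates: "pc v = (\<Sum>j\<in>UNIV. v $ j * pc (axis j 1))"
proof -
  have s: "pc (\<Sum>j\<in>A. f j) = (\<Sum>j\<in>A. pc (f j))" for f and A :: "'n set"
    using pc_scale[of 0 0] by (induction A rule: infinite_finite_induct) (simp_all add: pc_add)
  show ?thesis by (subst vec_sum_axis) (simp add: s pc_scale)
qed

text \<open>\<open>KA\<close> collects the types of the intersection of \<open>F 0\<close> with W
  (-1), and \<open>KB\<close> those of its conjugate. \<open>KA\<close> may include weights below -1
  because the pieces there with nonnegative first degree are zero; in \<open>KB\<close> they would
  include (-1, -1), which is kept apart.\<close>

definition KA :: "(int \<times> int) set" where "KA = {(a, b). a \<ge> 0 \<and> a + b \<le> -1}"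
definition KB :: "(int \<times> int) set" where "KB = {(a, b). a < 0 \<and> a + b = -1}"

lemma KA_iff: "v \<in> sum_over BI KA \<longleftrightarrow> v \<in> F 0 \<and> eps v = 0"
proof -
  have KA: "KA = Fge 0 \<inter> Wle (-1)" by (auto simp: KA_def)
  have 1: "v \<in> F 0 \<longleftrightarrow> v \<in> sum_over BI (Fge 0)" using F_eq_sum_over[of 0] by simp
  have 2: "eps v = 0 \<longleftrightarrow> v \<in> sum_over BI (Wle (-1))"
    using wfil_eq_sum_over[of "-1"] by (auto simp: wfil_simps)
  have "sum_over BI KA \<subseteq> sum_over BI (Fge 0)" "sum_over BI KA \<subseteq> sum_over BI (Wle (-1))"
    by (rule BI.sum_over_mono; auto simp: KA_def)+
  then show ?thesis unfolding 1 2 using BI.sum_over_Int[of v "Fge 0" "Wle (-1)"]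
    unfolding KA[symmetric] by blast
qed

lemma cnjv_swap:
  assumes "v \<in> sum_over BI K" "\<And>a b. (a, b) \<in> K \<Longrightarrow> (b, a) \<in> K' \<and> (a, b) \<noteq> (0, 0)"
  shows "cnjv v \<in> sum_over BI K'"
proof (rule BI.additive_into_subspace[OF assms(1), where f = cnjv])
  fix k x assume k: "k \<in> K" and x: "x \<in> BI k"
  obtain a b where ab: "k = (a, b)" by (cases k)
  have "cnjv x \<in> BI (b, a)" using cnjv_BI[of a b] assms(2)[of a b] k x ab by blast
  then have "cnjv x \<in> sum_over BI {(b, a)}" by (simp add: BI.sum_over_single)
  moreover have "{(b, a)} \<subseteq> K'" using assms(2)[of a b] k ab by blast
  ultimately show "cnjv x \<in> sum_over BI K'" using BI.sum_over_mono by blast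
qed (simp_all add: BI.sum_over_subspace)

lemma cnjv_KA: "v \<in> sum_over BI KA \<Longrightarrow> cnjv v \<in> sum_over BI KB"
proof -
  assume v: "v \<in> sum_over BI KA"
  have "sum_over BI KA \<subseteq> sum_over BI {(a, b). a \<ge> 0 \<and> a + b = -1}"
  proof (rule BI.sum_over_restrict)
    fix k assume "k \<in> KA" "k \<notin> {(a, b). a \<ge> 0 \<and> a + b = -1}"
    then obtain a b where k: "k = (a, b)" "a \<ge> 0" "a + b \<le> -2" by (cases k) (auto simp: KA_def)
    show "BI k = {0}" unfolding k(1) by (rule BI_trivial) (use k in auto)
  qed
  with v have "v \<in> sum_over BI {(a, b). a \<ge> 0 \<and> a + b = -1}" by blast
  then show ?thesis by (rule cnjv_swap) (auto simp: KB_def)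
qed

lemma cnjv_KB: "v \<in> sum_over BI KB \<Longrightarrow> cnjv v \<in> sum_over BI KA"
  by (erule cnjv_swap) (auto simp: KA_def KB_def)

lemma W1_parts:
  assumes "eps v = 0"
  shows "v = BI.proj KA v + BI.proj KB v + pc v *s tw"
proof -
  have "v \<in> sum_over BI (Wle (-1))"
    using assms unfolding wfil_eq_sum_over[symmetric] by (simp add: wfil_simps)
  moreover have "sum_over BI (Wle (-1)) \<subseteq> sum_over BI (KA \<union> (KB \<union> {(-1, -1)}))"
  proof (rule BI.sum_over_restrict)
    fix k assume "k \<in> Wle (-1)" "k \<notin> KA \<union> (KB \<union> {(-1, -1)})"
    then obtain a b where k: "k = (a, b)" "a + b \<le> -2" "(a, b) \<noteq> (-1, -1)"
      by (cases k) (auto simp: KA_def KB_def)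
    show "BI k = {0}" unfolding k(1) by (rule BI_trivial) (use k in auto)
  qed
  ultimately have "v \<in> sum_over BI (KA \<union> (KB \<union> {(-1, -1)}))" by blast
  from BI.sum_over_split[OF this] obtain x y where x: "x \<in> sum_over BI KA"
    and y: "y \<in> sum_over BI (KB \<union> {(-1, -1)})" and v: "v = x + y" by blast
  from BI.sum_over_split[OF y] obtain u w where u: "u \<in> sum_over BI KB"
    and w: "w \<in> sum_over BI {(-1, -1)}" and yu: "y = u + w" by blast
  obtain c where c: "w = c *s tw" using w unfolding BI.sum_over_single BI_m1_m1 by blast
  have AB: "KA \<inter> KB = {}" "KB \<inter> KA = {}" "KA \<inter> {(-1, -1)} = {}" "KB \<inter> {(-1, -1)} = {}"
    "(-1, -1) \<notin> KA" "(-1, -1) \<notin> KB" by (auto simp: KA_def KB_def)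
  have "BI.proj KA v = x" unfolding v yu
    by (simp add: BI.proj_add BI.proj_id[OF x] BI.proj_0[OF u AB(1)] BI.proj_0[OF w AB(3)])
  moreover have "BI.proj KB v = u" unfolding v yu
    by (simp add: BI.proj_add BI.proj_id[OF u] BI.proj_0[OF x AB(2)] BI.proj_0[OF w AB(4)])
  moreover have "pc v = c" unfolding v yu c by (simp add: pc_add pc_0[OF x AB(5)] pc_0[OF u AB(6)])
  ultimately show ?thesis using v yu c by (simp add: add.assoc)
qed

lemma parts_unique:
  assumes "a \<in> sum_over BI KA" "b \<in> sum_over BI KB"
  shows "BI.proj KA (a + b + c *s tw) = a" "BI.proj KB (a + b + c *s tw) = b" "pc (a + b + c *s tw) = c"
proof -
  have AB: "KA \<inter> KB = {}" "KB \<inter> KA = {}" "KA \<inter> {(-1, -1)} = {}" "KB \<inter> {(-1, -1)} = {}"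
    "(-1, -1) \<notin> KA" "(-1, -1) \<notin> KB" by (auto simp: KA_def KB_def)
  show "BI.proj KA (a + b + c *s tw) = a"
    by (simp add: BI.proj_add BI.proj_id[OF assms(1)] BI.proj_0[OF assms(2) AB(1)] BI.proj_0[OF tw_in_BI AB(3)])
  show "BI.proj KB (a + b + c *s tw) = b"
    by (simp add: BI.proj_add BI.proj_id[OF assms(2)] BI.proj_0[OF assms(1) AB(2)] BI.proj_0[OF tw_in_BI AB(4)])
  show "pc (a + b + c *s tw) = c"
    by (simp add: pc_add pc_0[OF assms(1) AB(5)] pc_0[OF assms(2) AB(6)])
qed

lemma pc_cnjv:
  assumes "eps v = 0"
  shows "pc (cnjv v) = cnj (pc v)"
proof -
  have "cnjv v = cnjv (BI.proj KA v + BI.proj KB v + pc v *s tw)" by (rule arg_cong[OF W1_parts[OF assms]])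
  also have "\<dots> = cnjv (BI.proj KB v) + cnjv (BI.proj KA v) + cnj (pc v) *s tw" by (simp add: add.commute)
  finally have "cnjv v = cnjv (BI.proj KB v) + cnjv (BI.proj KA v) + cnj (pc v) *s tw" .
  then show ?thesis by (simp only:) (rule parts_unique(3)[OF cnjv_KB[OF BI.proj(1)] cnjv_KA[OF BI.proj(1)]])
qed

text \<open>The projection onto the complementary pieces is a constant matrix which annihilates the
  function, hence also its derivatives.\<close>

lemma jet_in_sum_over:
  assumes j: "\<And>i. has_jet2 (\<lambda>z. x z $ i) (d $ i) (b $ i) (l i) z0"
    and x: "eventually (\<lambda>z. x z \<in> sum_over BI K) (nhds z0)"
  shows "d \<in> sum_over BI K"
proof -
  let ?P = "BI.pmat (- K)"
  have "(?P *v d) $ i = 0" for i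
  proof -
    have "has_jet2 (\<lambda>z. \<Sum>j\<in>UNIV. ?P $ i $ j * x z $ j) (\<Sum>j\<in>UNIV. 0 * x z0 $ j + ?P $ i $ j * d $ j)
      (\<Sum>j\<in>UNIV. 0 * x z0 $ j + ?P $ i $ j * b $ j)
      (\<Sum>j\<in>UNIV. 0 * x z0 $ j + ?P $ i $ j * l j + 2 * (0 * d $ j + 0 * b $ j)) z0"
    proof (rule has_jet2_sum[OF finite])
      fix k
      show "has_jet2 (\<lambda>z. ?P $ i $ k * x z $ k) (0 * x z0 $ k + ?P $ i $ k * d $ k)
        (0 * x z0 $ k + ?P $ i $ k * b $ k) (0 * x z0 $ k + ?P $ i $ k * l k + 2 * (0 * d $ k + 0 * b $ k)) z0"
        by (rule has_jet2_mult[OF has_jet2_const j])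
    qed
    moreover have "eventually (\<lambda>z. (\<Sum>j\<in>UNIV. ?P $ i $ j * x z $ j) = 0) (nhds z0)"
      using x
    proof eventually_elim
      case (elim z)
      have "?P *v x z = 0" unfolding BI.pmat by (rule BI.proj_0[OF elim]) simp
      then show ?case by (metis matrix_vector_mult_nth zero_index)
    qed
    ultimately have "has_jet2 (\<lambda>z. 0) (\<Sum>j\<in>UNIV. 0 * x z0 $ j + ?P $ i $ j * d $ j)
      (\<Sum>j\<in>UNIV. 0 * x z0 $ j + ?P $ i $ j * b $ j)
      (\<Sum>j\<in>UNIV. 0 * x z0 $ j + ?P $ i $ j * l j + 2 * (0 * d $ j + 0 * b $ j)) z0"
      by (rule has_jet2_cong)
    from has_jet2_unique(1)[OF this has_jet2_const] show ?thesis by (simp add: matrix_vector_mult_nth)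
  qed
  then have "?P *v d = 0" by (simp add: vec_eq_iff)
  then have "BI.proj (- K) d = 0" by (simp only: BI.pmat)
  then show ?thesis using BI.proj(2)[where K = "- K" and v = d] by simp
qed

end

subsection \<open>Germs of period maps\<close>

definition cnjm :: "complex ^ 'n ^ 'n \<Rightarrow> complex ^ 'n ^ 'n::finite" where
  "cnjm A = (\<chi> i j. cnj (A $ i $ j))"

lemma cnjm_mult: "cnjm A *v v = cnjv (A *v cnjv v)"
  by (simp add: cnjm_def cnjv_def matrix_vector_mult_def vec_eq_iff)

locale biext_germ = biext_split eps tw Q F e ea
    for eps :: "complex ^ 'n::finite \<Rightarrow> complex" and tw Q F e ea +
  fixes G :: "complex \<Rightarrow> complex ^ 'n ^ 'n" and z0 :: complex and R :: real
  assumes R: "R > 0"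
    and G_hol: "(\<lambda>z. G z $ i $ j) holomorphic_on ball z0 R"
    and G_0: "G z0 = 0"
    and G_neg: "z \<in> ball z0 R \<Longrightarrow> G z \<in> sum_over LC {(a, b). a < 0}"
begin

definition D :: "complex ^ 'n ^ 'n" where "D = matrix_deriv G z0"

definition g :: "complex \<Rightarrow> complex ^ 'n ^ 'n" where "g z = mexp (G z)"

lemma z0_ball: "z0 \<in> ball z0 R" using R by simp

lemma G_deriv: "((\<lambda>z. G z $ i $ j) has_field_derivative D $ i $ j) (at z0)"
  using holomorphic_derivI[OF G_hol open_ball z0_ball] by (simp add: D_def matrix_deriv_def)

lemma g_nth: "z \<in> ball z0 R \<Longrightarrow> (g z *v v) $ i = (\<Sum>k<nil. ((((*v) (G z)) ^^ k) v) $ i / of_nat (fact k))"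
  unfolding g_def
  by (simp add: mexp_neg[OF G_neg]) (simp add: scaleR_conv_of_real divide_inverse mult.commute)

lemma g_hol: "(\<lambda>z. (g z *v v) $ i) holomorphic_on ball z0 R"
proof -
  have "(\<lambda>z. \<Sum>k<nil. ((((*v) (G z)) ^^ k) v) $ i / of_nat (fact k)) holomorphic_on ball z0 R"
    by (intro holomorphic_intros funpow_matrix_holomorphic G_hol) simp
  then show ?thesis by (rule holomorphic_transform) (simp add: g_nth)
qed

lemma g_deriv: "((\<lambda>z. (g z *v v) $ i) has_field_derivative (D *v v) $ i) (at z0)"
proof -
  have "((\<lambda>z. \<Sum>k<nil. ((((*v) (G z)) ^^ k) v) $ i / of_nat (fact k)) has_field_derivative
      (\<Sum>k<nil. (if k = 1 then (D *v v) $ i else 0) / of_nat (fact k))) (at z0)"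
    by (intro DERIV_sum DERIV_cdivide funpow_matrix_deriv G_deriv G_0)
  moreover have "(\<Sum>k<nil. (if k = 1 then (D *v v) $ i else 0) / of_nat (fact k)) = (D *v v) $ i"
    using nil_ge by (simp add: if_distrib[of "\<lambda>x. x / _"] cong: if_cong)
  ultimately have "((\<lambda>z. \<Sum>k<nil. ((((*v) (G z)) ^^ k) v) $ i / of_nat (fact k)) has_field_derivative
      (D *v v) $ i) (at z0)" by (simp only:)
  then show ?thesis
    by (rule has_field_derivative_transform_within_open[OF _ open_ball z0_ball]) (simp add: g_nth)
qed

lemma g_jet: "has_jet2 (\<lambda>z. (g z *v v) $ i) ((D *v v) $ i) (\<i> * (D *v v) $ i) 0 z0"
  using has_jet2_holomorphic[OF g_hol open_ball z0_ball] DERIV_imp_deriv[OF g_deriv] by simp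

lemma g_entry_jet: "has_jet2 (\<lambda>z. g z $ i $ j) (D $ i $ j) (\<i> * D $ i $ j) 0 z0"
  using g_jet[of "axis j 1" i] by (simp flip: matrix_entry)

lemma g_z0: "g z0 = mat 1"
proof -
  have "g z0 *v v = mat 1 *v v" for v
  proof -
    have "(((*v) (0 :: complex ^ 'n ^ 'n)) ^^ k) v = 0" if "0 < k" for k using that by (simp add: funpow_pos)
    then show ?thesis using mexp_neg_split[OF G_neg[OF z0_ball]] by (simp add: g_def G_0)
  qed
  then show ?thesis by (simp add: matrix_eq)
qed

lemma g_eps_tw: "z \<in> ball z0 R \<Longrightarrow> eps (g z *v v) = eps v" "z \<in> ball z0 R \<Longrightarrow> g z *v tw = tw"
  unfolding g_def using mexp_neg_eps_tw[OF G_neg] by blast+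

lemma eventually_ball: "eventually (\<lambda>z. z \<in> ball z0 R) (nhds z0)"
  by (rule eventually_nhds_in_open[OF open_ball z0_ball])

text \<open>An arbitrary lift is only known to have values in q, so its derivative lowers the first
  degree by at least one; this suffices to show that the derivative is unique.\<close>

lemma D_lower:
  assumes "v \<in> BI k"
  shows "D *v v \<in> lower (fst k)"
  unfolding lower_def
proof (rule jet_in_sum_over[where b = "\<i> *s (D *v v)" and l = "\<lambda>i. 0"])
  fix i
  have j: "has_jet2 (\<lambda>z. G z $ i $ l) (D $ i $ l) (\<i> * D $ i $ l) 0 z0" for l
    using has_jet2_holomorphic[OF G_hol open_ball z0_ball] DERIV_imp_deriv[OF G_deriv] by simp
  have "has_jet2 (\<lambda>z. \<Sum>l\<in>UNIV. G z $ i $ l * v $ l) (\<Sum>l\<in>UNIV. D $ i $ l * v $ l)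
      (\<Sum>l\<in>UNIV. \<i> * D $ i $ l * v $ l) (\<Sum>l\<in>UNIV. 0 * v $ l) z0"
    by (rule has_jet2_sum[OF finite]) (rule has_jet2_mult_const[OF j])
  then show "has_jet2 (\<lambda>z. (G z *v v) $ i) ((D *v v) $ i) ((\<i> *s (D *v v)) $ i) 0 z0"
    by (simp only: matrix_vector_mult_nth vector_smult_component sum_distrib_left mult.assoc
        mult_zero_left sum.neutral_const)
next
  show "eventually (\<lambda>z. G z *v v \<in> sum_over BI {(a, b). a < fst k}) (nhds z0)"
    using eventually_ball
  proof eventually_elim
    case (elim z)
    have "(\<lambda>j. k + j) ` {(a, b). a < 0} \<subseteq> {(a, b). a < fst k}" by (cases k) auto
    then show ?case using LC_sum_over_action[OF G_neg[OF elim] assms] BI.sum_over_mono by blast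
  qed
qed

end

text \<open>For \<open>v\<close> in a piece of first degree \<open>p\<close>, let \<open>x z\<close>
  be the vector for which exp \<open>G2 z\<close> sends \<open>v + x z\<close> to the image of
  \<open>v\<close> under exp \<open>G1 z\<close>. It stays in \<open>F p\<close>, and so does its
  derivative at the centre, which is the difference of the two derivatives applied to
  \<open>v\<close>. Both derivatives also lower the first degree, so this difference lies in the
  complement \<open>lower p\<close> of \<open>F p\<close> as well.\<close>

lemma germ_deriv_unique:
  assumes "biext_germ eps tw Q F e ea G1 z0 R" "biext_germ eps tw Q F e ea G2 z0 R"
    and same: "\<And>z p. z \<in> ball z0 R \<Longrightarrow> (*v) (mexp (G1 z)) ` F p = (*v) (mexp (G2 z)) ` F p"
  shows "matrix_deriv G1 z0 = matrix_deriv G2 z0"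
proof -
  interpret A: biext_germ eps tw Q F e ea G1 z0 R by (rule assms)
  interpret B: biext_germ eps tw Q F e ea G2 z0 R by (rule assms)
  have "A.D *v v = B.D *v v" if v: "v \<in> A.BI k" for k v
  proof -
    have "\<exists>x. eventually (\<lambda>z. B.g z *v x z = A.g z *v v - B.g z *v v) (nhds z0) \<and>
      (\<forall>i. has_jet2 (\<lambda>z. x z $ i) ((A.D *v v - B.D *v v) $ i) ((\<i> *s (A.D *v v - B.D *v v)) $ i)
        ((- 2 *s (B.D *v (A.D *v v - B.D *v v) + (\<chi> i j. \<i> * B.D $ i $ j) *v (\<i> *s (A.D *v v - B.D *v v)))) $ i) z0)"
    proof (rule has_jet2_linear_system)
      show "has_jet2 (\<lambda>z. B.g z $ i $ j) (B.D $ i $ j) ((\<chi> i j. \<i> * B.D $ i $ j) $ i $ j) 0 z0" for i j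
        using B.g_entry_jet by simp
      show "has_jet2 (\<lambda>z. (A.g z *v v - B.g z *v v) $ i) ((A.D *v v - B.D *v v) $ i)
          ((\<i> *s (A.D *v v - B.D *v v)) $ i) 0 z0" for i
        using has_jet2_diff[OF A.g_jet[of v i] B.g_jet[of v i]] by (simp add: right_diff_distrib)
    qed (simp_all add: A.g_z0 B.g_z0)
    then obtain x where x: "eventually (\<lambda>z. B.g z *v x z = A.g z *v v - B.g z *v v) (nhds z0)"
      and j: "\<And>i. has_jet2 (\<lambda>z. x z $ i) ((A.D *v v - B.D *v v) $ i) ((\<i> *s (A.D *v v - B.D *v v)) $ i)
        ((- 2 *s (B.D *v (A.D *v v - B.D *v v) + (\<chi> i j. \<i> * B.D $ i $ j) *v (\<i> *s (A.D *v v - B.D *v v)))) $ i) z0"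
      by blast
    have "v \<in> F (fst k)"
    proof -
      have "{k} \<subseteq> Fge (fst k)" by (simp add: case_prod_beta)
      from A.BI.sum_over_mono[OF this] v show ?thesis
        by (simp only: A.F_eq_sum_over[of "fst k"] A.BI.sum_over_single) blast
    qed
    have "A.D *v v - B.D *v v \<in> sum_over A.BI (Fge (fst k))"
    proof (rule A.jet_in_sum_over[OF j])
      show "eventually (\<lambda>z. x z \<in> sum_over A.BI (Fge (fst k))) (nhds z0)"
        using x A.eventually_ball
      proof eventually_elim
        case (elim z)
        have "A.g z *v v \<in> (*v) (B.g z) ` F (fst k)"
          using same[OF elim(2), of "fst k"] \<open>v \<in> F (fst k)\<close> unfolding A.g_def B.g_def by blast
        then obtain w where w: "w \<in> F (fst k)" "A.g z *v v = B.g z *v w" by blast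
        have "B.g z *v (x z - (w - v)) = 0"
          using elim(1) w(2) by (simp add: matrix_vector_mult_diff_distrib)
        then have "x z - (w - v) = 0" unfolding B.g_def by (rule A.mexp_neg_injective[OF B.G_neg[OF elim(2)]])
        then have "x z = w - v" by simp
        moreover have "w - v \<in> F (fst k)" using w(1) \<open>v \<in> F (fst k)\<close> by (rule A.F_closed(3))
        ultimately have "x z \<in> F (fst k)" by (simp only:)
        then show ?case by (rule subst[OF A.F_eq_sum_over])
      qed
    qed
    moreover have "A.D *v v - B.D *v v \<in> A.lower (fst k)"
      by (rule vec.subspace_diff[OF A.lower_subspace A.D_lower[OF v] B.D_lower[OF v]])
    then have "A.D *v v - B.D *v v \<in> sum_over A.BI {(a, b). a < fst k}" unfolding A.lower_def .
    ultimately have "A.D *v v - B.D *v v = 0" by (rule A.BI.sum_over_disjoint) auto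
    then show ?thesis by simp
  qed
  then have "A.D = B.D" by (rule A.BI.matrix_eq_on_pieces)
  then show ?thesis by (simp only: A.D_def B.D_def)
qed

subsection \<open>The Laplacian at a point\<close>

text \<open>The situation near one point in a flat frame. Self-duality is recorded at step 0, where
  the moving \<open>F 0\<close> pairs to zero with its intersection with W (-1), and the Riemann
  relation at type (-1, 0), whose Weil operator is \<open>inverse \<i>\<close>.\<close>

locale biext_dual = biext_germ eps tw Q F e ea G z0 R
    for eps :: "complex ^ 'n::finite \<Rightarrow> complex" and tw Q F e ea G z0 R +
  fixes B :: "complex ^ 'n \<Rightarrow> complex ^ 'n \<Rightarrow> complex"
  assumes fibres: "z \<in> ball z0 R \<Longrightarrow> mixed_hodge eps tw (\<lambda>p. (*v) (mexp (G z)) ` F p)"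
    and horizontal: "matrix_deriv G z0 \<in> sum_over LC {(a, b). a = -1}"
    and B: "bilinear_on UNIV (wfil eps tw (-1)) B"
    and B_int: "\<forall>v \<in> int_lattice. \<forall>w \<in> wfil eps tw (-1) \<inter> int_lattice. B v w \<in> \<int>"
    and B_Q: "eps x = 0 \<Longrightarrow> eps w = 0 \<Longrightarrow> B x w = Q w x"
    and B_tw: "B v tw = eps v"
    and B_isotropic: "z \<in> ball z0 R \<Longrightarrow> v \<in> F 0 \<Longrightarrow> w \<in> F 0 \<Longrightarrow> eps w = 0 \<Longrightarrow>
      B (mexp (G z) *v v) (mexp (G z) *v w) = 0"
    and Q_positive: "v \<in> F (-1) \<Longrightarrow> eps v = 0 \<Longrightarrow> cnjv v \<in> F 0 \<Longrightarrow> v \<noteq> 0 \<Longrightarrow>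
      \<exists>r>0. inverse \<i> * Q v (cnjv v) = of_real r"
begin

abbreviation Fz :: "complex \<Rightarrow> int \<Rightarrow> (complex ^ 'n) set" where "Fz z \<equiv> (\<lambda>p. (*v) (mexp (G z)) ` F p)"

definition gam :: "complex ^ 'n ^ 'n" where "gam = component LC (-1, 0) D"
definition t :: "complex ^ 'n" where "t = gam *v e"

lemma components_D:
  "\<exists>c. decomposes LC c D \<and> (\<forall>a b. a \<noteq> -1 \<longrightarrow> c (a, b) = 0) \<and> gam = c (-1, 0)"
proof -
  obtain c where c: "decomposes LC c D" "\<And>k. k \<notin> {(a, b). a = -1} \<Longrightarrow> c k = 0"
    using horizontal unfolding D_def[symmetric] sum_over_def by blast
  have "(THE c. decomposes LC c D) = c" using c(1) LC_unique by (blast intro: the_equality)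
  then have "gam = c (-1, 0)" by (simp add: gam_def component_def)
  moreover have "c (a, b) = 0" if "a \<noteq> -1" for a b using c(2)[of "(a, b)"] that by simp
  ultimately show ?thesis using c(1) by blast
qed

lemma gam_BI: "v \<in> BI (p, q) \<Longrightarrow> gam *v v \<in> BI (p - 1, q)"
proof -
  assume v: "v \<in> BI (p, q)"
  obtain c where c: "decomposes LC c D" "gam = c (-1, 0)" using components_D by blast
  have "gam \<in> LC (-1, 0)" using c unfolding decomposes_def by auto
  from LC_BI[OF this v] show ?thesis by simp
qed

lemma e_BI: "e \<in> BI (0, 0)" unfolding BI_00 by (rule range_eqI[of _ _ 1]) simp

lemma t_H: "t \<in> H (-1)"
  using gam_BI[OF e_BI] BI_H[of "-1" 0] by (simp add: t_def)

text \<open>By horizontality only degrees (-1, b) occur, and among the types (-1, b) only (-1, 0)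
  and (-1, -1) can have nonzero pieces.\<close>

lemma D_e: "\<exists>m. D *v e = t + m *s tw"
proof -
  obtain c where c: "decomposes LC c D" "\<And>a b. a \<noteq> -1 \<Longrightarrow> c (a, b) = 0" "gam = c (-1, 0)"
    using components_D by blast
  have d: "decomposes BI (\<lambda>j. c j *v e) (D *v e)"
    using LC_action[OF c(1) e_BI] by (simp add: zero_prod_def[symmetric])
  have off: "c j *v e = 0" if j: "j \<notin> {(-1, 0), (-1, -1)}" for j
  proof -
    obtain a b where ab: "j = (a, b)" by (cases j)
    have "c (a, b) *v e \<in> BI (a, b)" using d ab unfolding decomposes_def by blast
    moreover have "BI (a, b) = {0}" if "a = -1" using j that by (intro BI_trivial) (auto simp: ab)
    ultimately show ?thesis using c(2)[of a b] ab by (cases "a = -1") auto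
  qed
  have "D *v e = (\<Sum>j\<in>{(-1, 0), (-1, -1)}. c j *v e)" by (rule decomposes_sum[OF d]) (use off in auto)
  then have De: "D *v e = t + c (-1, -1) *v e" by (simp add: t_def c(3))
  have "c (-1, -1) *v e \<in> BI (-1, -1)" using d unfolding decomposes_def by blast
  then obtain m where "c (-1, -1) *v e = m *s tw" unfolding BI_m1_m1 by blast
  with De show ?thesis by auto
qed

text \<open>On type (0, -1) the derivative consists of a component of degree (-1, 1), which stays in
  weight -1, and of \<open>gam\<close>, which lands in the line of \<open>tw\<close>; the functional
  \<open>pc\<close> sees only the latter.\<close>

lemma D_H0:
  assumes v: "v \<in> H 0"
  shows "gam *v v = pc (D *v v) *s tw"
proof -
  obtain c where c: "decomposes LC c D" "\<And>a b. a \<noteq> -1 \<Longrightarrow> c (a, b) = 0" "gam = c (-1, 0)"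
    using components_D by blast
  have vB: "v \<in> BI (0, -1)" using v BI_H[of 0 "-1"] by simp
  have d: "decomposes BI (\<lambda>j. c (j - (0, -1)) *v v) (D *v v)" by (rule LC_action[OF c(1) vB])
  have off: "c (j - (0, -1)) *v v = 0" if j: "j \<notin> {(-1, 0), (-1, -1)}" for j
  proof -
    obtain a b where ab: "j = (a, b)" by (cases j)
    have "c (j - (0, -1)) *v v \<in> BI j" using d unfolding decomposes_def by blast
    moreover have "BI (a, b) = {0}" if "a = -1" using j that by (intro BI_trivial) (auto simp: ab)
    ultimately show ?thesis using c(2)[of a "b + 1"] ab by (cases "a = -1") auto
  qed
  have "D *v v = (\<Sum>j\<in>{(-1, 0), (-1, -1)}. c (j - (0, -1)) *v v)"
    by (rule decomposes_sum[OF d]) (use off in auto)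
  then have Dv: "D *v v = c (-1, 1) *v v + gam *v v" by (simp add: c(3))
  have "c ((-1, 0) - (0, -1)) *v v \<in> BI (-1, 0)" using d unfolding decomposes_def by blast
  then have "c (-1, 1) *v v \<in> sum_over BI {(-1, 0)}" by (simp add: BI.sum_over_single)
  then have "pc (c (-1, 1) *v v) = 0" by (rule pc_0) simp
  moreover have "gam *v v \<in> BI (-1, -1)" using gam_BI[OF vB] by simp
  then obtain m where m: "gam *v v = m *s tw" unfolding BI_m1_m1 by blast
  ultimately show ?thesis by (simp add: Dv pc_add)
qed

lemma gam_tw: "gam *v tw = 0"
proof -
  have "1 *s tw \<in> BI (-1, -1)" unfolding BI_m1_m1 by (rule rangeI)
  from gam_BI[OF this] show ?thesis using BI_trivial[of "-2" "-1"] by simp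
qed

lemma gam_H: "v \<in> H q \<Longrightarrow> q \<noteq> 0 \<Longrightarrow> gam *v v = 0"
proof -
  assume v: "v \<in> H q" and q: "q \<noteq> 0"
  have "v \<in> BI (q, -1 - q)" using v by (simp add: BI_H)
  from gam_BI[OF this] have "gam *v v \<in> BI (q - 1, -1 - q)" .
  moreover have "BI (q - 1, -1 - q) = {0}" using q by (intro BI_trivial) auto
  ultimately show ?thesis by blast
qed

lemma B_add_left: "eps w = 0 \<Longrightarrow> B (u + v) w = B u w + B v w"
  and B_add_right: "eps w = 0 \<Longrightarrow> eps w' = 0 \<Longrightarrow> B v (w + w') = B v w + B v w'"
  and B_scale_left: "eps w = 0 \<Longrightarrow> B (a *s v) w = a * B v w"
  and B_scale_right: "eps w = 0 \<Longrightarrow> B v (a *s w) = a * B v w"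
  using B unfolding bilinear_on_def wfil_simps by blast+

lemma Q_tw: "eps v = 0 \<Longrightarrow> Q v tw = 0"
  using lat by (simp add: biext_lattice_def wfil_simps)

lemma Q_alt: "eps v = 0 \<Longrightarrow> Q v v = 0"
  using lat by (simp add: biext_lattice_def wfil_simps)

lemma Q_antisym:
  assumes "eps u = 0" "eps v = 0"
  shows "Q u v = - Q v u"
proof -
  have "B (u + v) (u + v) = 0" using assms Q_alt[of "u + v"] B_Q[of "u + v" "u + v"] by simp
  moreover have "B (u + v) (u + v) = B u u + B v u + (B u v + B v v)"
    using assms by (simp add: B_add_left B_add_right)
  ultimately have "B v u + B u v = 0" using assms B_Q[of u u] B_Q[of v v] Q_alt by simp
  then show ?thesis using assms by (simp add: B_Q eq_neg_iff_add_eq_0)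
qed

lemma B_e_KA: "w \<in> F 0 \<Longrightarrow> eps w = 0 \<Longrightarrow> B e w = 0"
  using B_isotropic[OF z0_ball e_F, of w] g_z0 unfolding g_def by simp

lemma B_e_cnjv_KA:
  assumes "cnjv w \<in> F 0" "eps w = 0"
  shows "B e w = 0"
proof -
  have c: "eps (cnjv w) = 0" using assms by simp
  have "B tw (cnjv w) = 0" using B_Q[of tw "cnjv w"] Q_tw[OF c] c by simp
  then have "B (cnjv e) (cnjv w) = 0"
    using B_e_KA[OF assms(1) c] by (simp only: cnjv_e B_add_left[OF c] B_scale_left[OF c] mult_zero_right add_0)
  then have "cnj (B e w) = 0" using bilinear_cnj[OF B B_int assms(2)] by simp
  then show ?thesis by simp
qed

text \<open>On the intersection of \<open>F 0\<close> with W (-1) both sides vanish, by isotropy at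
  \<open>z0\<close>; on its conjugate as well, because \<open>B\<close> is real and \<open>e\<close>
  differs from its conjugate by a multiple of \<open>tw\<close>, which pairs to zero with W (-1).
  The remaining direction \<open>tw\<close> is normalized by \<open>B_tw\<close>.\<close>

lemma B_e:
  assumes "eps w = 0"
  shows "B e w = pc w"
proof -
  let ?a = "BI.proj KA w" and ?b = "BI.proj KB w"
  have a: "?a \<in> F 0" "eps ?a = 0" using BI.proj(1) KA_iff by blast+
  have "cnjv ?b \<in> sum_over BI KA" by (rule cnjv_KB[OF BI.proj(1)])
  then have b: "cnjv ?b \<in> F 0" "eps ?b = 0" unfolding KA_iff by simp_all
  have "B e w = B e (?a + ?b + pc w *s tw)" by (rule arg_cong[OF W1_parts[OF assms]])
  also have "\<dots> = pc w"
    using a b B_e_KA[OF a] B_e_cnjv_KA[OF b] by (simp add: B_add_right B_scale_right B_tw)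
  finally show ?thesis .
qed

lemma D_eps: "eps (D *v v) = 0"
  by (rule LC_sum_over_eps_tw(1)) (use horizontal in \<open>simp only: D_def\<close>)

lemma t_eps: "eps t = 0" "cnjv t \<in> F 0" "t \<in> F (-1)"
  using t_H by (simp_all add: H_def)

text \<open>The pairing of \<open>g z *v e\<close> with \<open>g z *v v\<close> vanishes
  identically. In its derivative the term \<open>B (D *v e) v\<close> reduces to
  \<open>Q v t\<close>, because \<open>tw\<close> pairs to zero with W (-1), and
  \<open>B e (D *v v)\<close> is the \<open>tw\<close>-coordinate by \<open>B_e\<close>.\<close>

lemma pc_D:
  assumes v: "v \<in> F 0" "eps v = 0"
  shows "pc (D *v v) = - Q v t"
proof -
  have W: "eps (g z *v v) = 0" if "z \<in> ball z0 R" for z using g_eps_tw(1)[OF that] v(2) by simp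
  have "((\<lambda>z. B (g z *v e) (g z *v v)) has_field_derivative B (D *v e) (g z0 *v v) + B (g z0 *v e) (D *v v)) (at z0)"
    by (rule bilinear_deriv[OF B g_deriv g_deriv W D_eps open_ball z0_ball])
  then have d: "((\<lambda>z. B (g z *v e) (g z *v v)) has_field_derivative B (D *v e) v + B e (D *v v)) (at z0)"
    by (simp add: g_z0)
  have "((\<lambda>z. 0) has_field_derivative B (D *v e) v + B e (D *v v)) (at z0)"
    by (rule has_field_derivative_transform_within_open[OF d open_ball z0_ball])
      (simp add: B_isotropic[OF _ e_F v] g_def)
  then have z: "B (D *v e) v + B e (D *v v) = 0" using DERIV_unique DERIV_const by blast
  obtain m where m: "D *v e = t + m *s tw" using D_e by blast
  have "B (D *v e) v = B t v + m * B tw v" unfolding m using v(2) by (simp add: B_add_left B_scale_left)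
  also have "B t v = Q v t" by (rule B_Q[OF t_eps(1) v(2)])
  also have "B tw v = 0" using B_Q[of tw v] Q_tw[OF v(2)] v(2) by simp
  finally have "B (D *v e) v = Q v t" by simp
  then have "Q v t + pc (D *v v) = 0" using z B_e[OF D_eps[of v]] by simp
  then show ?thesis by (simp add: eq_neg_iff_add_eq_0 add.commute)
qed

definition r :: real where "r = Re (inverse \<i> * Q t (cnjv t))"

lemma Q_t: "Q t (cnjv t) = \<i> * of_real r" and r: "r \<ge> 0" "r = 0 \<longleftrightarrow> t = 0"
proof -
  have "(\<exists>r'\<ge>0. inverse \<i> * Q t (cnjv t) = of_real r' \<and> (r' = 0 \<longleftrightarrow> t = 0))"
  proof (cases "t = 0")
    case True
    have "Q 0 0 = 0" by (rule Q_alt) simp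
    then show ?thesis using True by (intro exI[of _ 0]) simp
  next
    case False
    then show ?thesis using Q_positive[OF t_eps(3,1,2)] by (metis less_eq_real_def less_irrefl)
  qed
  then obtain r' where r': "r' \<ge> 0" "inverse \<i> * Q t (cnjv t) = of_real r'" "r' = 0 \<longleftrightarrow> t = 0" by blast
  have "r = r'" unfolding r_def r'(2) by simp
  then show "r \<ge> 0" "r = 0 \<longleftrightarrow> t = 0" using r' by simp_all
  have "\<i> * (inverse \<i> * Q t (cnjv t)) = \<i> * of_real r" using r'(2) \<open>r = r'\<close> by simp
  then show "Q t (cnjv t) = \<i> * of_real r" by simp
qed

text \<open>In weight -1 only type (0, -1) can have a nonzero image under \<open>gam\<close>, and
  there \<open>gam\<close> is v \<mapsto> - Q(v, t) times \<open>tw\<close>. Thus the dual invariant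
  is the functional that self-duality attaches to \<open>t\<close>.\<close>

lemma gam_W1_zero_iff: "(\<forall>v \<in> wfil eps tw (-1). gam *v v = 0) \<longleftrightarrow> (\<forall>v \<in> H 0. Q v t = 0)"
proof
  assume "\<forall>v \<in> wfil eps tw (-1). gam *v v = 0"
  then show "\<forall>v \<in> H 0. Q v t = 0"
    using D_H0 pc_D by (fastforce simp: wfil_simps H_def)
next
  assume Q: "\<forall>v \<in> H 0. Q v t = 0"
  have H: "gam *v v = 0" if "v \<in> H q" for v q
  proof (cases "q = 0")
    case True
    have "pc (D *v v) = 0" using pc_D[of v] Q that True by (simp add: H_def)
    then show ?thesis using D_H0[of v] that True by simp
  qed (rule gam_H[OF that])
  show "\<forall>v \<in> wfil eps tw (-1). gam *v v = 0"
  proof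
    fix v assume "v \<in> wfil eps tw (-1)"
    then have "eps v = 0" by (simp add: wfil_simps)
    from span_W1[OF this] obtain h b where h: "\<forall>q. h q \<in> H q" and v: "v = b *s tw + (\<Sum>q\<in>{-N..N}. h q)"
      by (elim exE conjE) (rule that)
    have "gam *v v = b *s (gam *v tw) + (\<Sum>q\<in>{-N..N}. gam *v h q)"
      unfolding v by (simp add: matrix_vector_right_distrib vector_scalar_commute vec.linear_sum)
    also have "(\<Sum>q\<in>{-N..N}. gam *v h q) = 0" by (rule sum.neutral) (use h H in blast)
    finally show "gam *v v = 0" by (simp add: gam_tw)
  qed
qed

definition PA :: "complex ^ 'n ^ 'n" where "PA = BI.pmat KA"
definition PB :: "complex ^ 'n ^ 'n" where "PB = BI.pmat KB"

text \<open>The map carrying the decomposition of \<open>W (-1)\<close> into \<open>F 0\<close>, its conjugate and \<open>tw\<close> at \<open>z0\<close> to that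
  at \<open>z\<close>.\<close>

definition M :: "complex \<Rightarrow> complex ^ 'n ^ 'n" where
  "M z = g z ** PA + cnjm (g z) ** PB + (mat 1 - PA - PB)"

text \<open>The constant \<open>e - cnjv e\<close> is subtracted so that \<open>y\<close> vanishes
  at \<open>z0\<close>, as \<open>has_jet2_linear_system\<close> demands; it returns as the term
  \<open>- ea\<close> when the splitting is recovered from the solution.\<close>

definition y :: "complex \<Rightarrow> complex ^ 'n" where
  "y z = (g z *v e - e) - cnjv (g z *v e - e)"

lemma M_jet: "has_jet2 (\<lambda>z. M z $ i $ j) ((D ** PA + cnjm D ** PB) $ i $ j)
  ((cscale_matrix \<i> (D ** PA) - cscale_matrix \<i> (cnjm D ** PB)) $ i $ j) 0 z0"
proof -
  have c: "has_jet2 (\<lambda>z. cnj (g z $ i $ k)) (cnj (D $ i $ k)) (- \<i> * cnj (D $ i $ k)) 0 z0" for k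
    using has_jet2_cnj[OF g_entry_jet[of i k]] by simp
  have "has_jet2 (\<lambda>z. (\<Sum>k\<in>UNIV. g z $ i $ k * PA $ k $ j) + (\<Sum>k\<in>UNIV. cnj (g z $ i $ k) * PB $ k $ j)
      + (mat 1 - PA - PB) $ i $ j)
    ((\<Sum>k\<in>UNIV. D $ i $ k * PA $ k $ j) + (\<Sum>k\<in>UNIV. cnj (D $ i $ k) * PB $ k $ j) + 0)
    ((\<Sum>k\<in>UNIV. \<i> * D $ i $ k * PA $ k $ j) + (\<Sum>k\<in>UNIV. - \<i> * cnj (D $ i $ k) * PB $ k $ j) + 0)
    ((\<Sum>k\<in>UNIV. 0 * PA $ k $ j) + (\<Sum>k\<in>UNIV. 0 * PB $ k $ j) + 0) z0"
    by (intro has_jet2_add has_jet2_sum has_jet2_mult_const g_entry_jet c has_jet2_const finite)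
  moreover have "(\<Sum>k\<in>UNIV. \<i> * D $ i $ k * PA $ k $ j) = \<i> * (\<Sum>k\<in>UNIV. D $ i $ k * PA $ k $ j)"
    "(\<Sum>k\<in>UNIV. - \<i> * cnj (D $ i $ k) * PB $ k $ j) = - (\<i> * (\<Sum>k\<in>UNIV. cnj (D $ i $ k) * PB $ k $ j))"
    by (simp_all only: sum_distrib_left mult.assoc mult_minus_left sum_negf)
  ultimately show ?thesis
    by (simp add: M_def matrix_matrix_mult_def cnjm_def cscale_matrix_def)
qed

lemma y_jet: "has_jet2 (\<lambda>z. y z $ i) ((D *v e - cnjv (D *v e)) $ i) ((\<i> *s (D *v e + cnjv (D *v e))) $ i) 0 z0"
proof -
  have k: "has_jet2 (\<lambda>z. (g z *v e) $ i - e $ i) ((D *v e) $ i) (\<i> * (D *v e) $ i) 0 z0"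
    using has_jet2_diff[OF g_jet[of e i] has_jet2_const[of "e $ i"]] by simp
  from has_jet2_diff[OF k has_jet2_cnj[OF k]] show ?thesis
    by (simp add: y_def cnjv_def distrib_left)
qed

lemma M_z0: "M z0 = mat 1"
proof -
  have "M z0 *v v = mat 1 *v v" for v
    by (simp add: M_def g_z0 matrix_vector_mult_add_rdistrib matrix_vector_mult_diff_rdistrib cnjm_mult
        matrix_vector_mul_assoc[symmetric])
  then show ?thesis by (simp add: matrix_eq)
qed

lemma y_z0: "y z0 = 0" by (simp add: y_def g_z0)

lemma t_parts: "cnjv t \<in> sum_over BI KA" "t \<in> sum_over BI KB"
proof -
  show c: "cnjv t \<in> sum_over BI KA" unfolding KA_iff using t_eps by simp
  show "t \<in> sum_over BI KB" using cnjv_KA[OF c] by simp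
qed

lemma delta_of_solution:
  assumes z: "z \<in> ball z0 R" and x: "M z *v x = y z"
  shows "pc x - ea = 2 * \<i> * of_real (deligne_delta eps tw Q (Fz z))"
proof -
  interpret Z: biext_mhs eps tw Q "Fz z"
    by unfold_locales (rule fibres[OF z])
  let ?a = "BI.proj KA x" and ?b = "BI.proj KB x"
  have Mx: "M z *v x = g z *v ?a + cnjv (g z *v cnjv ?b) + (x - ?a - ?b)"
    by (simp add: M_def matrix_vector_mult_add_rdistrib matrix_vector_mult_diff_rdistrib cnjm_mult
        matrix_vector_mul_assoc[symmetric] PA_def PB_def BI.pmat)
  have "eps (y z) = 0" by (simp add: y_def g_eps_tw[OF z])
  then have "eps x = 0" using Mx x by (simp add: g_eps_tw[OF z])
  then have "x = ?a + ?b + pc x *s tw" by (rule W1_parts)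
  then have "x - ?a - ?b = pc x *s tw" by (simp add: diff_eq_eq add_ac)
  then have eq: "y z = g z *v ?a + cnjv (g z *v cnjv ?b) + pc x *s tw" using Mx x by simp
  have a: "?a \<in> F 0" "eps ?a = 0" using BI.proj(1)[where K = KA and v = x] unfolding KA_iff by blast+
  have b: "cnjv ?b \<in> F 0" "eps (cnjv ?b) = 0"
    using cnjv_KB[OF BI.proj(1)[where K = KB and v = x]] unfolding KA_iff by blast+
  have in_F: "g z *v v \<in> (*v) (mexp (G z)) ` F 0" if "v \<in> F 0" for v
    unfolding g_def using that by (rule imageI)
  have e1: "g z *v (e - ?a) = g z *v e - g z *v ?a" and e2: "g z *v (e + cnjv ?b) = g z *v e + g z *v cnjv ?b"
    by (simp_all add: matrix_vector_mult_diff_distrib matrix_vector_right_distrib)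
  have "y z = g z *v e - cnjv (g z *v e) + ea *s tw" by (simp add: y_def cnjv_e)
  with eq have "g z *v e - g z *v ?a = cnjv (g z *v e) + cnjv (g z *v cnjv ?b) + pc x *s tw - ea *s tw"
    by (simp add: algebra_simps)
  \<comment> \<open>Two vectors of \<open>Fz z 0\<close> with \<open>eps\<close>-value 1 appear, the
    images under \<open>g z\<close> of \<open>e - ?a\<close> and of \<open>e + cnjv ?b\<close>; up
    to a multiple of \<open>tw\<close> each is the conjugate of the other, which is the input of
    \<open>deligne_deltaI\<close>.\<close>
  then have "g z *v (e - ?a) = cnjv (g z *v (e + cnjv ?b)) + (pc x - ea) *s tw"
    unfolding e1 e2 by (simp add: vec.scale_left_diff_distrib add_diff_eq)
  then show ?thesis
    by (rule Z.deligne_deltaI(1)[rotated 3])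
      (use a b e_F in \<open>auto intro!: in_F simp: g_eps_tw[OF z]\<close>)
qed

lemma laplacian_delta:
  "has_laplacian (\<lambda>z. deligne_delta eps tw Q (Fz z)) (4 * r) z0"
proof -
  let ?Mx = "D ** PA + cnjm D ** PB"
  let ?My = "cscale_matrix \<i> (D ** PA) - cscale_matrix \<i> (cnjm D ** PB)"
  let ?yx = "D *v e - cnjv (D *v e)" and ?yy = "\<i> *s (D *v e + cnjv (D *v e))"
  let ?L = "- 2 *s (?Mx *v ?yx + ?My *v ?yy)"
  have "\<exists>x. eventually (\<lambda>z. M z *v x z = y z) (nhds z0) \<and>
    (\<forall>i. has_jet2 (\<lambda>z. x z $ i) (?yx $ i) (?yy $ i) (?L $ i) z0)"
    by (rule has_jet2_linear_system[OF M_jet y_jet M_z0 y_z0])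
  then obtain x where x: "eventually (\<lambda>z. M z *v x z = y z) (nhds z0)"
    and j: "\<And>i. has_jet2 (\<lambda>z. x z $ i) (?yx $ i) (?yy $ i) (?L $ i) z0" by blast
  obtain m where De: "D *v e = t + m *s tw" using D_e by blast
  have yx: "?yx = (- 1) *s cnjv t + t + (m - cnj m) *s tw"
    unfolding De by (simp add: vec.scale_left_diff_distrib)
  have yy: "?yy = \<i> *s cnjv t + \<i> *s t + (\<i> * (m + cnj m)) *s tw"
    unfolding De by (simp add: vec.scale_right_distrib vec.scale_left_distrib distrib_left add_ac)
  have KA: "c *s cnjv t \<in> sum_over BI KA" and KB: "c *s t \<in> sum_over BI KB" for c
    using t_parts by (simp_all add: vec.subspace_scale[OF BI.sum_over_subspace])
  \<comment> \<open>The parts are read off from the types: \<open>cnjv t\<close> belongs to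
    \<open>KA\<close> and \<open>t\<close> to \<open>KB\<close>.\<close>
  have pA: "PA *v ?yx = (- 1) *s cnjv t" "PA *v ?yy = \<i> *s cnjv t"
    unfolding yx yy PA_def BI.pmat by (rule parts_unique(1)[OF KA t_parts(2)], rule parts_unique(1)[OF KA KB])
  have pB: "PB *v ?yx = t" "PB *v ?yy = \<i> *s t"
    unfolding yx yy PB_def BI.pmat by (rule parts_unique(2)[OF KA t_parts(2)], rule parts_unique(2)[OF KA KB])
  let ?w = "D *v cnjv t"
  have Mx: "?Mx *v ?yx = (- 1) *s ?w + cnjv ?w"
    unfolding matrix_vector_mult_add_rdistrib matrix_vector_mul_assoc[symmetric] pA pB cnjm_mult
      vector_scalar_commute ..
  \<comment> \<open>Both directions contribute the same vector: the factor \<i> of the y-derivative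
    of \<open>g\<close> and the factor \<i> in \<open>?yy\<close> multiply to -1, and to 1 in the
    conjugate part.\<close>
  have "?My *v ?yy = \<i> *s (D *v (\<i> *s cnjv t)) - \<i> *s (cnjm D *v (\<i> *s t))"
    unfolding matrix_vector_mult_diff_rdistrib cscale_matrix_mult matrix_vector_mul_assoc[symmetric] pA pB ..
  also have "\<dots> = (- 1) *s ?w + cnjv ?w"
    by (simp add: vector_scalar_commute cnjm_mult)
  finally have My: "?My *v ?yy = (- 1) *s ?w + cnjv ?w" .
  have w: "eps ?w = 0" by (rule D_eps)
  have pw: "pc ?w = \<i> * of_real r"
    using pc_D[of "cnjv t"] t_eps Q_antisym[of t "cnjv t"] Q_t by simp
  \<comment> \<open>Each direction contributes \<open>cnj (pc ?w) - pc ?w\<close>, which is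
    \<open>- 2 * \<i>\<close> times \<open>r\<close>; two of them and the factor -2 of the linear
    system give \<open>8 * \<i>\<close> times \<open>r\<close>.\<close>
  have "pc ?L = - 2 * ((- 1) * pc ?w + cnj (pc ?w) + ((- 1) * pc ?w + cnj (pc ?w)))"
    unfolding Mx My by (simp only: pc_scale pc_add pc_cnjv[OF w])
  then have L: "pc ?L = 8 * \<i> * of_real r" unfolding pw by simp
  have "has_jet2 (\<lambda>z. \<Sum>i\<in>UNIV. x z $ i * pc (axis i 1)) (\<Sum>i\<in>UNIV. ?yx $ i * pc (axis i 1))
    (\<Sum>i\<in>UNIV. ?yy $ i * pc (axis i 1)) (\<Sum>i\<in>UNIV. ?L $ i * pc (axis i 1)) z0"
    by (rule has_jet2_sum[OF finite]) (rule has_jet2_mult_const[OF j])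
  then have "has_jet2 (\<lambda>z. pc (x z)) (pc ?yx) (pc ?yy) (pc ?L) z0" by (simp only: pc_coordinates[symmetric])
  \<comment> \<open>Division by \<open>2 * \<i>\<close> recovers the splitting from the
    \<open>tw\<close>-coordinate and turns the Laplacian into \<open>4 * r\<close>.\<close>
  from has_jet2_mult_const[OF has_jet2_diff[OF this has_jet2_const[of ea]], of "- \<i> / 2"]
  have "has_jet2 (\<lambda>z. (pc (x z) - ea) * (- \<i> / 2)) ((pc ?yx - 0) * (- \<i> / 2)) ((pc ?yy - 0) * (- \<i> / 2))
    ((pc ?L - 0) * (- \<i> / 2)) z0" .
  moreover have "eventually (\<lambda>z. (pc (x z) - ea) * (- \<i> / 2) =
      of_real (deligne_delta eps tw Q (Fz z))) (nhds z0)"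
    using x eventually_ball
  proof eventually_elim
    case (elim z)
    show ?case unfolding delta_of_solution[OF elim(2,1)] by (simp add: complex_eq_iff)
  qed
  ultimately have "has_jet2 (\<lambda>z. of_real (deligne_delta eps tw Q (Fz z)))
    ((pc ?yx - 0) * (- \<i> / 2)) ((pc ?yy - 0) * (- \<i> / 2)) ((pc ?L - 0) * (- \<i> / 2)) z0"
    by (rule has_jet2_cong)
  from has_jet2_imp_has_laplacian[OF this] show ?thesis unfolding L by simp
qed

lemma e_unique: "(THE v. v \<in> Ipq eps tw F (0, 0) \<and> eps v = 1) = e"
  unfolding Ipq_eq BI_00 by (rule the_equality) (auto intro: range_eqI[of _ _ 1])

text \<open>The first invariant is \<open>t\<close> itself, and the second vanishes as soon as
  \<open>t\<close> does, so the conjunction amounts to \<open>t = 0\<close>, which is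
  \<open>r = 0\<close> by the Riemann relation.\<close>

lemma invariants_vanish_iff:
  "4 * r = 0 \<longleftrightarrow> gam *v (THE v. v \<in> Ipq eps tw F (0, 0) \<and> eps v = 1) = 0 \<and>
    (\<forall>v \<in> wfil eps tw (-1). gam *v v = 0)"
proof -
  have "Q v t = 0" if "t = 0" "v \<in> H 0" for v
  proof -
    have "eps v = 0" using that(2) by (simp add: H_def)
    then have "B (0 *s t) v = 0 * B t v" by (rule B_scale_left)
    then show ?thesis using that(1) B_Q[OF t_eps(1) \<open>eps v = 0\<close>] by simp
  qed
  then show ?thesis unfolding gam_W1_zero_iff e_unique t_def[symmetric] using r(2) by auto
qed

end

subsection \<open>Variations over a curve\<close>

text \<open>A nonzero \<open>v\<close> with conjugate in \<open>F 0\<close> is not a multiple of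
  \<open>tw\<close>, so it is nonzero in gr (-1), where it has type (-1, 0).\<close>

lemma (in biext_mhs) polarized_positive:
  assumes pol: "polarized eps tw Q F"
    and v: "v \<in> F (-1)" "eps v = 0" "cnjv v \<in> F 0" "v \<noteq> 0"
  shows "\<exists>r>0. inverse \<i> * Q v (cnjv v) = of_real r"
proof -
  have gr: "x \<in> grF eps tw F (-1) p" if "x \<in> F p" "eps x = 0" for x p
    unfolding grF_m1 using that by (intro bexI[of _ x] conjI exI[of _ 0]) simp_all
  have "v \<in> cnjv ` grF eps tw F (-1) 0"
    by (rule rev_image_eqI[OF gr[OF v(3)]]) (simp_all add: v(2))
  moreover have "v \<notin> wfil eps tw (-2)"
  proof
    assume "v \<in> wfil eps tw (-2)"
    then obtain b where b: "v = b *s tw" by (auto simp: wfil_simps)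
    then have "cnj b *s tw \<in> F 0" using v(3) by simp
    then have "cnj b = 0" by (rule tw_F0) simp
    then show False using v(4) b by simp
  qed
  ultimately have "v \<in> grF eps tw F (-1) (-1) \<inter> cnjv ` grF eps tw F (-1) 0 - wfil eps tw (-2)"
    using gr[OF v(1,2)] by blast
  moreover have "\<forall>u \<in> grF eps tw F (-1) (-1) \<inter> cnjv ` grF eps tw F (-1) 0 - wfil eps tw (-2).
      \<exists>r>0. \<i> powi (-1 - 0) * Q u (cnjv u) = of_real r"
  proof -
    have "\<forall>p q. p + q = -1 \<longrightarrow>
        (\<forall>u \<in> grF eps tw F (-1) p \<inter> cnjv ` grF eps tw F (-1) q - wfil eps tw (-2).
           \<exists>r>0. \<i> powi (p - q) * Q u (cnjv u) = of_real r)"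
      using pol unfolding polarized_def by blast
    from this[THEN spec[of _ "-1"], THEN spec[of _ 0]] show ?thesis by simp
  qed
  ultimately have "\<exists>r>0. \<i> powi (-1 - 0) * Q v (cnjv v) = of_real r" by blast
  then show ?thesis by (simp add: power_int_minus)
qed

lemma (in biext_iso) polarized_positive_transport:
  assumes "mixed_hodge eps tw F" "polarized eps tw Q F"
    and v: "v \<in> (*v) g ` F (-1)" "eps v = 0" "cnjv v \<in> (*v) g ` F 0" "v \<noteq> 0"
  shows "\<exists>r>0. inverse \<i> * Q v (cnjv v) = of_real r"
proof -
  interpret A: biext_mhs eps tw Q F by unfold_locales (rule assms)
  obtain w where w: "w \<in> F (-1)" "v = g *v w" using v(1) by blast
  obtain u where u: "u \<in> F 0" "cnjv v = g *v u" using v(3) by blast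
  have "g *v cnjv w = g *v u" using u(2) by (simp add: w(2) g_cnjv)
  then have cw: "cnjv w = u" using bij_is_inj[OF g_bij] by (simp add: inj_eq)
  have ew: "eps w = 0" using v(2) w(2) by simp
  have "w \<noteq> 0" using v(4) w(2) by auto
  then have "\<exists>r>0. inverse \<i> * Q w (cnjv w) = of_real r"
    using A.polarized_positive[OF assms(2) w(1) ew] cw u(1) by simp
  moreover have "Q v (cnjv v) = Q w (cnjv w)"
    unfolding w(2) g_cnjv by (rule g_Q) (simp_all add: ew)
  ultimately show ?thesis by simp
qed

lemma chart_neighbourhood:
  assumes "curve S U chart" "openin S N" "s \<in> N" "N \<subseteq> U i"
  shows "\<exists>r>0. \<forall>z \<in> ball (chart i s) r. chart_inv U chart i z \<in> N"
proof -
  have o: "openin S (U i)" "open (chart i ` U i)"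
    and h: "homeomorphic_map (subtopology S (U i)) (top_of_set (chart i ` U i)) (chart i)"
    using assms(1) unfolding curve_def by blast+
  have "openin (subtopology S (U i)) N"
    using assms(2,4) by (simp add: openin_subset_topspace_eq openin_open_subtopology[OF o(1)])
  then have "openin (top_of_set (chart i ` U i)) (chart i ` N)"
    using homeomorphic_imp_open_map[OF h] by (simp add: open_map_def)
  then have "open (chart i ` N)" using o(2) openin_open_trans by blast
  then obtain r where r: "r > 0" "ball (chart i s) r \<subseteq> chart i ` N"
    using assms(3) by (meson imageI open_contains_ball)
  have "U i \<subseteq> topspace S" using o(1) by (rule openin_subset)
  then have "inj_on (chart i) (U i)"
    using homeomorphic_imp_injective_map[OF h] by (simp add: Int_absorb1)
  then have "chart_inv U chart i (chart i n) = n" if "n \<in> N" for n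
    unfolding chart_inv_def using that assms(4) by (intro inv_into_f_f) blast+
  then show ?thesis using r by (intro exI[of _ r]) auto
qed

text \<open>All smaller radii are allowed so that two lifts, or a lift and a self-duality pairing,
  can be restricted to a common disc.\<close>

lemma local_lift_germ:
  assumes split: "biext_split eps tw Q (flat_fil frame Fil i s) e ea"
    and lift: "local_lift U chart eps tw Q frame Fil i s \<Gamma>"
  shows "\<exists>r>0. \<forall>R. 0 < R \<and> R \<le> r \<longrightarrow>
    biext_germ eps tw Q (flat_fil frame Fil i s) e ea \<Gamma> (chart i s) R \<and>
    (\<forall>z \<in> ball (chart i s) R. \<forall>p. flat_fil frame Fil i (chart_inv U chart i z) p
       = (*v) (mexp (\<Gamma> z)) ` flat_fil frame Fil i s p)"
proof -
  interpret biext_split eps tw Q "flat_fil frame Fil i s" e ea by (rule split)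
  obtain r where r: "r > 0" "\<And>k l. (\<lambda>z. \<Gamma> z $ k $ l) holomorphic_on ball (chart i s) r"
    "\<Gamma> (chart i s) = 0"
    "\<And>z. z \<in> ball (chart i s) r \<Longrightarrow> \<Gamma> z \<in> sum_over (lie_comp eps tw Q (flat_fil frame Fil i s)) {(a, b). a < 0}"
    "\<And>z p. z \<in> ball (chart i s) r \<Longrightarrow> flat_fil frame Fil i (chart_inv U chart i z) p
                = (*v) (mexp (\<Gamma> z)) ` flat_fil frame Fil i s p"
    using lift unfolding local_lift_def by blast
  show ?thesis
  proof (intro exI[of _ r] conjI allI impI ballI)
    fix R assume R: "0 < R \<and> R \<le> r"
    then have sub: "ball (chart i s) R \<subseteq> ball (chart i s) r" by auto
    show "biext_germ eps tw Q (flat_fil frame Fil i s) e ea \<Gamma> (chart i s) R"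
    proof unfold_locales
      show "(\<lambda>z. \<Gamma> z $ k $ l) holomorphic_on ball (chart i s) R" for k l
        by (rule holomorphic_on_subset[OF r(2) sub])
      show "\<Gamma> z \<in> sum_over LC {(a, b). a < 0}" if "z \<in> ball (chart i s) R" for z
        using r(4) sub that by blast
    qed (use R r(3) in auto)
    show "flat_fil frame Fil i (chart_inv U chart i z) p = (*v) (mexp (\<Gamma> z)) ` flat_fil frame Fil i s p"
      if "z \<in> ball (chart i s) R" for z p
      using r(5) sub that by blast
  qed (rule r(1))
qed

text \<open>All lifts at a point have the same derivative, so the unique description in the
  definition may be evaluated on any of them, in particular on a horizontal one.\<close>

lemma gamma_m1_0_eq:
  assumes split: "biext_split eps tw Q (flat_fil frame Fil i s) e ea"
    and lift: "local_lift U chart eps tw Q frame Fil i s \<Gamma>"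
  shows "gamma_m1_0 U chart eps tw Q frame Fil i s =
    component (lie_comp eps tw Q (flat_fil frame Fil i s)) (-1, 0) (matrix_deriv \<Gamma> (chart i s))"
proof -
  have "matrix_deriv \<Gamma>' (chart i s) = matrix_deriv \<Gamma> (chart i s)"
    if lift': "local_lift U chart eps tw Q frame Fil i s \<Gamma>'" for \<Gamma>'
  proof -
    obtain r where r: "r > 0" "\<And>R. 0 < R \<and> R \<le> r \<Longrightarrow>
      biext_germ eps tw Q (flat_fil frame Fil i s) e ea \<Gamma> (chart i s) R \<and>
      (\<forall>z \<in> ball (chart i s) R. \<forall>p. flat_fil frame Fil i (chart_inv U chart i z) p
       = (*v) (mexp (\<Gamma> z)) ` flat_fil frame Fil i s p)"
      using local_lift_germ[OF split lift] by blast
    obtain r' where r': "r' > 0" "\<And>R. 0 < R \<and> R \<le> r' \<Longrightarrow>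
      biext_germ eps tw Q (flat_fil frame Fil i s) e ea \<Gamma>' (chart i s) R \<and>
      (\<forall>z \<in> ball (chart i s) R. \<forall>p. flat_fil frame Fil i (chart_inv U chart i z) p
       = (*v) (mexp (\<Gamma>' z)) ` flat_fil frame Fil i s p)"
      using local_lift_germ[OF split lift'] by blast
    have m: "0 < min r r' \<and> min r r' \<le> r" "0 < min r r' \<and> min r r' \<le> r'" using r(1) r'(1) by auto
    show ?thesis
    proof (rule germ_deriv_unique)
      show "biext_germ eps tw Q (flat_fil frame Fil i s) e ea \<Gamma>' (chart i s) (min r r')"
        using r'(2)[OF m(2)] by (rule conjunct1)
      show "biext_germ eps tw Q (flat_fil frame Fil i s) e ea \<Gamma> (chart i s) (min r r')"
        using r(2)[OF m(1)] by (rule conjunct1)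
      show "(*v) (mexp (\<Gamma>' z)) ` flat_fil frame Fil i s p = (*v) (mexp (\<Gamma> z)) ` flat_fil frame Fil i s p"
        if "z \<in> ball (chart i s) (min r r')" for z p
        using r(2)[OF m(1), THEN conjunct2, rule_format, OF that, of p]
          r'(2)[OF m(2), THEN conjunct2, rule_format, OF that, of p] by simp
    qed
  qed
  then have "(THE D. \<exists>\<Gamma>. local_lift U chart eps tw Q frame Fil i s \<Gamma> \<and> D = matrix_deriv \<Gamma> (chart i s))
      = matrix_deriv \<Gamma> (chart i s)"
    using lift by (intro the_equality) blast+
  then show ?thesis by (simp add: gamma_m1_0_def)
qed

lemma delta_laplacian:
  assumes curve: "curve S U chart"
    and var: "biext_variation S U chart eps tw Q frame Fil"
    and dual: "self_dual S U eps tw Q frame Fil"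
    and s: "s \<in> U i"
  shows "\<exists>L\<ge>0. has_laplacian ((\<lambda>s. deligne_delta eps tw Q (Fil s)) \<circ> chart_inv U chart i) L (chart i s) \<and>
    (L = 0 \<longleftrightarrow> inf_invariant U chart eps tw Q frame Fil i s = 0 \<and>
      dual_inf_invariant_vanishes U chart eps tw Q frame Fil i s)"
proof -
  interpret biext_lat eps tw Q by unfold_locales (use var in \<open>simp add: biext_variation_def\<close>)
  have top: "s' \<in> topspace S" if "s' \<in> U i" for s' using curve that unfolding curve_def by auto
  have mh: "mixed_hodge eps tw (Fil s')" and pol: "polarized eps tw Q (Fil s')" if "s' \<in> U i" for s'
    using var top[OF that] unfolding biext_variation_def by blast+
  have iso: "biext_iso eps tw Q (frame i s')" if "s' \<in> U i" for s'
    using var that unfolding biext_variation_def local_system_def by unfold_locales blast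
  have flat: "flat_fil frame Fil i s' = (\<lambda>p. (*v) (frame i s') ` Fil s' p)" for s'
    by (rule ext) (simp add: flat_fil_def)
  have mh_flat: "mixed_hodge eps tw (flat_fil frame Fil i s')" if "s' \<in> U i" for s'
    unfolding flat by (rule biext_iso.mixed_hodge_transport[OF iso[OF that] mh[OF that]])
  have delta_flat: "deligne_delta eps tw Q (flat_fil frame Fil i s') = deligne_delta eps tw Q (Fil s')" if "s' \<in> U i" for s'
    unfolding flat by (rule biext_iso.deligne_delta_transport[OF iso[OF that] mh[OF that]])
  let ?F = "flat_fil frame Fil i s"
  obtain e ea where split: "biext_split eps tw Q ?F e ea" using mixed_hodge_biext_split[OF mh_flat[OF s]] by blast
  obtain \<Gamma> where lift: "local_lift U chart eps tw Q frame Fil i s \<Gamma>"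
    and hor: "matrix_deriv \<Gamma> (chart i s) \<in> sum_over (lie_comp eps tw Q ?F) {(a, b). a = -1}"
    using var s unfolding biext_variation_def by blast
  obtain r where r: "r > 0" "\<And>R. 0 < R \<and> R \<le> r \<Longrightarrow>
      biext_germ eps tw Q ?F e ea \<Gamma> (chart i s) R \<and>
      (\<forall>z \<in> ball (chart i s) R. \<forall>p. flat_fil frame Fil i (chart_inv U chart i z) p = (*v) (mexp (\<Gamma> z)) ` ?F p)"
    using local_lift_germ[OF split lift] by blast
  obtain Nb B where Nb_props: "openin S Nb" "s \<in> Nb" "Nb \<subseteq> U i" and pairing: "bilinear_on UNIV (wfil eps tw (-1)) B"
    "\<forall>v \<in> int_lattice. \<forall>w \<in> wfil eps tw (-1) \<inter> int_lattice. B v w \<in> \<int>"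
    "\<forall>x \<in> wfil eps tw (-1). \<forall>w \<in> wfil eps tw (-1). B x w = Q w x" "\<forall>v. B v tw = eps v"
    and iso_B: "\<forall>s' \<in> Nb. \<forall>p. \<forall>v \<in> flat_fil frame Fil i s' p.
           \<forall>w \<in> flat_fil frame Fil i s' (-p) \<inter> wfil eps tw (-1). B v w = 0"
    using bspec[OF spec[OF dual[unfolded self_dual_def], of i] s] by blast
  obtain r' where r': "r' > 0" "\<And>z. z \<in> ball (chart i s) r' \<Longrightarrow> chart_inv U chart i z \<in> Nb"
    using chart_neighbourhood[where i = i, OF curve Nb_props] by blast
  define R where "R = min r r'"
  have R_le: "0 < R \<and> R \<le> r" "R \<le> r'" using r(1) r'(1) by (auto simp: R_def)
  interpret biext_germ eps tw Q ?F e ea \<Gamma> "chart i s" R using r(2)[OF R_le(1)] by (rule conjunct1)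
  have fib: "flat_fil frame Fil i (chart_inv U chart i z) = (\<lambda>p. (*v) (mexp (\<Gamma> z)) ` ?F p)"
    and inN: "chart_inv U chart i z \<in> Nb" if "z \<in> ball (chart i s) R" for z
  proof -
    show "flat_fil frame Fil i (chart_inv U chart i z) = (\<lambda>p. (*v) (mexp (\<Gamma> z)) ` ?F p)"
      using r(2)[OF R_le(1)] that by blast
    show "chart_inv U chart i z \<in> Nb" using r'(2)[of z] that R_le(2) by simp
  qed
  interpret biext_dual eps tw Q ?F e ea \<Gamma> "chart i s" R B
  proof unfold_locales
    fix z assume z: "z \<in> ball (chart i s) R"
    have zU: "chart_inv U chart i z \<in> U i" using inN[OF z] Nb_props(3) by blast
    show "mixed_hodge eps tw (\<lambda>p. (*v) (mexp (\<Gamma> z)) ` ?F p)"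
      using mh_flat[OF zU] unfolding fib[OF z] .
    fix v w assume v: "v \<in> ?F 0" and w: "w \<in> ?F 0" "eps w = 0"
    have "eps (mexp (\<Gamma> z) *v w) = 0" using g_eps_tw(1)[OF z, of w] w(2) by (simp add: g_def)
    then have "mexp (\<Gamma> z) *v w \<in> (*v) (mexp (\<Gamma> z)) ` ?F (- 0) \<inter> wfil eps tw (-1)"
      using w(1) by (simp add: wfil_simps)
    then show "B (mexp (\<Gamma> z) *v v) (mexp (\<Gamma> z) *v w) = 0"
      using bspec[OF bspec[OF spec[OF bspec[OF iso_B inN[OF z]], of 0]]] v unfolding fib[OF z] by blast
  next
    show "matrix_deriv \<Gamma> (chart i s) \<in> sum_over LC {(a, b). a = -1}" by (rule hor)
    show "\<exists>r>0. inverse \<i> * Q v (cnjv v) = of_real r"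
      if "v \<in> ?F (-1)" "eps v = 0" "cnjv v \<in> ?F 0" "v \<noteq> 0" for v
      using biext_iso.polarized_positive_transport[OF iso[OF s] mh[OF s] pol[OF s]] that unfolding flat by blast
  qed (use pairing in \<open>auto simp: wfil_simps\<close>)
  \<comment> \<open>The local formula concerns the filtration in the flat frame; invariance of the
    splitting under the frame carries it back to the fibres.\<close>
  have "eventually (\<lambda>z. deligne_delta eps tw Q (\<lambda>p. (*v) (mexp (\<Gamma> z)) ` ?F p)
      = ((\<lambda>s. deligne_delta eps tw Q (Fil s)) \<circ> chart_inv U chart i) z) (nhds (chart i s))"
    using eventually_ball
  proof eventually_elim
    case (elim z)
    have "chart_inv U chart i z \<in> U i" using inN[OF elim] Nb_props(3) by blast
    from delta_flat[OF this] show ?case unfolding fib[OF elim] by simp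
  qed
  from has_laplacian_cong[OF laplacian_delta this]
  have L: "has_laplacian ((\<lambda>s. deligne_delta eps tw Q (Fil s)) \<circ> chart_inv U chart i) (4 * biext_dual.r eps tw Q ?F e \<Gamma> (chart i s)) (chart i s)" .
  have gam: "gamma_m1_0 U chart eps tw Q frame Fil i s = gam"
    unfolding gam_def D_def by (rule gamma_m1_0_eq[OF split lift])
  show ?thesis
  proof (intro exI conjI)
    show "4 * biext_dual.r eps tw Q ?F e \<Gamma> (chart i s) \<ge> 0" using biext_dual.r(1)[OF biext_dual_axioms] by simp
    show "4 * biext_dual.r eps tw Q ?F e \<Gamma> (chart i s) = 0 \<longleftrightarrow> inf_invariant U chart eps tw Q frame Fil i s = 0 \<and>
      dual_inf_invariant_vanishes U chart eps tw Q frame Fil i s"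
      unfolding inf_invariant_def dual_inf_invariant_vanishes_def gam by (rule invariants_vanish_iff)
  qed (rule L)
qed

text \<open>The constant \<open>c\<close> allows for another normalization of the real coordinate;
  being positive, it keeps the sign of the Laplacian. The vanishing is that of the Laplacian in a
  chart. The value of the splitting is not governed by the invariants: applying \<open>gmap\<close>
  with one fixed parameter to all filtrations leaves \<open>\<Gamma>\<close>, the pairing and both
  invariants unchanged and shifts the splitting by a constant.\<close>

theorem corollary8p3:
  fixes S :: "'s topology"
    and U :: "'i \<Rightarrow> 's set"
    and chart :: "'i \<Rightarrow> 's \<Rightarrow> complex"
    and eps :: "complex ^ 'n::finite \<Rightarrow> complex"
    and tw :: "complex ^ 'n"
    and Q :: "complex ^ 'n \<Rightarrow> complex ^ 'n \<Rightarrow> complex"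
    and frame :: "'i \<Rightarrow> 's \<Rightarrow> complex ^ 'n ^ 'n"
    and Fil :: "'s \<Rightarrow> int \<Rightarrow> (complex ^ 'n) set"
    and c :: real
  assumes "curve S U chart"
    and "biext_variation S U chart eps tw Q frame Fil"
    and "self_dual S U eps tw Q frame Fil"
    and "c > 0"
  shows "subharmonic_on_curve U chart (\<lambda>s. c * deligne_delta eps tw Q (Fil s)) \<and>
    (\<forall>i. \<forall>s \<in> U i. \<exists>L.
       has_laplacian ((\<lambda>s. c * deligne_delta eps tw Q (Fil s)) \<circ> chart_inv U chart i) L (chart i s) \<and>
       (L = 0 \<longleftrightarrow>
          inf_invariant U chart eps tw Q frame Fil i s = 0 \<and>
          dual_inf_invariant_vanishes U chart eps tw Q frame Fil i s))"
proof -
  have main: "\<exists>L\<ge>0. has_laplacian ((\<lambda>s. c * deligne_delta eps tw Q (Fil s)) \<circ> chart_inv U chart i) L (chart i s) \<and>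
      (L = 0 \<longleftrightarrow> inf_invariant U chart eps tw Q frame Fil i s = 0 \<and>
        dual_inf_invariant_vanishes U chart eps tw Q frame Fil i s)" if s: "s \<in> U i" for i s
  proof -
    obtain L where L: "L \<ge> 0"
      "has_laplacian ((\<lambda>s. deligne_delta eps tw Q (Fil s)) \<circ> chart_inv U chart i) L (chart i s)"
      "L = 0 \<longleftrightarrow> inf_invariant U chart eps tw Q frame Fil i s = 0 \<and>
        dual_inf_invariant_vanishes U chart eps tw Q frame Fil i s"
      using delta_laplacian[OF assms(1-3) s] by blast
    have "(\<lambda>s. c * deligne_delta eps tw Q (Fil s)) \<circ> chart_inv U chart i
        = (\<lambda>z. c * ((\<lambda>s. deligne_delta eps tw Q (Fil s)) \<circ> chart_inv U chart i) z)" by auto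
    with has_laplacian_cmult[OF L(2), of c] L assms(4) show ?thesis
      by (intro exI[of _ "c * L"]) simp
  qed
  have "subharmonic_on_curve U chart (\<lambda>s. c * deligne_delta eps tw Q (Fil s))"
    unfolding subharmonic_on_curve_def
  proof
    fix i
    show "subharmonic_on (chart i ` U i) ((\<lambda>s. c * deligne_delta eps tw Q (Fil s)) \<circ> chart_inv U chart i)"
    proof (rule subharmonic_onI_laplacian)
      show "open (chart i ` U i)" using assms(1) by (simp add: curve_def)
    qed (use main in blast)
  qed
  with main show ?thesis by blast
qed

end
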